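(* Let $G$ and $H$ be groupoids and $G\amalg H$ their disjoint union. Define the $(G,G\amalg H)$-bi-set $X(1)$ by $X(1)_\gamma=G(-,\gamma)$ for $\gamma\in G_0$ and $X(1)_\eta=\varnothing$ for $\eta\in H_0$, and the $(G\amalg H,G)$-bi-set $Y(1)$ by $Y(1)^\gamma=G(\gamma,-)$ for $\gamma\in G_0$ and $Y(1)^\eta=\varnothing$ for $\eta\in H_0$; define the $(H,G\amalg H)$-bi-set $X(2)$ and the $(G\amalg H,H)$-bi-set $Y(2)$ similarly, with the roles of $G$ and $H$ exchanged. These bi-sets are admissible, and for every groupoid $K$ the functors $$\mathbf{B}(G\amalg H,K)\to\mathbf{B}(G,K)\times\mathbf{B}(H,K),\qquad Z\mapsto(Z\otimes_{G\amalg H}X(1),\,Z\otimes_{G\amalg H}X(2)),$$ $$\mathbf{B}(K,G\amalg H)\to\mathbf{B}(K,G)\times\mathbf{B}(K,H),\qquad Z\mapsto(Y(1)\otimes_{G\amalg H}Z,\,Y(2)\otimes_{G\amalg H}Z),$$ are equivalences of categories. Thus $G\amalg H$ serves as both the coproduct and the product of $G$ and $H$ in the bicategory $\mathbf{B}$.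
   Context: All groupoids are small; $G_0$ is the object set of $G$. A (left) $G$-set is a functor $X:G\to\mathbf{Set}$, with values $X_\gamma$ and action $x\mapsto gx$; a right $G$-set is a functor $Y:G^{\mathrm{op}}\to\mathbf{Set}$, with values $Y^\gamma$ and action $y\mapsto yg$. A $G$-set $X$ is free if for all $\gamma,\gamma'\in G_0$ and $x\in X_{\gamma'}$ the map $G(\gamma',\gamma)\to X_\gamma$, $g\mapsto gx$, is injective; it is finitely generated if $\mathrm{colim}_GX$ is finite. An $(H,G)$-bi-set is a functor $X:H^{\mathrm{op}}\times G\to\mathbf{Set}$, with values $X^\eta_\gamma$; it is admissible if for every $\eta\in H_0$ the $G$-set $X^\eta$ is free and finitely generated. For a right $H$-set $X$ and left $H$-set $Y$, $X\otimes_HY=\coprod_{\eta\in H_0}X^\eta\times Y_\eta/\sim$, with $(xh,y)\sim(x,hy)$. The bicategory $\mathbf{B}$ has groupoids as objects; $\mathbf{B}(H,G)$ is the groupoid of admissible $(H,G)$-bi-sets and natural isomorphisms; composition $\mathbf{B}(H,G)\times\mathbf{B}(K,H)\to\mathbf{B}(K,G)$ is $(X,Y)\mapsto X\otimes_HY$ with $(X\otimes_HY)^\kappa_\gamma=X_\gamma\otimes_HY^\kappa$; the identity is $(1_G)^{\gamma'}_\gamma=G(\gamma',\gamma)$. *)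

theory Defs
  imports "HOL-Library.FuncSet" "HOL-Library.Equipollence"
begin

record ('o, 'a) cat =
  Obj :: "'o set"
  Arr :: "'a set"
  Dom :: "'a \<Rightarrow> 'o"
  Cod :: "'a \<Rightarrow> 'o"
  Id :: "'o \<Rightarrow> 'a"
  Comp :: "'a \<Rightarrow> 'a \<Rightarrow> 'a"  \<comment> \<open>\<open>Comp C g f\<close> is \<open>g\<close> after \<open>f\<close>\<close>

definition hom :: "('o, 'a) cat \<Rightarrow> 'o \<Rightarrow> 'o \<Rightarrow> 'a set" where
  "hom C a b = {f \<in> Arr C. Dom C f = a \<and> Cod C f = b}"

definition is_iso :: "('o, 'a) cat \<Rightarrow> 'a \<Rightarrow> bool" where
  "is_iso C f \<longleftrightarrow> f \<in> Arr C \<and>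
     (\<exists>g \<in> hom C (Cod C f) (Dom C f).
        Comp C g f = Id C (Dom C f) \<and> Comp C f g = Id C (Cod C f))"

locale category =
  fixes C :: "('o, 'a) cat"
  assumes Dom_in: "f \<in> Arr C \<Longrightarrow> Dom C f \<in> Obj C"
    and Cod_in: "f \<in> Arr C \<Longrightarrow> Cod C f \<in> Obj C"
    and Id_in: "a \<in> Obj C \<Longrightarrow> Id C a \<in> hom C a a"
    and Comp_in: "f \<in> hom C a b \<Longrightarrow> g \<in> hom C b c \<Longrightarrow> Comp C g f \<in> hom C a c"
    and Comp_Id: "f \<in> hom C a b \<Longrightarrow> Comp C f (Id C a) = f"
    and Id_Comp: "f \<in> hom C a b \<Longrightarrow> Comp C (Id C b) f = f"
    and Comp_assoc: "f \<in> hom C a b \<Longrightarrow> g \<in> hom C b c \<Longrightarrow> h \<in> hom C c d \<Longrightarrow>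
      Comp C h (Comp C g f) = Comp C (Comp C h g) f"

locale groupoid = category +
  assumes Arr_iso: "f \<in> Arr C \<Longrightarrow> is_iso C f"

definition op_cat :: "('o, 'a) cat \<Rightarrow> ('o, 'a) cat" where
  "op_cat C = \<lparr>Obj = Obj C, Arr = Arr C, Dom = Cod C, Cod = Dom C, Id = Id C,
     Comp = (\<lambda>g f. Comp C f g)\<rparr>"

definition prod_cat :: "('o, 'a) cat \<Rightarrow> ('p, 'b) cat \<Rightarrow> ('o \<times> 'p, 'a \<times> 'b) cat" where
  "prod_cat C D = \<lparr>Obj = Obj C \<times> Obj D, Arr = Arr C \<times> Arr D,
     Dom = map_prod (Dom C) (Dom D), Cod = map_prod (Cod C) (Cod D),
     Id = map_prod (Id C) (Id D),
     Comp = (\<lambda>(g, g') (f, f'). (Comp C g f, Comp D g' f'))\<rparr>"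

definition coprod_cat :: "('o, 'a) cat \<Rightarrow> ('p, 'b) cat \<Rightarrow> ('o + 'p, 'a + 'b) cat"
    (infixr \<open>\<amalg>\<close> 65) where
  "C \<amalg> D = \<lparr>Obj = Obj C <+> Obj D, Arr = Arr C <+> Arr D,
     Dom = map_sum (Dom C) (Dom D), Cod = map_sum (Cod C) (Cod D),
     Id = map_sum (Id C) (Id D),
     Comp = (\<lambda>g f. case (g, f) of
         (Inl g, Inl f) \<Rightarrow> Inl (Comp C g f)
       | (Inr g, Inr f) \<Rightarrow> Inr (Comp D g f)
       | _ \<Rightarrow> undefined)\<rparr>"

record ('o, 'a, 'p, 'b) func =
  FObj :: "'o \<Rightarrow> 'p"
  FArr :: "'a \<Rightarrow> 'b"

text \<open>
  Functors and natural transformations are required to be extensional (\<open>undefined\<close> outside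
  the carriers), so that HOL equality is the mathematical equality.
\<close>

definition is_functor ::
    "('o, 'a) cat \<Rightarrow> ('p, 'b) cat \<Rightarrow> ('o, 'a, 'p, 'b) func \<Rightarrow> bool" where
  "is_functor C D F \<longleftrightarrow> category C \<and> category D \<and>
     FObj F \<in> Obj C \<rightarrow>\<^sub>E Obj D \<and> FArr F \<in> Arr C \<rightarrow>\<^sub>E Arr D \<and>
     (\<forall>f \<in> Arr C. FArr F f \<in> hom D (FObj F (Dom C f)) (FObj F (Cod C f))) \<and>
     (\<forall>a \<in> Obj C. FArr F (Id C a) = Id D (FObj F a)) \<and>
     (\<forall>f \<in> Arr C. \<forall>g \<in> Arr C. Dom C g = Cod C f \<longrightarrow>
        FArr F (Comp C g f) = Comp D (FArr F g) (FArr F f))"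

definition nat_trans :: "('o, 'a) cat \<Rightarrow> ('p, 'b) cat \<Rightarrow>
    ('o, 'a, 'p, 'b) func \<Rightarrow> ('o, 'a, 'p, 'b) func \<Rightarrow> ('o \<Rightarrow> 'b) \<Rightarrow> bool" where
  "nat_trans C D F F' \<tau> \<longleftrightarrow> is_functor C D F \<and> is_functor C D F' \<and>
     \<tau> \<in> extensional (Obj C) \<and>
     (\<forall>a \<in> Obj C. \<tau> a \<in> hom D (FObj F a) (FObj F' a)) \<and>
     (\<forall>f \<in> Arr C. Comp D (\<tau> (Cod C f)) (FArr F f) = Comp D (FArr F' f) (\<tau> (Dom C f)))"

definition nat_iso :: "('o, 'a) cat \<Rightarrow> ('p, 'b) cat \<Rightarrow>
    ('o, 'a, 'p, 'b) func \<Rightarrow> ('o, 'a, 'p, 'b) func \<Rightarrow> ('o \<Rightarrow> 'b) \<Rightarrow> bool" where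
  "nat_iso C D F F' \<tau> \<longleftrightarrow> nat_trans C D F F' \<tau> \<and> (\<forall>a \<in> Obj C. is_iso D (\<tau> a))"

definition id_func :: "('o, 'a) cat \<Rightarrow> ('o, 'a, 'o, 'a) func" where
  "id_func C = \<lparr>FObj = (\<lambda>a \<in> Obj C. a), FArr = (\<lambda>f \<in> Arr C. f)\<rparr>"

definition comp_func :: "('o, 'a) cat \<Rightarrow> ('p, 'b, 'q, 'c) func \<Rightarrow>
    ('o, 'a, 'p, 'b) func \<Rightarrow> ('o, 'a, 'q, 'c) func" where
  "comp_func C F' F = \<lparr>FObj = (\<lambda>a \<in> Obj C. FObj F' (FObj F a)),
     FArr = (\<lambda>f \<in> Arr C. FArr F' (FArr F f))\<rparr>"

definition pair_func :: "('o, 'a) cat \<Rightarrow> ('o, 'a, 'p, 'b) func \<Rightarrow>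
    ('o, 'a, 'q, 'c) func \<Rightarrow> ('o, 'a, 'p \<times> 'q, 'b \<times> 'c) func" where
  "pair_func C F F' = \<lparr>FObj = (\<lambda>a \<in> Obj C. (FObj F a, FObj F' a)),
     FArr = (\<lambda>f \<in> Arr C. (FArr F f, FArr F' f))\<rparr>"

definition is_equivalence ::
    "('o, 'a) cat \<Rightarrow> ('p, 'b) cat \<Rightarrow> ('o, 'a, 'p, 'b) func \<Rightarrow> bool" where
  "is_equivalence C D F \<longleftrightarrow> is_functor C D F \<and>
     (\<exists>F'. is_functor D C F' \<and>
        (\<exists>\<eta>. nat_iso C C (id_func C) (comp_func C F' F) \<eta>) \<and>
        (\<exists>\<epsilon>. nat_iso D D (comp_func D F F') (id_func D) \<epsilon>))"

text \<open>
  The type variable \<open>'u\<close> plays the role of the universe: \<open>set_cat\<close> consists of all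
  subsets of \<open>'u\<close> and all maps between them. Quotients such as the tensor product live over
  a larger type. An admissible bi-set into \<open>G\<close> embeds, in each value, into a finite disjoint
  union of hom-sets of \<open>G\<close>, so any infinite \<open>'u\<close> into which the hom-sets of \<open>G\<close> inject
  contains all admissible bi-sets up to isomorphism.
\<close>

type_synonym 'u setmap = "'u set \<times> ('u \<Rightarrow> 'u) \<times> 'u set"

definition set_cat :: "('u set, 'u setmap) cat" where
  "set_cat = \<lparr>Obj = UNIV, Arr = {(A, f, B). f \<in> A \<rightarrow>\<^sub>E B},
     Dom = fst, Cod = snd \<circ> snd, Id = (\<lambda>A. (A, (\<lambda>x \<in> A. x), A)),
     Comp = (\<lambda>(B', g, C) (A, f, B). (A, compose A g f, C))\<rparr>"

definition app :: "'u setmap \<Rightarrow> 'u \<Rightarrow> 'u" where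
  "app m = fst (snd m)"

type_synonym ('o, 'a, 'u) gset = "('o, 'a, 'u set, 'u setmap) func"

definition free_gset :: "('o, 'a) cat \<Rightarrow> ('o, 'a, 'u) gset \<Rightarrow> bool" where
  "free_gset G X \<longleftrightarrow> (\<forall>\<gamma> \<in> Obj G. \<forall>\<gamma>' \<in> Obj G. \<forall>x \<in> FObj X \<gamma>'.
     inj_on (\<lambda>g. app (FArr X g) x) (hom G \<gamma>' \<gamma>))"

definition equiv_gen :: "('a \<times> 'a) set \<Rightarrow> ('a \<times> 'a) set" where
  "equiv_gen r = (r \<union> r\<inverse>)\<^sup>*"

definition colim_rel ::
    "('o, 'a) cat \<Rightarrow> ('o, 'a, 'u) gset \<Rightarrow> (('o \<times> 'u) \<times> ('o \<times> 'u)) set" where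
  "colim_rel G X = {((Dom G g, x), (Cod G g, app (FArr X g) x)) | g x.
     g \<in> Arr G \<and> x \<in> FObj X (Dom G g)}"

definition colim :: "('o, 'a) cat \<Rightarrow> ('o, 'a, 'u) gset \<Rightarrow> ('o \<times> 'u) set set" where
  "colim G X = (SIGMA \<gamma>:Obj G. FObj X \<gamma>) // equiv_gen (colim_rel G X)"

definition fin_gen_gset :: "('o, 'a) cat \<Rightarrow> ('o, 'a, 'u) gset \<Rightarrow> bool" where
  "fin_gen_gset G X \<longleftrightarrow> finite (colim G X)"

text \<open>
  Tensor product of a right \<open>H\<close>-set \<open>X\<close> (a functor on \<open>op_cat H\<close>) and a left
  \<open>H\<close>-set \<open>Y\<close>; the relation identifies \<open>(x h, y)\<close> with \<open>(x, h y)\<close>.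
\<close>

definition tensor_rel :: "('o, 'a) cat \<Rightarrow> ('o, 'a, 'u) gset \<Rightarrow> ('o, 'a, 'v) gset \<Rightarrow>
    (('o \<times> 'u \<times> 'v) \<times> ('o \<times> 'u \<times> 'v)) set" where
  "tensor_rel H X Y =
     {((Dom H h, app (FArr X h) x, y), (Cod H h, x, app (FArr Y h) y)) | h x y.
        h \<in> Arr H \<and> x \<in> FObj X (Cod H h) \<and> y \<in> FObj Y (Dom H h)}"

definition tensor :: "('o, 'a) cat \<Rightarrow> ('o, 'a, 'u) gset \<Rightarrow> ('o, 'a, 'v) gset \<Rightarrow>
    ('o \<times> 'u \<times> 'v) set set" where
  "tensor H X Y = (SIGMA \<eta>:Obj H. FObj X \<eta> \<times> FObj Y \<eta>) // equiv_gen (tensor_rel H X Y)"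

text \<open>
  The map \<open>X \<otimes> Y \<rightarrow> X' \<otimes> Y'\<close> induced by natural \<open>\<phi> : X \<rightarrow> X'\<close> and \<open>\<psi> : Y \<rightarrow> Y'\<close>: a class
  is sent to the saturation of its image under \<open>\<phi> \<times> \<psi>\<close>, which is a single class.
\<close>

definition tensor_map :: "('o, 'a) cat \<Rightarrow>
    ('o, 'a, 'u) gset \<Rightarrow> ('o, 'a, 'v) gset \<Rightarrow> ('o, 'a, 'u) gset \<Rightarrow> ('o, 'a, 'v) gset \<Rightarrow>
    ('o \<Rightarrow> 'u setmap) \<Rightarrow> ('o \<Rightarrow> 'v setmap) \<Rightarrow> ('o \<times> 'u \<times> 'v) set setmap" where
  "tensor_map H X Y X' Y' \<phi> \<psi> =
     (tensor H X Y,
      (\<lambda>c \<in> tensor H X Y. equiv_gen (tensor_rel H X' Y') ``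
         ((\<lambda>(\<eta>, x, y). (\<eta>, app (\<phi> \<eta>) x, app (\<psi> \<eta>) y)) ` c)),
      tensor H X' Y')"

text \<open>
  In an \<open>(H, G)\<close>-bi-set \<open>X\<close>, the value at \<open>\<eta>\<close> (upper, contravariant) and \<open>\<gamma>\<close> (lower,
  covariant) is \<open>FObj X (\<eta>, \<gamma>)\<close>, and \<open>g x h\<close> is \<open>app (FArr X (h, g)) x\<close>.
\<close>

type_synonym ('ho, 'ha, 'go, 'ga, 'u) biset = "('ho \<times> 'go, 'ha \<times> 'ga, 'u set, 'u setmap) func"

definition is_biset ::
    "('ho, 'ha) cat \<Rightarrow> ('go, 'ga) cat \<Rightarrow> ('ho, 'ha, 'go, 'ga, 'u) biset \<Rightarrow> bool" where
  "is_biset H G X \<longleftrightarrow> is_functor (prod_cat (op_cat H) G) set_cat X"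

definition upper :: "('ho, 'ha) cat \<Rightarrow> ('go, 'ga) cat \<Rightarrow>
    ('ho, 'ha, 'go, 'ga, 'u) biset \<Rightarrow> 'ho \<Rightarrow> ('go, 'ga, 'u) gset" where
  "upper H G X \<eta> = \<lparr>FObj = (\<lambda>\<gamma> \<in> Obj G. FObj X (\<eta>, \<gamma>)),
     FArr = (\<lambda>g \<in> Arr G. FArr X (Id H \<eta>, g))\<rparr>"

definition lower :: "('ho, 'ha) cat \<Rightarrow> ('go, 'ga) cat \<Rightarrow>
    ('ho, 'ha, 'go, 'ga, 'u) biset \<Rightarrow> 'go \<Rightarrow> ('ho, 'ha, 'u) gset" where
  "lower H G X \<gamma> = \<lparr>FObj = (\<lambda>\<eta> \<in> Obj H. FObj X (\<eta>, \<gamma>)),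
     FArr = (\<lambda>h \<in> Arr H. FArr X (h, Id G \<gamma>))\<rparr>"

definition admissible ::
    "('ho, 'ha) cat \<Rightarrow> ('go, 'ga) cat \<Rightarrow> ('ho, 'ha, 'go, 'ga, 'u) biset \<Rightarrow> bool" where
  "admissible H G X \<longleftrightarrow> is_biset H G X \<and>
     (\<forall>\<eta> \<in> Obj H. free_gset G (upper H G X \<eta>) \<and> fin_gen_gset G (upper H G X \<eta>))"

type_synonym ('ho, 'ha, 'go, 'ga, 'u) biset_map =
  "('ho, 'ha, 'go, 'ga, 'u) biset \<times> ('ho \<times> 'go \<Rightarrow> 'u setmap) \<times> ('ho, 'ha, 'go, 'ga, 'u) biset"

type_synonym ('ho, 'ha, 'go, 'ga, 'u) biset_cat =
  "(('ho, 'ha, 'go, 'ga, 'u) biset, ('ho, 'ha, 'go, 'ga, 'u) biset_map) cat"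

definition BB ::
    "('ho, 'ha) cat \<Rightarrow> ('go, 'ga) cat \<Rightarrow> ('ho, 'ha, 'go, 'ga, 'u) biset_cat" where
  "BB H G = \<lparr>Obj = {X. admissible H G X},
     Arr = {(X, \<alpha>, X'). admissible H G X \<and> admissible H G X' \<and>
              nat_iso (prod_cat (op_cat H) G) set_cat X X' \<alpha>},
     Dom = fst, Cod = snd \<circ> snd,
     Id = (\<lambda>X. (X, (\<lambda>p \<in> Obj H \<times> Obj G. Id set_cat (FObj X p)), X)),
     Comp = (\<lambda>(Y', \<beta>, Z) (X, \<alpha>, Y).
       (X, (\<lambda>p \<in> Obj H \<times> Obj G. Comp set_cat (\<beta> p) (\<alpha> p)), Z))\<rparr>"

text \<open>
  \<open>biset_tensor K H G X Y\<close> is the composite of \<open>X\<close> in \<open>BB H G\<close> and \<open>Y\<close> in \<open>BB K H\<close>, and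
  \<open>biset_tensor_map K H G\<close> is the action of composition on pairs of 2-cells.
\<close>

definition biset_tensor :: "('ko, 'ka) cat \<Rightarrow> ('ho, 'ha) cat \<Rightarrow> ('go, 'ga) cat \<Rightarrow>
    ('ho, 'ha, 'go, 'ga, 'u) biset \<Rightarrow> ('ko, 'ka, 'ho, 'ha, 'v) biset \<Rightarrow>
    ('ko, 'ka, 'go, 'ga, ('ho \<times> 'u \<times> 'v) set) biset" where
  "biset_tensor K H G X Y =
     \<lparr>FObj = (\<lambda>(\<kappa>, \<gamma>) \<in> Obj K \<times> Obj G. tensor H (lower H G X \<gamma>) (upper K H Y \<kappa>)),
      FArr = (\<lambda>(k, g) \<in> Arr K \<times> Arr G.
        tensor_map H
          (lower H G X (Dom G g)) (upper K H Y (Cod K k))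
          (lower H G X (Cod G g)) (upper K H Y (Dom K k))
          (\<lambda>\<eta>. FArr X (Id H \<eta>, g)) (\<lambda>\<eta>. FArr Y (k, Id H \<eta>)))\<rparr>"

definition biset_tensor_map :: "('ko, 'ka) cat \<Rightarrow> ('ho, 'ha) cat \<Rightarrow> ('go, 'ga) cat \<Rightarrow>
    ('ho, 'ha, 'go, 'ga, 'u) biset_map \<Rightarrow> ('ko, 'ka, 'ho, 'ha, 'v) biset_map \<Rightarrow>
    ('ko, 'ka, 'go, 'ga, ('ho \<times> 'u \<times> 'v) set) biset_map" where
  "biset_tensor_map K H G = (\<lambda>(X, \<alpha>, X') (Y, \<beta>, Y').
     (biset_tensor K H G X Y,
      (\<lambda>(\<kappa>, \<gamma>) \<in> Obj K \<times> Obj G.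
        tensor_map H
          (lower H G X \<gamma>) (upper K H Y \<kappa>) (lower H G X' \<gamma>) (upper K H Y' \<kappa>)
          (\<lambda>\<eta>. \<alpha> (\<eta>, \<gamma>)) (\<lambda>\<eta>. \<beta> (\<kappa>, \<eta>))),
      biset_tensor K H G X' Y'))"

text \<open>\<open>Z \<mapsto> Z \<otimes> X\<close> from \<open>BB H G\<close> to \<open>BB K G\<close>, for \<open>X\<close> in \<open>BB K H\<close>.\<close>

definition tensor_on_right :: "('ko, 'ka) cat \<Rightarrow> ('ho, 'ha) cat \<Rightarrow> ('go, 'ga) cat \<Rightarrow>
    ('ko, 'ka, 'ho, 'ha, 'v) biset \<Rightarrow>
    (('ho, 'ha, 'go, 'ga, 'u) biset, ('ho, 'ha, 'go, 'ga, 'u) biset_map,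
     ('ko, 'ka, 'go, 'ga, ('ho \<times> 'u \<times> 'v) set) biset,
     ('ko, 'ka, 'go, 'ga, ('ho \<times> 'u \<times> 'v) set) biset_map) func" where
  "tensor_on_right K H G X =
     \<lparr>FObj = (\<lambda>Z \<in> Obj (BB H G). biset_tensor K H G Z X),
      FArr = (\<lambda>\<alpha> \<in> Arr (BB H G). biset_tensor_map K H G \<alpha> (Id (BB K H) X))\<rparr>"

text \<open>\<open>Z \<mapsto> Y \<otimes> Z\<close> from \<open>BB K H\<close> to \<open>BB K G\<close>, for \<open>Y\<close> in \<open>BB H G\<close>.\<close>

definition tensor_on_left :: "('ko, 'ka) cat \<Rightarrow> ('ho, 'ha) cat \<Rightarrow> ('go, 'ga) cat \<Rightarrow>
    ('ho, 'ha, 'go, 'ga, 'u) biset \<Rightarrow>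
    (('ko, 'ka, 'ho, 'ha, 'v) biset, ('ko, 'ka, 'ho, 'ha, 'v) biset_map,
     ('ko, 'ka, 'go, 'ga, ('ho \<times> 'u \<times> 'v) set) biset,
     ('ko, 'ka, 'go, 'ga, ('ho \<times> 'u \<times> 'v) set) biset_map) func" where
  "tensor_on_left K H G Y =
     \<lparr>FObj = (\<lambda>Z \<in> Obj (BB K H). biset_tensor K H G Y Z),
      FArr = (\<lambda>\<alpha> \<in> Arr (BB K H). biset_tensor_map K H G (Id (BB H G) Y) \<alpha>)\<rparr>"

definition hom_map :: "('o, 'a) cat \<Rightarrow> 'a \<Rightarrow> 'a \<Rightarrow> 'a setmap" where
  "hom_map G h g =
     (hom G (Cod G h) (Dom G g),
      (\<lambda>x \<in> hom G (Cod G h) (Dom G g). Comp G g (Comp G x h)),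
      hom G (Dom G h) (Cod G g))"

definition X1 :: "('go, 'ga) cat \<Rightarrow> ('ho, 'ha) cat \<Rightarrow>
    ('go, 'ga, 'go + 'ho, 'ga + 'ha, 'ga) biset" where
  "X1 G H =
     \<lparr>FObj = (\<lambda>(\<gamma>', c) \<in> Obj G \<times> Obj (G \<amalg> H).
        case c of Inl \<gamma> \<Rightarrow> hom G \<gamma>' \<gamma> | Inr \<eta> \<Rightarrow> {}),
      FArr = (\<lambda>(h, c) \<in> Arr G \<times> Arr (G \<amalg> H).
        case c of Inl g \<Rightarrow> hom_map G h g | Inr _ \<Rightarrow> Id set_cat {})\<rparr>"

definition X2 :: "('go, 'ga) cat \<Rightarrow> ('ho, 'ha) cat \<Rightarrow>
    ('ho, 'ha, 'go + 'ho, 'ga + 'ha, 'ha) biset" where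
  "X2 G H =
     \<lparr>FObj = (\<lambda>(\<eta>', c) \<in> Obj H \<times> Obj (G \<amalg> H).
        case c of Inl \<gamma> \<Rightarrow> {} | Inr \<eta> \<Rightarrow> hom H \<eta>' \<eta>),
      FArr = (\<lambda>(h, c) \<in> Arr H \<times> Arr (G \<amalg> H).
        case c of Inl _ \<Rightarrow> Id set_cat {} | Inr g \<Rightarrow> hom_map H h g)\<rparr>"

definition Y1 :: "('go, 'ga) cat \<Rightarrow> ('ho, 'ha) cat \<Rightarrow>
    ('go + 'ho, 'ga + 'ha, 'go, 'ga, 'ga) biset" where
  "Y1 G H =
     \<lparr>FObj = (\<lambda>(c, \<gamma>') \<in> Obj (G \<amalg> H) \<times> Obj G.
        case c of Inl \<gamma> \<Rightarrow> hom G \<gamma> \<gamma>' | Inr \<eta> \<Rightarrow> {}),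
      FArr = (\<lambda>(c, g) \<in> Arr (G \<amalg> H) \<times> Arr G.
        case c of Inl h \<Rightarrow> hom_map G h g | Inr _ \<Rightarrow> Id set_cat {})\<rparr>"

definition Y2 :: "('go, 'ga) cat \<Rightarrow> ('ho, 'ha) cat \<Rightarrow>
    ('go + 'ho, 'ga + 'ha, 'ho, 'ha, 'ha) biset" where
  "Y2 G H =
     \<lparr>FObj = (\<lambda>(c, \<eta>') \<in> Obj (G \<amalg> H) \<times> Obj H.
        case c of Inl \<gamma> \<Rightarrow> {} | Inr \<eta> \<Rightarrow> hom H \<eta> \<eta>'),
      FArr = (\<lambda>(c, g) \<in> Arr (G \<amalg> H) \<times> Arr H.
        case c of Inl _ \<Rightarrow> Id set_cat {} | Inr h \<Rightarrow> hom_map H h g)\<rparr>"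

end

(*
  Bi-sets into or out of G \<amalg> H are functors on a category that is the disjoint union of two
  full subcategories, one for G and one for H, so they amount to pairs of functors on the two
  parts, and admissibility is checked on the parts. By the co-Yoneda lemma, tensoring with X(i)
  or Y(i) is naturally isomorphic to restriction to the i-th part; since hom-sets between such
  functors split accordingly, the functor in question is full and faithful. It is essentially
  surjective because an admissible bi-set has values that are covered by finitely many hom-sets,
  so that it can be transported into the given universe before glueing.
*)
theory Submission
  imports Defs
begin

section \<open>Groupoids and equivalences\<close>

text \<open>The tensor product of bi-sets over \<open>'u\<close> has values in a larger type, so the
  functors under study change universe and \<open>nat_iso\<close> cannot compare them with
  restriction. Isomorphisms are therefore handled elementwise, by \<open>set_iso\<close>, which may
  change universe, and only essential surjectivity needs to bring a given bi-set back into
  \<open>'u\<close>. This is where the infinity of \<open>'u\<close> and the injections of hom-sets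
  into \<open>'u\<close> enter. Admissibility is a condition on the covariant variable alone, so the
  relevant hom-sets are those of \<open>K\<close> for bi-sets out of G \<amalg> H, and those of
  \<open>G\<close> and \<open>H\<close> for bi-sets into it. The same asymmetry shapes the check of
  admissibility on the parts. Splitting the contravariant variable leaves every \<open>K\<close>-set
  as it is. Splitting the covariant variable cuts each set into a \<open>G\<close>-set and an
  \<open>H\<close>-set, and a finite generating set must be cut or joined accordingly; this is
  easier with generators than with the colimit.\<close>

lemma hom_iff: "f \<in> hom C a b \<longleftrightarrow> f \<in> Arr C \<and> Dom C f = a \<and> Cod C f = b"
  by (simp add: hom_def)

lemma (in category) hom_obj: "f \<in> hom C a b \<Longrightarrow> a \<in> Obj C \<and> b \<in> Obj C"
  using Dom_in Cod_in by (auto simp: hom_def)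

lemma (in category) Arr_hom: "f \<in> Arr C \<Longrightarrow> f \<in> hom C (Dom C f) (Cod C f)"
  by (auto simp: hom_def)

definition inverse_arr :: "('o, 'a) cat \<Rightarrow> 'a \<Rightarrow> 'a" where
  "inverse_arr C f = (SOME g. g \<in> hom C (Cod C f) (Dom C f) \<and>
     Comp C g f = Id C (Dom C f) \<and> Comp C f g = Id C (Cod C f))"

lemma (in groupoid) inverse_arr:
  assumes "f \<in> hom C a b"
  shows "inverse_arr C f \<in> hom C b a" "Comp C (inverse_arr C f) f = Id C a"
    "Comp C f (inverse_arr C f) = Id C b"
proof -
  have "\<exists>g. g \<in> hom C (Cod C f) (Dom C f) \<and>
     Comp C g f = Id C (Dom C f) \<and> Comp C f g = Id C (Cod C f)"
    using Arr_iso[of f] assms unfolding is_iso_def hom_def by auto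
  from someI_ex[OF this] show "inverse_arr C f \<in> hom C b a" "Comp C (inverse_arr C f) f = Id C a"
    "Comp C f (inverse_arr C f) = Id C b"
    using assms by (auto simp: inverse_arr_def hom_iff)
qed

lemma (in groupoid) Comp_inverse_cancel:
  assumes "f \<in> hom C a b"
  shows "g \<in> hom C c b \<Longrightarrow> Comp C f (Comp C (inverse_arr C f) g) = g"
    "h \<in> hom C c a \<Longrightarrow> Comp C (inverse_arr C f) (Comp C f h) = h"
  using Comp_assoc[OF _ inverse_arr(1)[OF assms] assms] Comp_assoc[OF _ assms inverse_arr(1)[OF assms]]
    inverse_arr(2,3)[OF assms] Id_Comp by auto

lemma is_functorD:
  assumes "is_functor C D F"
  shows "category C" "category D"
    "a \<in> Obj C \<Longrightarrow> FObj F a \<in> Obj D"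
    "f \<in> hom C a b \<Longrightarrow> FArr F f \<in> hom D (FObj F a) (FObj F b)"
    "a \<in> Obj C \<Longrightarrow> FArr F (Id C a) = Id D (FObj F a)"
    "f \<in> hom C a b \<Longrightarrow> g \<in> hom C b c \<Longrightarrow> FArr F (Comp C g f) = Comp D (FArr F g) (FArr F f)"
  using assms unfolding is_functor_def by (auto simp: hom_iff)

lemma is_functorI:
  assumes "category C" "category D"
    and "FObj F \<in> extensional (Obj C)" "FArr F \<in> extensional (Arr C)"
    and obj: "\<And>a. a \<in> Obj C \<Longrightarrow> FObj F a \<in> Obj D"
    and arr: "\<And>f a b. f \<in> hom C a b \<Longrightarrow> FArr F f \<in> hom D (FObj F a) (FObj F b)"
    and ident: "\<And>a. a \<in> Obj C \<Longrightarrow> FArr F (Id C a) = Id D (FObj F a)"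
    and comp: "\<And>f g a b c. f \<in> hom C a b \<Longrightarrow> g \<in> hom C b c \<Longrightarrow>
      FArr F (Comp C g f) = Comp D (FArr F g) (FArr F f)"
  shows "is_functor C D F"
proof -
  have "FArr F f \<in> hom D (FObj F (Dom C f)) (FObj F (Cod C f))" if "f \<in> Arr C" for f
    using arr that by (simp add: hom_iff)
  moreover have "FArr F (Comp C g f) = Comp D (FArr F g) (FArr F f)"
    if "f \<in> Arr C" "g \<in> Arr C" "Dom C g = Cod C f" for f g
    using comp[of f "Dom C f" "Cod C f" g "Cod C g"] that by (auto simp: hom_iff)
  ultimately show ?thesis
    unfolding is_functor_def PiE_def using assms by (auto simp: hom_iff)
qed

section \<open>Opposites, products and disjoint unions of groupoids\<close>

lemma category_op: "category C \<Longrightarrow> category (op_cat C)"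
  unfolding category_def op_cat_def hom_def by simp

lemma prod_hom: "f \<in> hom (prod_cat C D) a b \<longleftrightarrow>
    fst f \<in> hom C (fst a) (fst b) \<and> snd f \<in> hom D (snd a) (snd b)"
  by (cases f; cases a; cases b) (auto simp: prod_cat_def hom_def)

lemma prod_simps [simp]:
  "Obj (prod_cat C D) = Obj C \<times> Obj D" "Arr (prod_cat C D) = Arr C \<times> Arr D"
  "Dom (prod_cat C D) f = (Dom C (fst f), Dom D (snd f))"
  "Cod (prod_cat C D) f = (Cod C (fst f), Cod D (snd f))"
  "Id (prod_cat C D) a = (Id C (fst a), Id D (snd a))"
  "Comp (prod_cat C D) g f = (Comp C (fst g) (fst f), Comp D (snd g) (snd f))"
  by (auto simp: prod_cat_def map_prod_def split: prod.splits)

lemma op_simps [simp]: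
  "Obj (op_cat C) = Obj C" "Arr (op_cat C) = Arr C" "Dom (op_cat C) f = Cod C f"
  "Cod (op_cat C) f = Dom C f" "Id (op_cat C) a = Id C a" "Comp (op_cat C) g f = Comp C f g"
  "hom (op_cat C) a b = hom C b a"
  by (auto simp: op_cat_def hom_def)

lemma category_prod:
  assumes "category C" "category D" shows "category (prod_cat C D)"
proof -
  interpret C: category C by fact
  interpret D: category D by fact
  show ?thesis
    by unfold_locales
      (auto simp: prod_hom C.Dom_in D.Dom_in C.Cod_in D.Cod_in C.Id_in D.Id_in C.Comp_Id D.Comp_Id
        C.Id_Comp D.Id_Comp intro: C.Comp_in D.Comp_in C.Comp_assoc D.Comp_assoc)
qed

lemma groupoid_prod:
  assumes "groupoid C" "groupoid D" shows "groupoid (prod_cat C D)"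
proof -
  interpret C: groupoid C by fact
  interpret D: groupoid D by fact
  interpret CD: category "prod_cat C D"
    by (intro category_prod C.category_axioms D.category_axioms)
  show ?thesis
  proof
    fix f assume "f \<in> Arr (prod_cat C D)"
    then have f: "fst f \<in> Arr C" "snd f \<in> Arr D" by auto
    show "is_iso (prod_cat C D) f"
      unfolding is_iso_def
      using C.inverse_arr[OF C.Arr_hom[OF f(1)]] D.inverse_arr[OF D.Arr_hom[OF f(2)]] f
      by (auto simp: prod_hom mem_Times_iff
        intro!: bexI[of _ "(inverse_arr C (fst f), inverse_arr D (snd f))"])
  qed
qed

lemma coprod_simps [simp]:
  "Obj (C \<amalg> D) = Obj C <+> Obj D" "Arr (C \<amalg> D) = Arr C <+> Arr D"
  "Dom (C \<amalg> D) (Inl f) = Inl (Dom C f)" "Dom (C \<amalg> D) (Inr g) = Inr (Dom D g)"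
  "Cod (C \<amalg> D) (Inl f) = Inl (Cod C f)" "Cod (C \<amalg> D) (Inr g) = Inr (Cod D g)"
  "Id (C \<amalg> D) (Inl a) = Inl (Id C a)" "Id (C \<amalg> D) (Inr b) = Inr (Id D b)"
  "Comp (C \<amalg> D) (Inl f) (Inl f') = Inl (Comp C f f')"
  "Comp (C \<amalg> D) (Inr g) (Inr g') = Inr (Comp D g g')"
  by (auto simp: coprod_cat_def)

lemma coprod_hom:
  "f \<in> hom (C \<amalg> D) a b \<longleftrightarrow>
     (\<exists>f' a' b'. f = Inl f' \<and> a = Inl a' \<and> b = Inl b' \<and> f' \<in> hom C a' b') \<or>
     (\<exists>f' a' b'. f = Inr f' \<and> a = Inr a' \<and> b = Inr b' \<and> f' \<in> hom D a' b')"
  by (cases f) (auto simp: hom_def)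

lemma groupoid_coprod:
  assumes "groupoid C" "groupoid D" shows "groupoid (C \<amalg> D)"
proof -
  interpret C: groupoid C by fact
  interpret D: groupoid D by fact
  interpret CD: category "C \<amalg> D"
    by unfold_locales
      (auto simp: coprod_hom C.Dom_in D.Dom_in C.Cod_in D.Cod_in C.Id_in D.Id_in C.Comp_Id D.Comp_Id
        C.Id_Comp D.Id_Comp intro: C.Comp_in D.Comp_in C.Comp_assoc D.Comp_assoc)
  show ?thesis
  proof
    fix f assume "f \<in> Arr (C \<amalg> D)"
    then show "is_iso (C \<amalg> D) f"
      unfolding is_iso_def Bex_def coprod_hom
      using C.inverse_arr[OF C.Arr_hom] D.inverse_arr[OF D.Arr_hom]
      by (cases f) (fastforce simp: coprod_hom)+
  qed
qed

text \<open>A quasi-inverse is built by choice from fullness, faithfulness and essential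
  surjectivity. The condition \<open>surj\<close> asks for a mere arrow because all arrows of
  \<open>D\<close> are invertible.\<close>

lemma equivalenceI:
  assumes "groupoid C" "groupoid D" and F: "is_functor C D F"
    and faithful: "\<And>a b f g. f \<in> hom C a b \<Longrightarrow> g \<in> hom C a b \<Longrightarrow> FArr F f = FArr F g \<Longrightarrow> f = g"
    and full: "\<And>a b h. a \<in> Obj C \<Longrightarrow> b \<in> Obj C \<Longrightarrow> h \<in> hom D (FObj F a) (FObj F b) \<Longrightarrow>
      \<exists>f \<in> hom C a b. FArr F f = h"
    and surj: "\<And>d. d \<in> Obj D \<Longrightarrow> \<exists>c \<in> Obj C. \<exists>e. e \<in> hom D (FObj F c) d"
  shows "is_equivalence C D F"
proof -
  interpret C: groupoid C by fact
  interpret D: groupoid D by fact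
  note F_obj = is_functorD(3)[OF F] and F_arr = is_functorD(4)[OF F]
    and F_id = is_functorD(5)[OF F] and F_comp = is_functorD(6)[OF F]
  obtain p e where p: "\<And>d. d \<in> Obj D \<Longrightarrow> p d \<in> Obj C"
    and e: "\<And>d. d \<in> Obj D \<Longrightarrow> e d \<in> hom D (FObj F (p d)) d"
    using surj by metis
  obtain L where L: "\<And>a b h. a \<in> Obj C \<Longrightarrow> b \<in> Obj C \<Longrightarrow> h \<in> hom D (FObj F a) (FObj F b) \<Longrightarrow>
      L a b h \<in> hom C a b \<and> FArr F (L a b h) = h"
    using full by metis
  let ?i = "inverse_arr D"
  \<comment> \<open>\<open>q d d' h\<close> is \<open>h\<close> conjugated by the chosen
    isomorphisms \<open>e\<close>; its lift along \<open>F\<close> will be the value of the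
    quasi-inverse at \<open>h\<close>.\<close>
  define q where "q d d' h = Comp D (?i (e d')) (Comp D h (e d))" for d d' h
  have q: "q d d' h \<in> hom D (FObj F (p d)) (FObj F (p d'))"
    and e_q: "Comp D (e d') (q d d' h) = Comp D h (e d)" if "h \<in> hom D d d'" for d d' h
  proof -
    have dd: "d \<in> Obj D" "d' \<in> Obj D" using D.hom_obj that by auto
    show "q d d' h \<in> hom D (FObj F (p d)) (FObj F (p d'))"
      unfolding q_def using dd e that D.inverse_arr(1) D.Comp_in by meson
    show "Comp D (e d') (q d d' h) = Comp D h (e d)"
      unfolding q_def using dd e that D.Comp_inverse_cancel(1) D.Comp_in by meson
  qed
  have e_cancel: "u = v" if "d \<in> Obj D" "u \<in> hom D c (FObj F (p d))" "v \<in> hom D c (FObj F (p d))"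
    "Comp D (e d) u = Comp D (e d) v" for d u v c
    using D.Comp_inverse_cancel(2)[OF e[OF that(1)]] that by metis
  define F' where "F' = \<lparr>FObj = (\<lambda>d \<in> Obj D. p d),
    FArr = (\<lambda>h \<in> Arr D. L (p (Dom D h)) (p (Cod D h)) (q (Dom D h) (Cod D h) h))\<rparr>"
  have F'_obj: "FObj F' d = p d" if "d \<in> Obj D" for d using that by (simp add: F'_def)
  have F'_arr: "FArr F' h \<in> hom C (p d) (p d')" "FArr F (FArr F' h) = q d d' h"
    if "h \<in> hom D d d'" for h d d'
    using L[OF p p q[OF that]] D.hom_obj[OF that] that by (auto simp: F'_def hom_iff)
  have eF': "Comp D (e d') (FArr F (FArr F' h)) = Comp D h (e d)" if "h \<in> hom D d d'" for h d d'
    using F'_arr(2)[OF that] e_q[OF that] by simp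
  \<comment> \<open>As \<open>e d'\<close> is invertible and \<open>F\<close> is faithful,
    \<open>FArr F' h\<close> is the only arrow making the square with \<open>e\<close> commute. Both
    functor laws of \<open>F'\<close> then reduce to pasting such squares.\<close>
  have F'_eqI: "u = FArr F' h" if h: "h \<in> hom D d d'" and u: "u \<in> hom C (p d) (p d')"
    and eq: "Comp D (e d') (FArr F u) = Comp D h (e d)" for u h d d'
  proof (rule faithful[OF u F'_arr(1)[OF h]], rule e_cancel)
    show "d' \<in> Obj D" using D.hom_obj h by auto
  qed (use h u eq F_arr F'_arr(1)[OF h] eF'[OF h] in auto)
  have F': "is_functor D C F'"
  proof (rule is_functorI)
    show "FObj F' \<in> extensional (Obj D)" "FArr F' \<in> extensional (Arr D)"
      by (simp_all add: F'_def)
    show "FArr F' h \<in> hom C (FObj F' a) (FObj F' b)" if "h \<in> hom D a b" for h a b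
      using F'_arr(1)[OF that] F'_obj D.hom_obj[OF that] by simp
    show "FArr F' (Id D a) = Id C (FObj F' a)" if a: "a \<in> Obj D" for a
    proof -
      have "Id C (p a) = FArr F' (Id D a)"
        using F'_eqI[OF D.Id_in[OF a] C.Id_in[OF p[OF a]]] F_id[OF p[OF a]] e[OF a]
          D.Comp_Id D.Id_Comp by metis
      then show ?thesis using F'_obj a by simp
    qed
    show "FArr F' (Comp D g f) = Comp C (FArr F' g) (FArr F' f)"
      if f: "f \<in> hom D a b" and g: "g \<in> hom D b c" for f g a b c
    proof (rule F'_eqI[symmetric])
      show "Comp D g f \<in> hom D a c" using D.Comp_in f g by blast
      show "Comp C (FArr F' g) (FArr F' f) \<in> hom C (p a) (p c)"
        using C.Comp_in F'_arr(1) f g by blast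
      have obj: "a \<in> Obj D" "b \<in> Obj D" "c \<in> Obj D" using D.hom_obj f g by auto
      note h = F_arr[OF F'_arr(1)[OF f]] F_arr[OF F'_arr(1)[OF g]] e[OF obj(1)] e[OF obj(2)]
        e[OF obj(3)]
      have "Comp D (e c) (FArr F (Comp C (FArr F' g) (FArr F' f))) =
          Comp D (e c) (Comp D (FArr F (FArr F' g)) (FArr F (FArr F' f)))"
        using F_comp[OF F'_arr(1)[OF f] F'_arr(1)[OF g]] by simp
      also have "\<dots> = Comp D (Comp D g (e b)) (FArr F (FArr F' f))"
        using D.Comp_assoc[OF h(1,2,5)] eF'[OF g] by simp
      also have "\<dots> = Comp D g (Comp D f (e a))"
        using D.Comp_assoc[OF h(1,4) g] eF'[OF f] by simp
      finally show "Comp D (e c) (FArr F (Comp C (FArr F' g) (FArr F' f))) =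
          Comp D (Comp D g f) (e a)"
        using D.Comp_assoc[OF h(3) f g] by simp
    qed
  qed (use p F'_obj C.category_axioms D.category_axioms in auto)
  have id_functor: "is_functor A A (id_func A)" if "category A" for A :: "('s, 't) cat"
    using that category.hom_obj[OF that] category.Id_in[OF that] category.Comp_in[OF that]
    by (intro is_functorI) (auto simp: id_func_def hom_iff)
  have comp_functor: "is_functor A A'' (comp_func A S T)"
    if T: "is_functor A A' T" and S: "is_functor A' A'' S"
    for A :: "('s, 't) cat" and A' :: "('s1, 't1) cat" and A'' :: "('s2, 't2) cat" and S T
  proof -
    interpret A: category A using is_functorD(1)[OF T] .
    note [simp] = is_functorD(3,5)[OF T] is_functorD(3,5)[OF S]
    show ?thesis
    proof (rule is_functorI)
      show "FArr (comp_func A S T) f \<in> hom A'' (FObj (comp_func A S T) a) (FObj (comp_func A S T) b)"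
        if "f \<in> hom A a b" for f a b
        using is_functorD(4)[OF S is_functorD(4)[OF T that]] A.hom_obj[OF that] that
        by (simp add: comp_func_def hom_iff)
      show "FArr (comp_func A S T) (Id A a) = Id A'' (FObj (comp_func A S T) a)"
        if "a \<in> Obj A" for a
        using that A.Id_in[OF that] by (simp add: comp_func_def hom_iff)
      show "FArr (comp_func A S T) (Comp A g f) =
          Comp A'' (FArr (comp_func A S T) g) (FArr (comp_func A S T) f)"
        if "f \<in> hom A a b" "g \<in> hom A b c" for f g a b c
        using is_functorD(6)[OF T that] A.Comp_in[OF that] that
          is_functorD(6)[OF S is_functorD(4)[OF T that(1)] is_functorD(4)[OF T that(2)]]
        by (simp add: comp_func_def hom_iff)
    qed (use is_functorD(1)[OF T] is_functorD(2)[OF S] in \<open>auto simp: comp_func_def\<close>)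
  qed
  \<comment> \<open>The counit will be \<open>e\<close> itself, and the unit is the lift of its
    inverse at the objects \<open>FObj F a\<close>.\<close>
  define \<eta> where "\<eta> = (\<lambda>a \<in> Obj C. L a (p (FObj F a)) (?i (e (FObj F a))))"
  have \<eta>: "\<eta> a \<in> hom C a (p (FObj F a))" "FArr F (\<eta> a) = ?i (e (FObj F a))" if "a \<in> Obj C" for a
    using L[of a "p (FObj F a)" "?i (e (FObj F a))"] that p F_obj e D.inverse_arr(1)
    by (auto simp: \<eta>_def)
  have \<eta>_nat: "Comp C (\<eta> b) f = Comp C (FArr F' (FArr F f)) (\<eta> a)" if f: "f \<in> hom C a b" for f a b
  proof -
    have ab: "a \<in> Obj C" "b \<in> Obj C" using C.hom_obj f by auto
    note Fab = F_obj[OF ab(1)] F_obj[OF ab(2)]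
    note Ff = F_arr[OF f] and F'Ff = F'_arr(1)[OF F_arr[OF f]]
    note ea = e[OF Fab(1)] and eb = e[OF Fab(2)]
    show ?thesis
    proof (rule faithful)
      show "Comp C (\<eta> b) f \<in> hom C a (p (FObj F b))"
        using C.Comp_in f \<eta>(1) ab by blast
      show "Comp C (FArr F' (FArr F f)) (\<eta> a) \<in> hom C a (p (FObj F b))"
        using C.Comp_in F'Ff \<eta>(1) ab by blast
      show "FArr F (Comp C (\<eta> b) f) = FArr F (Comp C (FArr F' (FArr F f)) (\<eta> a))"
      proof (rule e_cancel)
        note ia = D.inverse_arr(1)[OF ea] and ib = D.inverse_arr(1)[OF eb]
        have l: "FArr F (Comp C (\<eta> b) f) = Comp D (?i (e (FObj F b))) (FArr F f)"
          using F_comp[OF f \<eta>(1)[OF ab(2)]] \<eta>(2) ab by simp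
        have r: "FArr F (Comp C (FArr F' (FArr F f)) (\<eta> a)) =
            Comp D (FArr F (FArr F' (FArr F f))) (?i (e (FObj F a)))"
          using F_comp[OF \<eta>(1)[OF ab(1)] F'Ff] \<eta>(2) ab by simp
        show "FArr F (Comp C (\<eta> b) f) \<in> hom D (FObj F a) (FObj F (p (FObj F b)))"
          unfolding l using D.Comp_in[OF Ff ib] .
        show "FArr F (Comp C (FArr F' (FArr F f)) (\<eta> a)) \<in> hom D (FObj F a) (FObj F (p (FObj F b)))"
          unfolding r using D.Comp_in[OF ia F_arr[OF F'Ff]] .
        show "Comp D (e (FObj F b)) (FArr F (Comp C (\<eta> b) f)) =
          Comp D (e (FObj F b)) (FArr F (Comp C (FArr F' (FArr F f)) (\<eta> a)))"
          unfolding l r D.Comp_inverse_cancel(1)[OF eb Ff] D.Comp_assoc[OF ia F_arr[OF F'Ff] eb]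
            eF'[OF Ff] D.Comp_assoc[OF ia ea Ff, symmetric] D.inverse_arr(3)[OF ea] D.Comp_Id[OF Ff]
          by simp
      qed (use Fab in auto)
    qed
  qed
  have "nat_iso C C (id_func C) (comp_func C F' F) \<eta>"
    unfolding nat_iso_def nat_trans_def
    using id_functor[OF C.category_axioms] comp_functor[OF F F'] \<eta>(1) \<eta>_nat F'_obj[OF F_obj]
      C.Arr_iso C.Arr_hom
    by (auto simp: id_func_def comp_func_def \<eta>_def hom_iff)
  moreover have "nat_iso D D (comp_func D F F') (id_func D) (\<lambda>d \<in> Obj D. e d)"
    unfolding nat_iso_def nat_trans_def
    using id_functor[OF D.category_axioms] comp_functor[OF F' F] e eF' F'_obj
      D.Arr_iso D.Arr_hom D.Dom_in D.Cod_in
    by (auto simp: id_func_def comp_func_def hom_iff)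
  ultimately show ?thesis unfolding is_equivalence_def using F F' by blast
qed

section \<open>Set-valued functors\<close>

abbreviation act :: "('o, 'a, 'u) gset \<Rightarrow> 'a \<Rightarrow> 'u \<Rightarrow> 'u" where
  "act X f \<equiv> app (FArr X f)"

lemma set_hom: "m \<in> hom set_cat A B \<longleftrightarrow> (\<exists>f. m = (A, f, B) \<and> f \<in> A \<rightarrow>\<^sub>E B)"
  by (cases m) (auto simp: set_cat_def hom_def)

lemma app_simp [simp]: "app (A, f, B) = f"
  by (simp add: app_def)

lemma set_cat_simps [simp]:
  "Obj set_cat = UNIV" "Id set_cat A = (A, (\<lambda>x \<in> A. x), A)"
  "Comp set_cat (B', g, C) (A, f, B) = (A, compose A g f, C)"
  "Dom set_cat m = fst m" "Cod set_cat m = snd (snd m)"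
  "(A, f, B) \<in> Arr set_cat \<longleftrightarrow> f \<in> A \<rightarrow>\<^sub>E B"
  by (auto simp: set_cat_def)

lemma category_set_cat: "category set_cat"
  by unfold_locales
    (auto simp: set_hom hom_def compose_def PiE_iff extensional_def fun_eq_iff restrict_def
      set_cat_def)

text \<open>By extensionality a map of sets is recovered from its values on elements, so that from
  here on functors into sets are handled through \<open>act\<close>.\<close>

lemma set_functorD:
  assumes "is_functor C set_cat X"
  shows "category C" "FObj X \<in> extensional (Obj C)" "FArr X \<in> extensional (Arr C)"
    and "f \<in> hom C a b \<Longrightarrow> FArr X f = (FObj X a, restrict (act X f) (FObj X a), FObj X b)"
    and "f \<in> hom C a b \<Longrightarrow> x \<in> FObj X a \<Longrightarrow> act X f x \<in> FObj X b"
    and "a \<in> Obj C \<Longrightarrow> x \<in> FObj X a \<Longrightarrow> act X (Id C a) x = x"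
    and "f \<in> hom C a b \<Longrightarrow> g \<in> hom C b c \<Longrightarrow> x \<in> FObj X a \<Longrightarrow>
      act X (Comp C g f) x = act X g (act X f x)"
proof -
  show "category C" "FObj X \<in> extensional (Obj C)" "FArr X \<in> extensional (Arr C)"
    using assms by (auto simp: is_functor_def PiE_def)
  have arr: "\<exists>m. FArr X f = (FObj X a, m, FObj X b) \<and> m \<in> FObj X a \<rightarrow>\<^sub>E FObj X b"
    if "f \<in> hom C a b" for f a b
    using is_functorD(4)[OF assms that] by (simp add: set_hom)
  show "f \<in> hom C a b \<Longrightarrow> FArr X f = (FObj X a, restrict (act X f) (FObj X a), FObj X b)"
    using arr[of f a b] by (auto simp: PiE_def extensional_restrict)
  show "f \<in> hom C a b \<Longrightarrow> x \<in> FObj X a \<Longrightarrow> act X f x \<in> FObj X b"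
    using arr[of f a b] by auto
  show "a \<in> Obj C \<Longrightarrow> x \<in> FObj X a \<Longrightarrow> act X (Id C a) x = x"
    using is_functorD(5)[OF assms] by simp
  show "f \<in> hom C a b \<Longrightarrow> g \<in> hom C b c \<Longrightarrow> x \<in> FObj X a \<Longrightarrow>
      act X (Comp C g f) x = act X g (act X f x)"
    using arr[of f a b] arr[of g b c] is_functorD(6)[OF assms, of f a b g c]
    by (auto simp: compose_def)
qed

text \<open>The function \<open>m\<close> only has to agree with the functor on the values, so the
  laws can be checked on elements, free of \<open>restrict\<close> and
  \<open>compose\<close>.\<close>

lemma set_functorI:
  assumes "category C" "FObj X \<in> extensional (Obj C)" "FArr X \<in> extensional (Arr C)"
    and arr: "\<And>f a b. f \<in> hom C a b \<Longrightarrow> FArr X f = (FObj X a, restrict (m f) (FObj X a), FObj X b)"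
    and maps: "\<And>f a b x. f \<in> hom C a b \<Longrightarrow> x \<in> FObj X a \<Longrightarrow> m f x \<in> FObj X b"
    and ident: "\<And>a x. a \<in> Obj C \<Longrightarrow> x \<in> FObj X a \<Longrightarrow> m (Id C a) x = x"
    and comp: "\<And>f g a b c x. f \<in> hom C a b \<Longrightarrow> g \<in> hom C b c \<Longrightarrow> x \<in> FObj X a \<Longrightarrow>
      m (Comp C g f) x = m g (m f x)"
  shows "is_functor C set_cat X"
proof (rule is_functorI)
  interpret category C by fact
  show "FArr X f \<in> hom set_cat (FObj X a) (FObj X b)" if "f \<in> hom C a b" for f a b
    using arr[OF that] maps[OF that] by (auto simp: set_hom)
  show "FArr X (Id C a) = Id set_cat (FObj X a)" if "a \<in> Obj C" for a
    using arr[OF Id_in[OF that]] ident[OF that] by (auto cong: restrict_cong)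
  show "FArr X (Comp C g f) = Comp set_cat (FArr X g) (FArr X f)"
    if f: "f \<in> hom C a b" and g: "g \<in> hom C b c" for f g a b c
    using arr[OF f] arr[OF g] arr[OF Comp_in[OF f g]] comp[OF f g] maps[OF f]
    by (auto simp: compose_def fun_eq_iff)
qed (use assms category_set_cat in auto)

lemma set_functor_eqI:
  assumes "is_functor C set_cat X" "is_functor C set_cat Y"
    and obj: "\<And>a. a \<in> Obj C \<Longrightarrow> FObj X a = FObj Y a"
    and arr: "\<And>f. f \<in> Arr C \<Longrightarrow> FArr X f = FArr Y f"
  shows "X = Y"
proof -
  have "FObj X = FObj Y"
    using set_functorD(2)[OF assms(1)] set_functorD(2)[OF assms(2)] obj by (rule extensionalityI)
  moreover have "FArr X = FArr Y"
    using set_functorD(3)[OF assms(1)] set_functorD(3)[OF assms(2)] arr by (rule extensionalityI)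
  ultimately show ?thesis by simp
qed

text \<open>
  Isomorphisms between set-valued functors over possibly different universes, where
  \<open>nat_iso\<close> does not apply.
\<close>

definition set_iso ::
    "('o, 'a) cat \<Rightarrow> ('o, 'a, 'u) gset \<Rightarrow> ('o, 'a, 'v) gset \<Rightarrow> ('o \<Rightarrow> 'u \<Rightarrow> 'v) \<Rightarrow> bool" where
  "set_iso C X Y t \<longleftrightarrow> (\<forall>a \<in> Obj C. bij_betw (t a) (FObj X a) (FObj Y a)) \<and>
     (\<forall>a b. \<forall>f \<in> hom C a b. \<forall>x \<in> FObj X a. t b (act X f x) = act Y f (t a x))"

lemma set_isoD:
  assumes "set_iso C X Y t"
  shows "a \<in> Obj C \<Longrightarrow> bij_betw (t a) (FObj X a) (FObj Y a)"
    "a \<in> Obj C \<Longrightarrow> x \<in> FObj X a \<Longrightarrow> t a x \<in> FObj Y a"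
    "f \<in> hom C a b \<Longrightarrow> x \<in> FObj X a \<Longrightarrow> t b (act X f x) = act Y f (t a x)"
  using assms by (auto simp: set_iso_def bij_betw_apply)

lemma set_iso_cong:
  assumes X: "is_functor C set_cat X" and t: "set_iso C X Y t"
    and eq: "\<And>a x. a \<in> Obj C \<Longrightarrow> x \<in> FObj X a \<Longrightarrow> t a x = s a x"
  shows "set_iso C X Y s"
proof -
  interpret category C using set_functorD(1)[OF X] .
  have "bij_betw (s a) (FObj X a) (FObj Y a)" if "a \<in> Obj C" for a
    using set_isoD(1)[OF t that] bij_betw_cong[of "FObj X a" "t a" "s a"] eq that by auto
  moreover have "s b (act X f x) = act Y f (s a x)" if f: "f \<in> hom C a b" and x: "x \<in> FObj X a"
    for f a b x
    using set_isoD(3)[OF t f x] set_functorD(5)[OF X f x] hom_obj[OF f] eq x by auto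
  ultimately show ?thesis by (simp add: set_iso_def)
qed

lemma set_iso_comp:
  assumes X: "is_functor C set_cat X" and t: "set_iso C X Y t" and s: "set_iso C Y Z s"
  shows "set_iso C X Z (\<lambda>a x. s a (t a x))"
proof -
  interpret category C using set_functorD(1)[OF X] .
  have "bij_betw (\<lambda>x. s a (t a x)) (FObj X a) (FObj Z a)" if "a \<in> Obj C" for a
    using bij_betw_trans[OF set_isoD(1)[OF t that] set_isoD(1)[OF s that]] by (simp add: comp_def)
  moreover have "s b (t b (act X f x)) = act Z f (s a (t a x))"
    if f: "f \<in> hom C a b" and x: "x \<in> FObj X a" for f a b x
    using set_isoD(3)[OF t f x] set_isoD(2)[OF t _ x] set_isoD(3)[OF s f] hom_obj[OF f] by simp
  ultimately show ?thesis by (simp add: set_iso_def)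
qed

lemma set_iso_inverse:
  assumes X: "is_functor C set_cat X" and t: "set_iso C X Y t"
  shows "set_iso C Y X (\<lambda>a. inv_into (FObj X a) (t a))"
proof -
  interpret category C using set_functorD(1)[OF X] .
  have "inv_into (FObj X b) (t b) (act Y f y) = act X f (inv_into (FObj X a) (t a) y)"
    if f: "f \<in> hom C a b" and y: "y \<in> FObj Y a" for f a b y
  proof -
    note bij = set_isoD(1)[OF t] and ab = hom_obj[OF f]
    obtain x where x: "x \<in> FObj X a" "y = t a x"
      using bij ab y unfolding bij_betw_def by blast
    show ?thesis
      using set_isoD(3)[OF t f x(1)] bij_betw_inv_into_left[OF bij] set_functorD(5)[OF X f x(1)]
        x ab by metis
  qed
  then show ?thesis
    using set_isoD(1)[OF t] by (auto simp: set_iso_def bij_betw_inv_into)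
qed

text \<open>Encodes an elementwise family as a 2-cell. The restrictions make it canonical: families
  that agree on all values have the same encoding.\<close>

definition iso_family ::
    "('o, 'a) cat \<Rightarrow> ('o, 'a, 'u) gset \<Rightarrow> ('o, 'a, 'u) gset \<Rightarrow> ('o \<Rightarrow> 'u \<Rightarrow> 'u) \<Rightarrow> 'o \<Rightarrow> 'u setmap"
    where
  "iso_family C X Y t = (\<lambda>a \<in> Obj C. (FObj X a, restrict (t a) (FObj X a), FObj Y a))"

lemma iso_family_eqI:
  "(\<And>a x. a \<in> Obj C \<Longrightarrow> x \<in> FObj X a \<Longrightarrow> t a x = s a x) \<Longrightarrow> iso_family C X Y t = iso_family C X Y s"
  by (auto simp: iso_family_def fun_eq_iff)

lemma is_iso_set_cat: "is_iso set_cat m \<longleftrightarrow> (\<exists>A f B. m = (A, f, B) \<and> f \<in> extensional A \<and> bij_betw f A B)"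
proof
  assume "is_iso set_cat m"
  then obtain A f B g where m: "m = (A, f, B)" and f: "f \<in> A \<rightarrow>\<^sub>E B" and g: "g \<in> B \<rightarrow>\<^sub>E A"
    and "compose A g f = (\<lambda>x \<in> A. x)" "compose B f g = (\<lambda>x \<in> B. x)"
    by (cases m) (auto simp: is_iso_def set_hom)
  then have "\<forall>x \<in> A. g (f x) = x" "\<forall>y \<in> B. f (g y) = y"
    by (metis compose_eq restrict_apply')+
  then have "bij_betw f A B"
    using f g by (intro bij_betw_byWitness[of _ g]) auto
  then show "\<exists>A f B. m = (A, f, B) \<and> f \<in> extensional A \<and> bij_betw f A B"
    using m f by (auto simp: PiE_def)
next
  assume "\<exists>A f B. m = (A, f, B) \<and> f \<in> extensional A \<and> bij_betw f A B"
  then obtain A f B where m: "m = (A, f, B)" and f: "f \<in> extensional A" "bij_betw f A B"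
    by blast
  let ?g = "restrict (inv_into A f) B"
  have "(B, ?g, A) \<in> hom set_cat B A"
    using bij_betw_inv_into[OF f(2)] by (auto simp: set_hom bij_betw_apply)
  moreover have "compose A ?g f = (\<lambda>x \<in> A. x)" "compose B f ?g = (\<lambda>x \<in> B. x)"
    using f(2) by (auto simp: compose_def fun_eq_iff bij_betw_apply bij_betw_inv_into_left
        bij_betw_inv_into_right)
  moreover have "m \<in> hom set_cat A B"
    using f m by (simp add: set_hom PiE_def bij_betw_imp_funcset)
  ultimately show "is_iso set_cat m"
    using m by (auto simp: is_iso_def hom_iff intro!: bexI[of _ "(B, ?g, A)"])
qed

text \<open>Every natural isomorphism is the encoding of an elementwise one. Equations between
  2-cells thus become equations between elements.\<close>

lemma nat_iso_iff:
  "nat_iso C set_cat X Y \<alpha> \<longleftrightarrow> is_functor C set_cat X \<and> is_functor C set_cat Y \<and>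
     set_iso C X Y (\<lambda>a. app (\<alpha> a)) \<and> \<alpha> = iso_family C X Y (\<lambda>a. app (\<alpha> a))" (is "?L \<longleftrightarrow> ?R")
proof
  assume L: ?L
  then have X: "is_functor C set_cat X" and Y: "is_functor C set_cat Y"
    and ext: "\<alpha> \<in> extensional (Obj C)"
    and hom: "\<And>a. a \<in> Obj C \<Longrightarrow> \<alpha> a \<in> hom set_cat (FObj X a) (FObj Y a)"
    and nat: "\<And>f. f \<in> Arr C \<Longrightarrow>
      Comp set_cat (\<alpha> (Cod C f)) (FArr X f) = Comp set_cat (FArr Y f) (\<alpha> (Dom C f))"
    and iso: "\<And>a. a \<in> Obj C \<Longrightarrow> is_iso set_cat (\<alpha> a)"
    by (auto simp: nat_iso_def nat_trans_def)
  interpret category C using set_functorD(1)[OF X] .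
  have \<alpha>: "\<alpha> a = (FObj X a, app (\<alpha> a), FObj Y a)" "app (\<alpha> a) \<in> extensional (FObj X a)"
    "bij_betw (app (\<alpha> a)) (FObj X a) (FObj Y a)" if "a \<in> Obj C" for a
    using hom[OF that] iso[OF that] by (auto simp: set_hom is_iso_set_cat PiE_def)
  have "\<alpha> = iso_family C X Y (\<lambda>a. app (\<alpha> a))"
    using ext \<alpha>(1,2)
    by (auto simp: iso_family_def extensional_restrict intro: extensionalityI[of _ "Obj C"])
  moreover have "app (\<alpha> b) (act X f x) = act Y f (app (\<alpha> a) x)"
    if f: "f \<in> hom C a b" and x: "x \<in> FObj X a" for f a b x
  proof -
    have "compose (FObj X a) (app (\<alpha> b)) (act X f) = compose (FObj X a) (act Y f) (app (\<alpha> a))"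
      using nat[of f] f hom_obj[OF f] \<alpha>(1)[of a] \<alpha>(1)[of b] set_functorD(4)[OF X f]
        set_functorD(4)[OF Y f] set_cat_simps(3)
      by (metis (no_types, lifting) app_simp hom_iff)
    from fun_cong[OF this, of x] show ?thesis using x by (simp add: compose_def)
  qed
  ultimately show ?R using X Y \<alpha> by (auto simp: set_iso_def)
next
  assume R: ?R
  then have X: "is_functor C set_cat X" and Y: "is_functor C set_cat Y" by auto
  interpret category C using set_functorD(1)[OF X] .
  obtain t where t: "set_iso C X Y t" and \<alpha>: "\<alpha> = iso_family C X Y t"
    using R by blast
  have \<alpha>_app: "\<alpha> a = (FObj X a, restrict (t a) (FObj X a), FObj Y a)" if "a \<in> Obj C" for a
    using that by (simp add: \<alpha> iso_family_def)
  have "\<alpha> \<in> extensional (Obj C)"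
    by (simp add: \<alpha> iso_family_def)
  moreover have "\<alpha> a \<in> hom set_cat (FObj X a) (FObj Y a)" "is_iso set_cat (\<alpha> a)"
    if "a \<in> Obj C" for a
    unfolding \<alpha>_app[OF that] set_hom is_iso_set_cat PiE_def using set_isoD(1)[OF t that]
    by (auto simp: bij_betw_apply)
  moreover have "Comp set_cat (\<alpha> (Cod C f)) (FArr X f) = Comp set_cat (FArr Y f) (\<alpha> (Dom C f))"
    if "f \<in> Arr C" for f
  proof -
    let ?a = "Dom C f" and ?b = "Cod C f"
    note f = Arr_hom[OF that]
    have ab: "?a \<in> Obj C" "?b \<in> Obj C" using hom_obj[OF f] by auto
    have "compose (FObj X ?a) (restrict (t ?b) (FObj X ?b)) (restrict (act X f) (FObj X ?a)) =
        compose (FObj X ?a) (restrict (act Y f) (FObj Y ?a)) (restrict (t ?a) (FObj X ?a))"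
      using set_isoD(3)[OF t f] set_isoD(2)[OF t ab(1)] set_functorD(5)[OF X f]
      by (auto simp: compose_def fun_eq_iff)
    then show ?thesis
      by (subst set_functorD(4)[OF X f], subst set_functorD(4)[OF Y f]) (simp add: \<alpha>_app ab)
  qed
  ultimately show ?L using X Y by (auto simp: nat_iso_def nat_trans_def)
qed

lemma nat_iso_iso_family:
  assumes "is_functor C set_cat X" "is_functor C set_cat Y" "set_iso C X Y t"
  shows "nat_iso C set_cat X Y (iso_family C X Y t)"
proof -
  have "set_iso C X Y (\<lambda>a. app (iso_family C X Y t a))"
    using assms(1,3) by (rule set_iso_cong) (simp add: iso_family_def)
  moreover have "iso_family C X Y t = iso_family C X Y (\<lambda>a. app (iso_family C X Y t a))"
    by (auto simp: iso_family_def fun_eq_iff)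
  ultimately show ?thesis using assms by (simp add: nat_iso_iff)
qed

lemma app_iso_family [simp]:
  "a \<in> Obj C \<Longrightarrow> x \<in> FObj X a \<Longrightarrow> app (iso_family C X Y t a) x = t a x"
  by (simp add: iso_family_def)

section \<open>The groupoid of set-valued functors with a given property\<close>

definition iso_cat :: "('o, 'a) cat \<Rightarrow> (('o, 'a, 'u) gset \<Rightarrow> bool) \<Rightarrow>
    (('o, 'a, 'u) gset, ('o, 'a, 'u) gset \<times> ('o \<Rightarrow> 'u setmap) \<times> ('o, 'a, 'u) gset) cat" where
  "iso_cat C P = \<lparr>Obj = {X. P X},
     Arr = {(X, \<alpha>, X'). P X \<and> P X' \<and> nat_iso C set_cat X X' \<alpha>},
     Dom = fst, Cod = snd \<circ> snd,
     Id = (\<lambda>X. (X, (\<lambda>p \<in> Obj C. Id set_cat (FObj X p)), X)),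
     Comp = (\<lambda>(Y', \<beta>, Z) (X, \<alpha>, Y). (X, (\<lambda>p \<in> Obj C. Comp set_cat (\<beta> p) (\<alpha> p)), Z))\<rparr>"

text \<open>With an arbitrary category and property in place of bi-sets and admissibility, a single
  abstract argument serves for splitting either variable.\<close>

lemma BB_eq: "BB H G = iso_cat (prod_cat (op_cat H) G) (admissible H G)"
  by (simp add: BB_def iso_cat_def)

locale set_functors =
  fixes C :: "('o, 'a) cat" and P :: "('o, 'a, 'u) gset \<Rightarrow> bool"
  assumes P_functor: "P X \<Longrightarrow> is_functor C set_cat X"
begin

lemma iso_cat_Obj [simp]: "Obj (iso_cat C P) = {X. P X}"
  by (simp add: iso_cat_def)

lemma iso_cat_hom: "m \<in> hom (iso_cat C P) X Y \<longleftrightarrow>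
    P X \<and> P Y \<and> (\<exists>t. set_iso C X Y t \<and> m = (X, iso_family C X Y t, Y))" (is "?L \<longleftrightarrow> ?R")
proof
  assume ?L
  then show ?R by (cases m) (auto simp: iso_cat_def hom_def nat_iso_iff)
next
  assume ?R
  then show ?L using nat_iso_iso_family[OF P_functor P_functor]
    by (auto simp: iso_cat_def hom_def)
qed

lemma iso_cat_Id: "Id (iso_cat C P) X = (X, iso_family C X X (\<lambda>a x. x), X)"
  by (simp add: iso_cat_def iso_family_def cong: restrict_cong)

lemma iso_cat_Comp:
  assumes "set_iso C X Y t"
  shows "Comp (iso_cat C P) (Y', iso_family C Y Z s, Z) (X, iso_family C X Y t, Y) =
    (X, iso_family C X Z (\<lambda>a x. s a (t a x)), Z)"
  using set_isoD(2)[OF assms]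
  by (auto simp: iso_cat_def iso_family_def fun_eq_iff compose_def)

lemma set_iso_id: "P X \<Longrightarrow> set_iso C X X (\<lambda>a x. x)"
  by (simp add: set_iso_def bij_betw_id[unfolded id_def])

lemma groupoid_iso_cat: "groupoid (iso_cat C P)"
proof
  note comp = set_iso_comp[OF P_functor]
  show "Dom (iso_cat C P) f \<in> Obj (iso_cat C P)" "Cod (iso_cat C P) f \<in> Obj (iso_cat C P)"
    if "f \<in> Arr (iso_cat C P)" for f
    using that by (auto simp: iso_cat_def)
  show "Id (iso_cat C P) X \<in> hom (iso_cat C P) X X" if "X \<in> Obj (iso_cat C P)" for X
    using that set_iso_id by (auto simp: iso_cat_hom iso_cat_Id)
  show "Comp (iso_cat C P) g f \<in> hom (iso_cat C P) X Z"
    if "f \<in> hom (iso_cat C P) X Y" "g \<in> hom (iso_cat C P) Y Z" for f g X Y Z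
    using that comp by (fastforce simp: iso_cat_hom iso_cat_Comp)
  show "Comp (iso_cat C P) f (Id (iso_cat C P) X) = f" if "f \<in> hom (iso_cat C P) X Y" for f X Y
    using that set_iso_id by (auto simp: iso_cat_hom iso_cat_Comp iso_cat_Id)
  show "Comp (iso_cat C P) (Id (iso_cat C P) Y) f = f" if "f \<in> hom (iso_cat C P) X Y" for f X Y
    using that by (auto simp: iso_cat_hom iso_cat_Comp iso_cat_Id)
  show "Comp (iso_cat C P) h (Comp (iso_cat C P) g f) = Comp (iso_cat C P) (Comp (iso_cat C P) h g) f"
    if "f \<in> hom (iso_cat C P) X Y" "g \<in> hom (iso_cat C P) Y Z" "h \<in> hom (iso_cat C P) Z W"
    for f g h X Y Z W
    using that iso_cat_Comp[OF comp] by (auto simp: iso_cat_hom iso_cat_Comp)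
  show "is_iso (iso_cat C P) f" if "f \<in> Arr (iso_cat C P)" for f
  proof -
    have "f \<in> hom (iso_cat C P) (Dom (iso_cat C P) f) (Cod (iso_cat C P) f)"
      using that by (simp add: hom_iff)
    then obtain X Y t where fXY: "f \<in> hom (iso_cat C P) X Y" and P: "P X" "P Y"
      and t: "set_iso C X Y t" and f: "f = (X, iso_family C X Y t, Y)"
      by (auto simp: iso_cat_hom)
    let ?s = "\<lambda>a. inv_into (FObj X a) (t a)"
    have s: "set_iso C Y X ?s" using set_iso_inverse[OF P_functor[OF P(1)] t] .
    let ?g = "(Y, iso_family C Y X ?s, X)"
    have "?g \<in> hom (iso_cat C P) Y X" using P s by (auto simp: iso_cat_hom)
    moreover have "Comp (iso_cat C P) ?g (X, iso_family C X Y t, Y) = Id (iso_cat C P) X"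
      using bij_betw_inv_into_left[OF set_isoD(1)[OF t]]
      by (auto simp: iso_cat_Comp[OF t] iso_cat_Id intro!: iso_family_eqI)
    moreover have "Comp (iso_cat C P) (X, iso_family C X Y t, Y) ?g = Id (iso_cat C P) Y"
      using bij_betw_inv_into_right[OF set_isoD(1)[OF t]]
      by (auto simp: iso_cat_Comp[OF s] iso_cat_Id intro!: iso_family_eqI)
    ultimately show ?thesis using that fXY unfolding is_iso_def f by (auto simp: hom_iff)
  qed
qed

end

section \<open>Functors on a disjoint union of categories\<close>

text \<open>Transport of structure: each element of \<open>Y\<close> is some \<open>t a x\<close>,
  so the laws of \<open>X\<close> carry over. It is used both to change universe and to obtain the
  functor laws of a tensor product without computing with its classes.\<close>

lemma set_functor_bij:
  assumes X: "is_functor C set_cat X"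
    and "FObj Y \<in> extensional (Obj C)" "FArr Y \<in> extensional (Arr C)"
    and bij: "\<And>a. a \<in> Obj C \<Longrightarrow> bij_betw (t a) (FObj X a) (FObj Y a)"
    and arr: "\<And>f a b. f \<in> hom C a b \<Longrightarrow> FArr Y f = (FObj Y a, restrict (m f) (FObj Y a), FObj Y b)"
    and nat: "\<And>f a b x. f \<in> hom C a b \<Longrightarrow> x \<in> FObj X a \<Longrightarrow> m f (t a x) = t b (act X f x)"
  shows "is_functor C set_cat Y" "set_iso C X Y t"
proof -
  interpret category C using set_functorD(1)[OF X] .
  have pre: "\<exists>x \<in> FObj X a. y = t a x" if "a \<in> Obj C" "y \<in> FObj Y a" for a y
    using bij that unfolding bij_betw_def by blast
  have t: "t a x \<in> FObj Y a" if "a \<in> Obj C" "x \<in> FObj X a" for a x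
    using bij that bij_betw_apply by metis
  show "is_functor C set_cat Y"
  proof (rule set_functorI)
    show "m f y \<in> FObj Y b" if f: "f \<in> hom C a b" and y: "y \<in> FObj Y a" for f a b y
      using pre[OF _ y] nat[OF f] t set_functorD(5)[OF X f] hom_obj[OF f] by auto
    show "m (Id C a) y = y" if a: "a \<in> Obj C" and y: "y \<in> FObj Y a" for a y
      using pre[OF a y] nat[OF Id_in[OF a]] set_functorD(6)[OF X a] by auto
    show "m (Comp C g f) y = m g (m f y)"
      if f: "f \<in> hom C a b" and g: "g \<in> hom C b c" and y: "y \<in> FObj Y a" for f g a b c y
      using pre[OF _ y] nat[OF f] nat[OF g] nat[OF Comp_in[OF f g]] hom_obj[OF f]
        set_functorD(5)[OF X f] set_functorD(7)[OF X f g] by auto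
  qed (use assms category_axioms in auto)
  show "set_iso C X Y t"
    unfolding set_iso_def using bij arr nat t hom_obj by auto
qed

lemma set_functor_transport:
  fixes X :: "('o, 'a, 'v) gset"
  assumes X: "is_functor C set_cat X" and small: "\<And>a. a \<in> Obj C \<Longrightarrow> FObj X a \<lesssim> (UNIV :: 'u set)"
  shows "\<exists>(Y :: ('o, 'a, 'u) gset) t. is_functor C set_cat Y \<and> set_iso C Y X t"
proof -
  have "\<exists>e :: 'v \<Rightarrow> 'u. inj_on e (FObj X a)" if "a \<in> Obj C" for a
    using small[OF that] by (auto simp: lepoll_def)
  then obtain e :: "'o \<Rightarrow> 'v \<Rightarrow> 'u" where e: "\<And>a. a \<in> Obj C \<Longrightarrow> inj_on (e a) (FObj X a)"
    by metis
  \<comment> \<open>The action on the copies in \<open>'u\<close> is the old action conjugated by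
    the chosen injections \<open>e\<close>.\<close>
  define m where "m f u = e (Cod C f) (act X f (inv_into (FObj X (Dom C f)) (e (Dom C f)) u))" for f u
  define Y where "Y = \<lparr>FObj = (\<lambda>a \<in> Obj C. e a ` FObj X a),
    FArr = (\<lambda>f \<in> Arr C. (e (Dom C f) ` FObj X (Dom C f),
      restrict (m f) (e (Dom C f) ` FObj X (Dom C f)), e (Cod C f) ` FObj X (Cod C f)))\<rparr>"
  interpret category C using set_functorD(1)[OF X] .
  have "is_functor C set_cat Y" "set_iso C X Y e"
    by (rule set_functor_bij[OF X, of Y e m];
      use e hom_obj Dom_in Cod_in in \<open>auto simp: Y_def m_def hom_iff inj_on_imp_bij_betw\<close>)+
  then show ?thesis using set_iso_inverse[OF X] by blast
qed

locale component = C1: category C1 + C: category C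
  for C1 :: "('p, 'b) cat" and C :: "('o, 'a) cat" +
  fixes J :: "('p, 'b, 'o, 'a) func"
  assumes Obj_iff [simp]: "FObj J a \<in> Obj C \<longleftrightarrow> a \<in> Obj C1"
    and Arr_iff [simp]: "FArr J f \<in> Arr C \<longleftrightarrow> f \<in> Arr C1"
    and Dom_J [simp]: "Dom C (FArr J f) = FObj J (Dom C1 f)"
    and Cod_J [simp]: "Cod C (FArr J f) = FObj J (Cod C1 f)"
    and Id_J: "Id C (FObj J a) = FArr J (Id C1 a)"
    and Comp_J: "Comp C (FArr J g) (FArr J f) = FArr J (Comp C1 g f)"
    and inj_obj: "inj (FObj J)"
    and inj_arr: "inj (FArr J)"
    and Dom_closed: "h \<in> Arr C \<Longrightarrow> Dom C h = FObj J a \<Longrightarrow> h \<in> range (FArr J)"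
    and Cod_closed: "h \<in> Arr C \<Longrightarrow> Cod C h = FObj J a \<Longrightarrow> h \<in> range (FArr J)"
begin

lemma J_eq [simp]: "FObj J a = FObj J b \<longleftrightarrow> a = b" "FArr J f = FArr J g \<longleftrightarrow> f = g"
  using inj_obj inj_arr by (auto dest: injD)

lemma hom_J [simp]: "FArr J f \<in> hom C (FObj J a) (FObj J b) \<longleftrightarrow> f \<in> hom C1 a b"
  by (simp add: hom_iff)

lemma hom_from: "f \<in> hom C (FObj J a) b \<Longrightarrow> \<exists>f' b'. f = FArr J f' \<and> b = FObj J b' \<and> f' \<in> hom C1 a b'"
  using Dom_closed[of f a] by (auto simp: hom_iff)

lemma hom_to: "f \<in> hom C a (FObj J b) \<Longrightarrow> \<exists>f' a'. f = FArr J f' \<and> a = FObj J a' \<and> f' \<in> hom C1 a' b"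
  using Cod_closed[of f b] by (auto simp: hom_iff)

abbreviation res :: "('o, 'a, 'u) gset \<Rightarrow> ('p, 'b, 'u) gset" where
  "res Z \<equiv> comp_func C1 Z J"

lemma res_simps [simp]:
  "a \<in> Obj C1 \<Longrightarrow> FObj (res Z) a = FObj Z (FObj J a)"
  "f \<in> Arr C1 \<Longrightarrow> FArr (res Z) f = FArr Z (FArr J f)"
  by (simp_all add: comp_func_def)

lemma res_functor:
  assumes Z: "is_functor C set_cat Z" shows "is_functor C1 set_cat (res Z)"
proof (rule set_functorI)
  show "FArr (res Z) f = (FObj (res Z) a, restrict (act Z (FArr J f)) (FObj (res Z) a), FObj (res Z) b)"
    if "f \<in> hom C1 a b" for f a b
    using set_functorD(4)[OF Z, of "FArr J f" "FObj J a" "FObj J b"] C1.hom_obj[OF that] that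
    by (simp add: hom_iff)
  show "act Z (FArr J f) x \<in> FObj (res Z) b" if "f \<in> hom C1 a b" "x \<in> FObj (res Z) a" for f a b x
    using set_functorD(5)[OF Z, of "FArr J f" "FObj J a" "FObj J b"] C1.hom_obj[OF that(1)] that
    by simp
  show "act Z (FArr J (Id C1 a)) x = x" if "a \<in> Obj C1" "x \<in> FObj (res Z) a" for a x
    using set_functorD(6)[OF Z, of "FObj J a"] that by (simp add: Id_J)
  show "act Z (FArr J (Comp C1 g f)) x = act Z (FArr J g) (act Z (FArr J f) x)"
    if "f \<in> hom C1 a b" "g \<in> hom C1 b c" "x \<in> FObj (res Z) a" for f g a b c x
    using set_functorD(7)[OF Z, of "FArr J f" "FObj J a" "FObj J b" "FArr J g" "FObj J c"]
      C1.hom_obj[OF that(1)] that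
    by (simp add: Comp_J)
qed (use C1.category_axioms in \<open>auto simp: comp_func_def\<close>)

lemma res_iso: "set_iso C Z Z' t \<Longrightarrow> set_iso C1 (res Z) (res Z') (\<lambda>a. t (FObj J a))"
  using C1.hom_obj by (auto simp: set_iso_def hom_iff)

end

text \<open>The disjoint union is described by properties instead of as \<open>coprod_cat\<close>,
  because this description is stable under opposites and under products with a fixed category, where
  bi-sets live.\<close>

locale decomposition = J1: component C1 C J1 + J2: component C2 C J2
  for C1 :: "('p, 'b) cat" and C2 :: "('q, 'c) cat" and C :: "('o, 'a) cat" and J1 J2 +
  assumes cover: "c \<in> Obj C \<Longrightarrow> c \<in> range (FObj J1) \<union> range (FObj J2)"
    and disjoint [simp]: "FObj J1 a \<noteq> FObj J2 b"
begin

lemma disjoint_arr [simp]: "FArr J1 f \<noteq> FArr J2 g"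
  using disjoint J1.Dom_J J2.Dom_J by metis

lemma Obj_cases:
  assumes "a \<in> Obj C"
  obtains a' where "a = FObj J1 a'" "a' \<in> Obj C1" | a' where "a = FObj J2 a'" "a' \<in> Obj C2"
  using assms cover[of a] by auto

lemma hom_cases:
  assumes "f \<in> hom C a b"
  obtains f' a' b' where "f = FArr J1 f'" "a = FObj J1 a'" "b = FObj J1 b'" "f' \<in> hom C1 a' b'"
  | f' a' b' where "f = FArr J2 f'" "a = FObj J2 a'" "b = FObj J2 b'" "f' \<in> hom C2 a' b'"
proof -
  have "a \<in> Obj C" using J1.C.hom_obj assms by blast
  then show ?thesis
    using J1.hom_from J2.hom_from assms that by (cases rule: Obj_cases) metis+
qed

text \<open>The copairing of \<open>u\<close> and \<open>v\<close> along the two inclusions.\<close>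

definition glue_obj :: "('p \<Rightarrow> 'r) \<Rightarrow> ('q \<Rightarrow> 'r) \<Rightarrow> 'o \<Rightarrow> 'r" where
  "glue_obj u v a = (if a \<in> range (FObj J1) then u (inv (FObj J1) a) else v (inv (FObj J2) a))"

definition glue_arr :: "('b \<Rightarrow> 'r) \<Rightarrow> ('c \<Rightarrow> 'r) \<Rightarrow> 'a \<Rightarrow> 'r" where
  "glue_arr u v f = (if f \<in> range (FArr J1) then u (inv (FArr J1) f) else v (inv (FArr J2) f))"

lemma glue_simps [simp]:
  "glue_obj u v (FObj J1 a) = u a" "glue_obj u v (FObj J2 b) = v b"
  "glue_arr u' v' (FArr J1 f) = u' f" "glue_arr u' v' (FArr J2 g) = v' g"
  using disjoint[symmetric] disjoint_arr[symmetric]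
  by (auto simp: glue_obj_def glue_arr_def inv_f_f[OF J1.inj_obj] inv_f_f[OF J2.inj_obj]
      inv_f_f[OF J1.inj_arr] inv_f_f[OF J2.inj_arr] simp del: disjoint disjoint_arr)

text \<open>An arrow of \<open>C\<close> lies in one part together with both its ends, so each
  functor law is a law of \<open>A\<close> or of \<open>B\<close>. Extensionality turns the
  restrictions into equalities, not just isomorphisms.\<close>

lemma glue_functors:
  assumes A: "is_functor C1 set_cat A" and B: "is_functor C2 set_cat B"
  shows "\<exists>Z. is_functor C set_cat Z \<and> J1.res Z = A \<and> J2.res Z = B"
proof -
  define Z where "Z = \<lparr>FObj = (\<lambda>a \<in> Obj C. glue_obj (FObj A) (FObj B) a),
    FArr = (\<lambda>f \<in> Arr C. glue_arr (FArr A) (FArr B) f)\<rparr>"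
  have obj [simp]: "a \<in> Obj C1 \<Longrightarrow> FObj Z (FObj J1 a) = FObj A a"
    "b \<in> Obj C2 \<Longrightarrow> FObj Z (FObj J2 b) = FObj B b" for a b
    by (simp_all add: Z_def)
  have arr [simp]: "f \<in> Arr C1 \<Longrightarrow> FArr Z (FArr J1 f) = FArr A f"
    "g \<in> Arr C2 \<Longrightarrow> FArr Z (FArr J2 g) = FArr B g" for f g
    by (simp_all add: Z_def)
  have Z1: "FArr Z (FArr J1 f) = FArr A f" "FObj Z (FObj J1 a) = FObj A a"
    "FObj Z (FObj J1 b) = FObj A b" if "f \<in> hom C1 a b" for f a b
    using J1.C1.hom_obj[OF that] that by (simp_all add: hom_iff)
  have Z2: "FArr Z (FArr J2 f) = FArr B f" "FObj Z (FObj J2 a) = FObj B a"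
    "FObj Z (FObj J2 b) = FObj B b" if "f \<in> hom C2 a b" for f a b
    using J2.C1.hom_obj[OF that] that by (simp_all add: hom_iff)
  have "is_functor C set_cat Z"
  proof (rule set_functorI)
    show "FArr Z f = (FObj Z a, restrict (act Z f) (FObj Z a), FObj Z b)" if "f \<in> hom C a b" for f a b
      using that
    proof (cases rule: hom_cases)
      case (1 f' a' b')
      show ?thesis unfolding 1(1-3) Z1[OF 1(4)] by (rule set_functorD(4)[OF A 1(4)])
    next
      case (2 f' a' b')
      show ?thesis unfolding 2(1-3) Z2[OF 2(4)] by (rule set_functorD(4)[OF B 2(4)])
    qed
    show "act Z f x \<in> FObj Z b" if f: "f \<in> hom C a b" and x: "x \<in> FObj Z a" for f a b x
      using f
    proof (cases rule: hom_cases)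
      case (1 f' a' b')
      show ?thesis
        using x unfolding 1(1-3) Z1[OF 1(4)] by (rule set_functorD(5)[OF A 1(4)])
    next
      case (2 f' a' b')
      show ?thesis
        using x unfolding 2(1-3) Z2[OF 2(4)] by (rule set_functorD(5)[OF B 2(4)])
    qed
    show "act Z (Id C a) x = x" if a: "a \<in> Obj C" and x: "x \<in> FObj Z a" for a x
      using a
    proof (cases rule: Obj_cases)
      case (1 a')
      show ?thesis
        using x unfolding 1(1) J1.Id_J Z1[OF J1.C1.Id_in[OF 1(2)]] by (rule set_functorD(6)[OF A 1(2)])
    next
      case (2 a')
      show ?thesis
        using x unfolding 2(1) J2.Id_J Z2[OF J2.C1.Id_in[OF 2(2)]] by (rule set_functorD(6)[OF B 2(2)])
    qed
    show "act Z (Comp C g f) x = act Z g (act Z f x)"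
      if f: "f \<in> hom C a b" and g: "g \<in> hom C b c" and x: "x \<in> FObj Z a" for f g a b c x
      using f
    proof (cases rule: hom_cases)
      case (1 f' a' b')
      then obtain g' c' where g': "g = FArr J1 g'" "c = FObj J1 c'" "g' \<in> hom C1 b' c'"
        using J1.hom_from g by blast
      show ?thesis
        using x unfolding 1(1-3) g'(1) J1.Comp_J Z1[OF J1.C1.Comp_in[OF 1(4) g'(3)]] Z1[OF 1(4)]
          Z1[OF g'(3)]
        by (rule set_functorD(7)[OF A 1(4) g'(3)])
    next
      case (2 f' a' b')
      then obtain g' c' where g': "g = FArr J2 g'" "c = FObj J2 c'" "g' \<in> hom C2 b' c'"
        using J2.hom_from g by blast
      show ?thesis
        using x unfolding 2(1-3) g'(1) J2.Comp_J Z2[OF J2.C1.Comp_in[OF 2(4) g'(3)]] Z2[OF 2(4)]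
          Z2[OF g'(3)]
        by (rule set_functorD(7)[OF B 2(4) g'(3)])
    qed
  qed (use J1.C.category_axioms in \<open>auto simp: Z_def\<close>)
  moreover from this have "J1.res Z = A" "J2.res Z = B"
    using A B by (auto intro: set_functor_eqI J1.res_functor J2.res_functor)
  ultimately show ?thesis by blast
qed

text \<open>No naturality square has corners in both parts, so the two families impose no condition
  on each other.\<close>

lemma glue_isos:
  assumes s: "set_iso C1 (J1.res Z) (J1.res Z') s" and s': "set_iso C2 (J2.res Z) (J2.res Z') s'"
  shows "set_iso C Z Z' (glue_obj s s')"
proof -
  have "bij_betw (glue_obj s s' a) (FObj Z a) (FObj Z' a)" if "a \<in> Obj C" for a
    using that set_isoD(1)[OF s] set_isoD(1)[OF s'] by (cases rule: Obj_cases) auto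
  moreover have "glue_obj s s' b (act Z f x) = act Z' f (glue_obj s s' a x)"
    if f: "f \<in> hom C a b" and x: "x \<in> FObj Z a" for f a b x
    using f
  proof (cases rule: hom_cases)
    case (1 f' a' b')
    then show ?thesis
      using set_isoD(3)[OF s 1(4), of x] J1.C1.hom_obj[OF 1(4)] x by (simp add: hom_iff)
  next
    case (2 f' a' b')
    then show ?thesis
      using set_isoD(3)[OF s' 2(4), of x] J2.C1.hom_obj[OF 2(4)] x by (simp add: hom_iff)
  qed
  ultimately show ?thesis by (simp add: set_iso_def)
qed

end

section \<open>Functors isomorphic to restriction, up to a change of universe\<close>

text \<open>
  \<open>T\<close> is naturally isomorphic, via \<open>\<psi>\<close>, to restriction along \<open>J\<close>, but takes values in
  another universe, where \<open>P'\<close> corresponds to \<open>Q\<close>.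
\<close>

locale restriction = component C1 C J + dom: set_functors C P + cod: set_functors C1 P'
  for C1 :: "('p, 'b) cat" and C :: "('o, 'a) cat" and J
    and P :: "('o, 'a, 'u) gset \<Rightarrow> bool" and P' :: "('p, 'b, 'v) gset \<Rightarrow> bool" +
  fixes Q :: "('p, 'b, 'u) gset \<Rightarrow> bool"
    and T :: "(('o, 'a, 'u) gset, ('o, 'a, 'u) gset \<times> ('o \<Rightarrow> 'u setmap) \<times> ('o, 'a, 'u) gset,
      ('p, 'b, 'v) gset, ('p, 'b, 'v) gset \<times> ('p \<Rightarrow> 'v setmap) \<times> ('p, 'b, 'v) gset) func"
    and \<psi> :: "('o, 'a, 'u) gset \<Rightarrow> 'p \<Rightarrow> 'u \<Rightarrow> 'v"
  assumes res_Q: "P Z \<Longrightarrow> Q (res Z)"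
    and Q_P': "Q X \<Longrightarrow> is_functor C1 set_cat Y \<Longrightarrow> set_iso C1 X Y t \<Longrightarrow> P' Y"
    and P'_Q: "P' Y \<Longrightarrow> is_functor C1 set_cat X \<Longrightarrow> set_iso C1 X Y t \<Longrightarrow> Q X"
    and small: "P' Y \<Longrightarrow> a \<in> Obj C1 \<Longrightarrow> FObj Y a \<lesssim> (UNIV :: 'u set)"
    and T_functor: "P Z \<Longrightarrow> is_functor C1 set_cat (FObj T Z)"
    and \<psi>: "P Z \<Longrightarrow> set_iso C1 (res Z) (FObj T Z) (\<psi> Z)"
    and T_arr: "P Z \<Longrightarrow> P Z' \<Longrightarrow> set_iso C Z Z' r \<Longrightarrow>
      FArr T (Z, iso_family C Z Z' r, Z') = (FObj T Z, iso_family C1 (FObj T Z) (FObj T Z')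
        (\<lambda>a y. \<psi> Z' a (r (FObj J a) (inv_into (FObj (res Z) a) (\<psi> Z a) y))), FObj T Z')"
begin

lemma T_P': "P Z \<Longrightarrow> P' (FObj T Z)"
  using Q_P' res_Q T_functor \<psi> by blast

lemmas res_P = res_functor[OF dom.P_functor]

text \<open>The formula of assumption \<open>T_arr\<close>, which says that \<open>T\<close> acts on
  2-cells as restriction does, transported along \<open>\<psi>\<close>; in other words,
  \<open>\<psi>\<close> is natural in \<open>Z\<close>.\<close>

definition conjugate :: "('o, 'a, 'u) gset \<Rightarrow> ('o, 'a, 'u) gset \<Rightarrow> ('o \<Rightarrow> 'u \<Rightarrow> 'u) \<Rightarrow> 'p \<Rightarrow> 'v \<Rightarrow> 'v" where
  "conjugate Z Z' t a y = \<psi> Z' a (t (FObj J a) (inv_into (FObj (res Z) a) (\<psi> Z a) y))"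

lemma T_arr': "P Z \<Longrightarrow> P Z' \<Longrightarrow> set_iso C Z Z' t \<Longrightarrow>
    FArr T (Z, iso_family C Z Z' t, Z') =
      (FObj T Z, iso_family C1 (FObj T Z) (FObj T Z') (conjugate Z Z' t), FObj T Z')"
  using T_arr unfolding conjugate_def by blast

lemma conjugate_iso:
  assumes "P Z" "P Z'" "set_iso C Z Z' t"
  shows "set_iso C1 (FObj T Z) (FObj T Z') (conjugate Z Z' t)"
  unfolding conjugate_def
  using set_iso_comp[OF T_functor[OF assms(1)] set_iso_inverse[OF res_P \<psi>]
      set_iso_comp[OF res_P res_iso \<psi>]] assms by blast

text \<open>The naturality square of \<open>\<psi>\<close>. Together with
  \<open>\<psi>_cases\<close> it removes \<open>inv_into\<close> from all later
  computations.\<close>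

lemma conjugate_\<psi>:
  assumes "P Z" "a \<in> Obj C1" "x \<in> FObj Z (FObj J a)"
  shows "conjugate Z Z' t a (\<psi> Z a x) = \<psi> Z' a (t (FObj J a) x)"
  using bij_betw_inv_into_left[OF set_isoD(1)[OF \<psi>[OF assms(1)] assms(2)]] assms(2,3)
  by (simp add: conjugate_def)

lemma \<psi>_cases:
  assumes "P Z" "a \<in> Obj C1" "y \<in> FObj (FObj T Z) a"
  obtains x where "x \<in> FObj Z (FObj J a)" "y = \<psi> Z a x"
  using set_isoD(1)[OF \<psi>[OF assms(1)] assms(2)] assms that unfolding bij_betw_def by force

lemma T_hom:
  "m \<in> hom (iso_cat C P) Z Z' \<Longrightarrow> FArr T m \<in> hom (iso_cat C1 P') (FObj T Z) (FObj T Z')"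
  using T_P' conjugate_iso T_arr' unfolding dom.iso_cat_hom cod.iso_cat_hom by blast

lemma T_Id:
  assumes "P Z" shows "FArr T (Id (iso_cat C P) Z) = Id (iso_cat C1 P') (FObj T Z)"
proof -
  have "conjugate Z Z (\<lambda>a x. x) a y = y" if "a \<in> Obj C1" "y \<in> FObj (FObj T Z) a" for a y
    using \<psi>_cases[OF assms that] conjugate_\<psi>[OF assms that(1)] by metis
  then show ?thesis
    using assms dom.set_iso_id by (auto simp: dom.iso_cat_Id cod.iso_cat_Id T_arr' intro: iso_family_eqI)
qed

lemma T_Comp:
  assumes "f \<in> hom (iso_cat C P) X Y" "g \<in> hom (iso_cat C P) Y Z"
  shows "FArr T (Comp (iso_cat C P) g f) = Comp (iso_cat C1 P') (FArr T g) (FArr T f)"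
proof -
  obtain t s where P: "P X" "P Y" "P Z" and t: "set_iso C X Y t" and s: "set_iso C Y Z s"
    and f: "f = (X, iso_family C X Y t, Y)" and g: "g = (Y, iso_family C Y Z s, Z)"
    using assms by (auto simp: dom.iso_cat_hom)
  have "conjugate X Z (\<lambda>a x. s a (t a x)) a y = conjugate Y Z s a (conjugate X Y t a y)"
    if a: "a \<in> Obj C1" and y: "y \<in> FObj (FObj T X) a" for a y
  proof -
    obtain x where x: "x \<in> FObj X (FObj J a)" "y = \<psi> X a x" using \<psi>_cases[OF P(1) a y] .
    have "t (FObj J a) x \<in> FObj Y (FObj J a)" using set_isoD(2)[OF t _ x(1)] a by simp
    then show ?thesis unfolding x(2) by (simp only: conjugate_\<psi>[OF P(1) a x(1)] conjugate_\<psi>[OF P(2) a])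
  qed
  then show ?thesis
    unfolding f g dom.iso_cat_Comp[OF t] T_arr'[OF P(1,2) t] T_arr'[OF P(2,3) s]
      T_arr'[OF P(1,3) set_iso_comp[OF dom.P_functor[OF P(1)] t s]]
      cod.iso_cat_Comp[OF conjugate_iso[OF P(1,2) t]]
    by (auto intro: iso_family_eqI)
qed

text \<open>As \<open>\<psi>\<close> is injective on values, \<open>T\<close> remembers a 2-cell
  over its own component, and only there; the complementary restriction has to supply the
  rest.\<close>

lemma T_faithful:
  assumes P: "P Z" "P Z'" and t: "set_iso C Z Z' t" and s: "set_iso C Z Z' s"
    and eq: "FArr T (Z, iso_family C Z Z' t, Z') = FArr T (Z, iso_family C Z Z' s, Z')"
    and a: "a \<in> Obj C1" and x: "x \<in> FObj Z (FObj J a)"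
  shows "t (FObj J a) x = s (FObj J a) x"
proof -
  let ?y = "\<psi> Z a x"
  have "?y \<in> FObj (FObj T Z) a" using set_isoD(2)[OF \<psi>[OF P(1)] a] a x by simp
  then have "conjugate Z Z' t a ?y = conjugate Z Z' s a ?y"
    using eq app_iso_family[OF a] T_arr'[OF P t] T_arr'[OF P s] by (metis prod.inject)
  then have "\<psi> Z' a (t (FObj J a) x) = \<psi> Z' a (s (FObj J a) x)"
    using conjugate_\<psi>[OF P(1) a x] by simp
  moreover have "inj_on (\<psi> Z' a) (FObj Z' (FObj J a))"
    using set_isoD(1)[OF \<psi>[OF P(2)] a] a by (simp add: bij_betw_def)
  ultimately show ?thesis
    using set_isoD(2)[OF t _ x] set_isoD(2)[OF s _ x] a by (auto dest: inj_onD)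
qed

text \<open>A prescribed image fixes the 2-cell over one component only. Quantifying over all
  \<open>t\<close> that extend \<open>s\<close> leaves it free elsewhere, so that one glued family
  can meet the demands of two restrictions at once.\<close>

lemma T_full:
  assumes P: "P Z" "P Z'" and h: "h \<in> hom (iso_cat C1 P') (FObj T Z) (FObj T Z')"
  shows "\<exists>s. set_iso C1 (res Z) (res Z') s \<and> (\<forall>t. set_iso C Z Z' t \<longrightarrow>
    (\<forall>a \<in> Obj C1. \<forall>x. t (FObj J a) x = s a x) \<longrightarrow> FArr T (Z, iso_family C Z Z' t, Z') = h)"
proof -
  obtain r where r: "set_iso C1 (FObj T Z) (FObj T Z') r"
    and h: "h = (FObj T Z, iso_family C1 (FObj T Z) (FObj T Z') r, FObj T Z')"
    using h by (auto simp: cod.iso_cat_hom)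
  define s where "s a x = inv_into (FObj (res Z') a) (\<psi> Z' a) (r a (\<psi> Z a x))" for a x
  have "set_iso C1 (res Z) (res Z') s"
    using set_iso_comp[OF res_P[OF P(1)] set_iso_comp[OF res_P[OF P(1)] \<psi>[OF P(1)] r]
        set_iso_inverse[OF res_P[OF P(2)] \<psi>[OF P(2)]]]
    by (simp add: s_def[abs_def])
  moreover have "FArr T (Z, iso_family C Z Z' t, Z') = h"
    if t: "set_iso C Z Z' t" and ts: "\<forall>a \<in> Obj C1. \<forall>x. t (FObj J a) x = s a x" for t
  proof -
    have "conjugate Z Z' t a y = r a y" if a: "a \<in> Obj C1" and y: "y \<in> FObj (FObj T Z) a" for a y
    proof -
      obtain x where x: "x \<in> FObj Z (FObj J a)" "y = \<psi> Z a x" using \<psi>_cases[OF P(1) a y] .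
      have "conjugate Z Z' t a y = \<psi> Z' a (s a x)"
        using conjugate_\<psi>[OF P(1) a x(1)] x(2) ts a by simp
      also have "\<dots> = r a y"
        unfolding s_def x(2)[symmetric]
        using bij_betw_inv_into_right[OF set_isoD(1)[OF \<psi>[OF P(2)] a]] set_isoD(2)[OF r a y] .
      finally show ?thesis .
    qed
    then show ?thesis using T_arr'[OF P t] h by (auto intro: iso_family_eqI)
  qed
  ultimately show ?thesis by blast
qed

text \<open>A copy of \<open>A\<close> in the universe \<open>'u\<close> does the job. Only the
  restriction of \<open>Z\<close> is prescribed, again so that two such demands can be met by
  glueing.\<close>

lemma T_surj:
  assumes A: "P' A"
  shows "\<exists>X. Q X \<and> is_functor C1 set_cat X \<and>
    (\<forall>Z. P Z \<longrightarrow> res Z = X \<longrightarrow> (\<exists>e. e \<in> hom (iso_cat C1 P') (FObj T Z) A))"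
proof -
  obtain X t where X: "is_functor C1 set_cat (X :: ('p, 'b, 'u) gset)" and t: "set_iso C1 X A t"
    using set_functor_transport[OF cod.P_functor[OF A] small[OF A]] by blast
  have "\<exists>e. e \<in> hom (iso_cat C1 P') (FObj T Z) A" if Z: "P Z" "res Z = X" for Z
    using set_iso_comp[OF T_functor[OF Z(1)] set_iso_inverse[OF res_P[OF Z(1)] \<psi>[OF Z(1)]]] Z t
      T_P'[OF Z(1)] A
    unfolding cod.iso_cat_hom by blast
  then show ?thesis using P'_Q[OF A X t] X by blast
qed

end

text \<open>\<open>P_I\<close> is the converse of the two assumptions \<open>res_Q\<close>: the
  property \<open>P\<close> can be tested on the parts.\<close>

locale decomposed_restriction = decomposition C1 C2 C J1 J2 +
    R1: restriction C1 C J1 P P1 Q1 T1 \<psi>1 + R2: restriction C2 C J2 P P2 Q2 T2 \<psi>2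
  for C1 :: "('p, 'b) cat" and C2 :: "('q, 'c) cat" and C :: "('o, 'a) cat" and J1 J2
    and P :: "('o, 'a, 'u) gset \<Rightarrow> bool" and P1 :: "('p, 'b, 'v) gset \<Rightarrow> bool"
    and P2 :: "('q, 'c, 'w) gset \<Rightarrow> bool" and Q1 Q2 T1 T2 \<psi>1 \<psi>2 +
  assumes P_I: "is_functor C set_cat Z \<Longrightarrow> Q1 (J1.res Z) \<Longrightarrow> Q2 (J2.res Z) \<Longrightarrow> P Z"
begin

text \<open>A 2-cell is determined by its two restrictions, hence faithfulness. Choices on the two
  parts are independent and can be glued, hence fullness and essential surjectivity.\<close>

lemma equivalence:
  "is_equivalence (iso_cat C P) (prod_cat (iso_cat C1 P1) (iso_cat C2 P2))
     (pair_func (iso_cat C P) T1 T2)" (is "is_equivalence ?B ?D ?F")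
proof (rule equivalenceI)
  interpret B: groupoid ?B by (rule R1.dom.groupoid_iso_cat)
  interpret D: groupoid ?D
    by (intro groupoid_prod R1.cod.groupoid_iso_cat R2.cod.groupoid_iso_cat)
  show "groupoid ?B" "groupoid ?D" by unfold_locales
  have F_obj: "FObj ?F Z = (FObj T1 Z, FObj T2 Z)" if "P Z" for Z
    using that by (simp add: pair_func_def)
  have F_arr: "FArr ?F m = (FArr T1 m, FArr T2 m)" if "m \<in> hom ?B Z Z'" for m Z Z'
    using that by (simp add: pair_func_def hom_iff)
  show "is_functor ?B ?D ?F"
  proof (rule is_functorI)
    show "FArr ?F m \<in> hom ?D (FObj ?F Z) (FObj ?F Z')" if "m \<in> hom ?B Z Z'" for m Z Z'
      using F_arr[OF that] R1.T_hom[OF that] R2.T_hom[OF that] B.hom_obj[OF that]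
      by (simp add: prod_hom F_obj)
    show "FArr ?F (Id ?B Z) = Id ?D (FObj ?F Z)" if "Z \<in> Obj ?B" for Z
      using F_arr[OF B.Id_in[OF that]] that by (simp add: F_obj R1.T_Id R2.T_Id)
    show "FArr ?F (Comp ?B g f) = Comp ?D (FArr ?F g) (FArr ?F f)"
      if "f \<in> hom ?B X Y" "g \<in> hom ?B Y Z" for f g X Y Z
      using F_arr[OF B.Comp_in[OF that]] F_arr[OF that(1)] F_arr[OF that(2)]
        R1.T_Comp[OF that] R2.T_Comp[OF that] by simp
  qed (use B.category_axioms D.category_axioms R1.T_P' R2.T_P' in \<open>auto simp: pair_func_def\<close>)
  show "f = g" if f: "f \<in> hom ?B Z Z'" and g: "g \<in> hom ?B Z Z'" and eq: "FArr ?F f = FArr ?F g"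
    for Z Z' f g
  proof -
    obtain t s where P: "P Z" "P Z'" and t: "set_iso C Z Z' t" and s: "set_iso C Z Z' s"
      and fg: "f = (Z, iso_family C Z Z' t, Z')" "g = (Z, iso_family C Z Z' s, Z')"
      using f g by (auto simp: R1.dom.iso_cat_hom)
    have "t a x = s a x" if a: "a \<in> Obj C" and x: "x \<in> FObj Z a" for a x
      using a
    proof (cases rule: Obj_cases)
      case (1 a')
      then show ?thesis using R1.T_faithful[OF P t s] eq F_arr[OF f] F_arr[OF g] fg x by simp
    next
      case (2 a')
      then show ?thesis using R2.T_faithful[OF P t s] eq F_arr[OF f] F_arr[OF g] fg x by simp
    qed
    then show "f = g" unfolding fg by (auto intro: iso_family_eqI)
  qed
  show "\<exists>f \<in> hom ?B Z Z'. FArr ?F f = h"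
    if Z: "Z \<in> Obj ?B" and Z': "Z' \<in> Obj ?B" and h: "h \<in> hom ?D (FObj ?F Z) (FObj ?F Z')" for Z Z' h
  proof -
    have P: "P Z" "P Z'" using Z Z' by auto
    have h12: "fst h \<in> hom (iso_cat C1 P1) (FObj T1 Z) (FObj T1 Z')"
      "snd h \<in> hom (iso_cat C2 P2) (FObj T2 Z) (FObj T2 Z')"
      using h P by (auto simp: prod_hom F_obj)
    obtain s1 where s1: "set_iso C1 (J1.res Z) (J1.res Z') s1"
      and T1: "\<And>t. set_iso C Z Z' t \<Longrightarrow> \<forall>a \<in> Obj C1. \<forall>x. t (FObj J1 a) x = s1 a x \<Longrightarrow>
        FArr T1 (Z, iso_family C Z Z' t, Z') = fst h"
      using R1.T_full[OF P h12(1)] by blast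
    obtain s2 where s2: "set_iso C2 (J2.res Z) (J2.res Z') s2"
      and T2: "\<And>t. set_iso C Z Z' t \<Longrightarrow> \<forall>a \<in> Obj C2. \<forall>x. t (FObj J2 a) x = s2 a x \<Longrightarrow>
        FArr T2 (Z, iso_family C Z Z' t, Z') = snd h"
      using R2.T_full[OF P h12(2)] by blast
    note t = glue_isos[OF s1 s2]
    have m: "(Z, iso_family C Z Z' (glue_obj s1 s2), Z') \<in> hom ?B Z Z'"
      using t P by (auto simp: R1.dom.iso_cat_hom)
    show ?thesis
      using F_arr[OF m] T1[OF t] T2[OF t] m by (intro bexI[OF _ m]) simp
  qed
  show "\<exists>Z \<in> Obj ?B. \<exists>e. e \<in> hom ?D (FObj ?F Z) d" if d_Obj: "d \<in> Obj ?D" for d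
  proof -
    obtain A B where d: "d = (A, B)" and A: "P1 A" and B: "P2 B"
      using d_Obj by (cases d) auto
    obtain X1 where X1: "Q1 X1" "is_functor C1 set_cat X1" and e1: "\<And>Z. P Z \<Longrightarrow> J1.res Z = X1 \<Longrightarrow>
        \<exists>e. e \<in> hom (iso_cat C1 P1) (FObj T1 Z) A"
      using R1.T_surj[OF A] by blast
    obtain X2 where X2: "Q2 X2" "is_functor C2 set_cat X2" and e2: "\<And>Z. P Z \<Longrightarrow> J2.res Z = X2 \<Longrightarrow>
        \<exists>e. e \<in> hom (iso_cat C2 P2) (FObj T2 Z) B"
      using R2.T_surj[OF B] by blast
    obtain Z where Z: "is_functor C set_cat Z" "J1.res Z = X1" "J2.res Z = X2"
      using glue_functors[OF X1(2) X2(2)] by blast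
    then have "P Z" using P_I X1 X2 by simp
    moreover obtain e e' where "e \<in> hom (iso_cat C1 P1) (FObj T1 Z) A"
      "e' \<in> hom (iso_cat C2 P2) (FObj T2 Z) B"
      using e1[OF \<open>P Z\<close> Z(2)] e2[OF \<open>P Z\<close> Z(3)] by blast
    ultimately show ?thesis
      using F_obj d by (intro bexI[of _ Z] exI[of _ "(e, e')"]) (auto simp: prod_hom)
  qed
qed

end

section \<open>Admissibility\<close>

lemma upper_simps [simp]:
  "\<gamma> \<in> Obj G \<Longrightarrow> FObj (upper H G X \<eta>) \<gamma> = FObj X (\<eta>, \<gamma>)"
  "g \<in> Arr G \<Longrightarrow> FArr (upper H G X \<eta>) g = FArr X (Id H \<eta>, g)"
  by (simp_all add: upper_def)

lemma lower_simps [simp]: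
  "\<eta> \<in> Obj H \<Longrightarrow> FObj (lower H G X \<gamma>) \<eta> = FObj X (\<eta>, \<gamma>)"
  "h \<in> Arr H \<Longrightarrow> FArr (lower H G X \<gamma>) h = FArr X (h, Id G \<gamma>)"
  by (simp_all add: lower_def)

lemma bisetD:
  assumes "is_biset H G X" "category H" "category G"
  shows "h \<in> hom H a b \<Longrightarrow> g \<in> hom G c d \<Longrightarrow> x \<in> FObj X (b, c) \<Longrightarrow> act X (h, g) x \<in> FObj X (a, d)"
    and "a \<in> Obj H \<Longrightarrow> c \<in> Obj G \<Longrightarrow> x \<in> FObj X (a, c) \<Longrightarrow> act X (Id H a, Id G c) x = x"
    and "h \<in> hom H a b \<Longrightarrow> h' \<in> hom H b b' \<Longrightarrow> g \<in> hom G c d \<Longrightarrow> g' \<in> hom G d d' \<Longrightarrow>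
      x \<in> FObj X (b', c) \<Longrightarrow> act X (h, g') (act X (h', g) x) = act X (Comp H h' h, Comp G g' g) x"
proof -
  have X: "is_functor (prod_cat (op_cat H) G) set_cat X"
    using assms(1) by (simp add: is_biset_def)
  show "h \<in> hom H a b \<Longrightarrow> g \<in> hom G c d \<Longrightarrow> x \<in> FObj X (b, c) \<Longrightarrow> act X (h, g) x \<in> FObj X (a, d)"
    using set_functorD(5)[OF X, of "(h, g)" "(b, c)" "(a, d)" x] by (simp add: prod_hom)
  show "a \<in> Obj H \<Longrightarrow> c \<in> Obj G \<Longrightarrow> x \<in> FObj X (a, c) \<Longrightarrow> act X (Id H a, Id G c) x = x"
    using set_functorD(6)[OF X, of "(a, c)"] by simp
  show "h \<in> hom H a b \<Longrightarrow> h' \<in> hom H b b' \<Longrightarrow> g \<in> hom G c d \<Longrightarrow> g' \<in> hom G d d' \<Longrightarrow>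
      x \<in> FObj X (b', c) \<Longrightarrow> act X (h, g') (act X (h', g) x) = act X (Comp H h' h, Comp G g' g) x"
    using set_functorD(7)[OF X, of "(h', g)" "(b', c)" "(b, d)" "(h, g')" "(a, d')" x]
    by (simp add: prod_hom)
qed

lemma upper_functor:
  assumes X: "is_biset H G X" and H: "category H" and G: "category G" and \<eta>: "\<eta> \<in> Obj H"
  shows "is_functor G set_cat (upper H G X \<eta>)"
proof (rule set_functorI)
  interpret G: category G by fact
  note I = category.Id_in[OF H \<eta>]
  have X': "is_functor (prod_cat (op_cat H) G) set_cat X"
    using X by (simp add: is_biset_def)
  show "FArr (upper H G X \<eta>) g = (FObj (upper H G X \<eta>) a,
      restrict (act X (Id H \<eta>, g)) (FObj (upper H G X \<eta>) a), FObj (upper H G X \<eta>) b)"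
    if "g \<in> hom G a b" for g a b
    using set_functorD(4)[OF X', of "(Id H \<eta>, g)" "(\<eta>, a)" "(\<eta>, b)"] that G.hom_obj[OF that] I
    by (simp add: prod_hom hom_iff)
  show "act X (Id H \<eta>, g) x \<in> FObj (upper H G X \<eta>) b"
    if "g \<in> hom G a b" "x \<in> FObj (upper H G X \<eta>) a" for g a b x
    using bisetD(1)[OF X H G I that(1)] that G.hom_obj[OF that(1)] by simp
  show "act X (Id H \<eta>, Id G a) x = x" if "a \<in> Obj G" "x \<in> FObj (upper H G X \<eta>) a" for a x
    using bisetD(2)[OF X H G \<eta>] that by simp
  show "act X (Id H \<eta>, Comp G g f) x = act X (Id H \<eta>, g) (act X (Id H \<eta>, f) x)"
    if "f \<in> hom G a b" "g \<in> hom G b c" "x \<in> FObj (upper H G X \<eta>) a" for f g a b c x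
    using bisetD(3)[OF X H G I I that(1,2)] that G.hom_obj[OF that(1)] category.Id_Comp[OF H I]
    by simp
qed (use G in \<open>auto simp: upper_def\<close>)

section \<open>Generated equivalence relations, orbits and finite generation\<close>

lemma equiv_equiv_gen: "equiv UNIV (equiv_gen r)"
  unfolding equiv_gen_def
  by (intro equivI refl_rtrancl trans_rtrancl sym_rtrancl) (auto simp: sym_def)

lemma equiv_gen_class_eq:
  "equiv_gen r `` {p} = equiv_gen r `` {q} \<longleftrightarrow> (p, q) \<in> equiv_gen r"
  using eq_equiv_class_iff[OF equiv_equiv_gen, of p q r] by simp

lemma equiv_gen_base: "(p, q) \<in> r \<Longrightarrow> (p, q) \<in> equiv_gen r" "(p, q) \<in> r \<Longrightarrow> (q, p) \<in> equiv_gen r"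
  by (auto simp: equiv_gen_def)

lemma equiv_gen_map:
  assumes "(p, q) \<in> equiv_gen r" "\<And>u v. (u, v) \<in> r \<Longrightarrow> (f u, f v) \<in> equiv_gen r'"
  shows "(f p, f q) \<in> equiv_gen r'"
  using assms(1) unfolding equiv_gen_def
proof (induction rule: rtrancl_induct)
  case (step u v)
  have "(f u, f v) \<in> equiv_gen r'"
    using step(2) assms(2)[of u v] assms(2)[of v u] equiv_equiv_gen[of r'] by (auto elim: equivE dest: symD)
  then show ?case using step(3) by (simp add: equiv_gen_def)
qed simp

text \<open>Provides invariants of classes, by which distinct elements of a quotient are told
  apart.\<close>

lemma equiv_gen_const:
  assumes "(p, q) \<in> equiv_gen r" "\<And>u v. (u, v) \<in> r \<Longrightarrow> f u = f v"
  shows "f p = f q"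
  using assms(1) unfolding equiv_gen_def
  by (induction rule: rtrancl_induct) (use assms(2) in fastforce)+

text \<open>A generator used backwards is undone by an inverse arrow, so a zigzag of generators
  composes to one arrow: over a groupoid the classes of the colimit are orbits. Since
  \<open>equiv_gen\<close> is reflexive on the whole type, membership in the carrier is carried
  along.\<close>

lemma colim_rel_orbit:
  assumes G: "groupoid G" and U: "is_functor G set_cat U"
    and pq: "(p, q) \<in> equiv_gen (colim_rel G U)" and p: "p \<in> Sigma (Obj G) (FObj U)"
  shows "q \<in> Sigma (Obj G) (FObj U) \<and> (\<exists>g \<in> hom G (fst p) (fst q). act U g (snd p) = snd q)"
proof -
  interpret groupoid G by fact
  show ?thesis
    using pq unfolding equiv_gen_def
  proof (induction rule: rtrancl_induct)
    case base
    show ?case using p Id_in set_functorD(6)[OF U] by force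
  next
    case (step u v)
    then obtain g where u: "u \<in> Sigma (Obj G) (FObj U)" and g: "g \<in> hom G (fst p) (fst u)"
      and gp: "act U g (snd p) = snd u" by blast
    have x: "snd p \<in> FObj U (fst p)" using p by auto
    have "\<exists>h \<in> hom G (fst u) (fst v). act U h (snd u) = snd v"
      using step(2)
    proof
      assume "(u, v) \<in> colim_rel G U"
      then show ?thesis using Arr_hom by (auto simp: colim_rel_def)
    next
      assume "(u, v) \<in> (colim_rel G U)\<inverse>"
      then obtain h y where h: "h \<in> Arr G" "y \<in> FObj U (Dom G h)"
        and uv: "v = (Dom G h, y)" "u = (Cod G h, act U h y)"
        by (auto simp: colim_rel_def)
      note h' = Arr_hom[OF h(1)]
      show ?thesis
        using set_functorD(7)[OF U h' inverse_arr(1)[OF h'] h(2)] inverse_arr(1,2)[OF h']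
          set_functorD(6)[OF U _ h(2)] Dom_in[OF h(1)] uv
        by (intro bexI[of _ "inverse_arr G h"]) auto
    qed
    then obtain h where h: "h \<in> hom G (fst u) (fst v)" "act U h (snd u) = snd v" by blast
    have "v \<in> Sigma (Obj G) (FObj U)"
      using h set_functorD(5)[OF U h(1), of "snd u"] u hom_obj[OF h(1)] by (cases v) auto
    moreover have "act U (Comp G h g) (snd p) = snd v"
      using set_functorD(7)[OF U g h(1) x] gp h(2) by simp
    ultimately show ?case using Comp_in[OF g h(1)] by blast
  qed
qed

text \<open>
  Over a groupoid, finiteness of the colimit amounts to a finite generating set, which is
  easier to transport than the colimit itself.
\<close>

definition free_fin_gen :: "('o, 'a) cat \<Rightarrow> ('o \<Rightarrow> 'u set) \<Rightarrow> ('a \<Rightarrow> 'u \<Rightarrow> 'u) \<Rightarrow> bool" where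
  "free_fin_gen G S m \<longleftrightarrow>
     (\<forall>a \<in> Obj G. \<forall>b \<in> Obj G. \<forall>x \<in> S a. inj_on (\<lambda>g. m g x) (hom G a b)) \<and>
     (\<exists>F. finite F \<and> F \<subseteq> Sigma (Obj G) S \<and>
        (\<forall>b \<in> Obj G. \<forall>y \<in> S b. \<exists>a x. (a, x) \<in> F \<and> (\<exists>g \<in> hom G a b. m g x = y)))"

lemma free_fin_gen_inj:
  "free_fin_gen G S m \<Longrightarrow> a \<in> Obj G \<Longrightarrow> b \<in> Obj G \<Longrightarrow> x \<in> S a \<Longrightarrow> inj_on (\<lambda>g. m g x) (hom G a b)"
  by (simp add: free_fin_gen_def)

lemma free_fin_genE:
  assumes "free_fin_gen G S m"
  obtains F where "finite F" "F \<subseteq> Sigma (Obj G) S"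
    "\<forall>b \<in> Obj G. \<forall>y \<in> S b. \<exists>a x. (a, x) \<in> F \<and> (\<exists>g \<in> hom G a b. m g x = y)"
proof -
  obtain F where "finite F \<and> F \<subseteq> Sigma (Obj G) S \<and>
      (\<forall>b \<in> Obj G. \<forall>y \<in> S b. \<exists>a x. (a, x) \<in> F \<and> (\<exists>g \<in> hom G a b. m g x = y))"
    using conjunct2[OF assms[unfolded free_fin_gen_def]] by (rule exE)
  then show thesis by (intro that[of F]) auto
qed

text \<open>One representative of each class generates, since classes are orbits. Conversely every
  class is the class of some generator, so there are finitely many.\<close>

lemma fin_gen_gset_iff:
  assumes G: "groupoid G" and U: "is_functor G set_cat U"
  shows "fin_gen_gset G U \<longleftrightarrow> (\<exists>F. finite F \<and> F \<subseteq> Sigma (Obj G) (FObj U) \<and>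
    (\<forall>b \<in> Obj G. \<forall>y \<in> FObj U b. \<exists>a x. (a, x) \<in> F \<and> (\<exists>g \<in> hom G a b. act U g x = y)))"
    (is "_ \<longleftrightarrow> (\<exists>F. ?gen F)")
proof
  interpret groupoid G by fact
  let ?E = "equiv_gen (colim_rel G U)" and ?S = "Sigma (Obj G) (FObj U)"
  assume fin: "fin_gen_gset G U"
  have "\<forall>c \<in> colim G U. \<exists>p \<in> ?S. c = ?E `` {p}"
    by (auto simp: colim_def quotient_def)
  then obtain r where r: "\<And>c. c \<in> colim G U \<Longrightarrow> r c \<in> ?S" "\<And>c. c \<in> colim G U \<Longrightarrow> c = ?E `` {r c}"
    by metis
  have "?gen (r ` colim G U)"
  proof (intro conjI ballI)
    show "finite (r ` colim G U)" using fin by (simp add: fin_gen_gset_def)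
    show "r ` colim G U \<subseteq> ?S" using r by blast
    fix b y assume b_y: "b \<in> Obj G" "y \<in> FObj U b"
    let ?c = "?E `` {(b, y)}"
    have c: "?c \<in> colim G U" using b_y by (auto simp: colim_def quotient_def)
    then have "(r ?c, (b, y)) \<in> ?E"
      using r(2)[OF c] equiv_gen_class_eq by metis
    then obtain g where "g \<in> hom G (fst (r ?c)) b" "act U g (snd (r ?c)) = y"
      using colim_rel_orbit[OF G U _ r(1)[OF c]] by fastforce
    then show "\<exists>a x. (a, x) \<in> r ` colim G U \<and> (\<exists>g \<in> hom G a b. act U g x = y)"
      using c by (intro exI[of _ "fst (r ?c)"] exI[of _ "snd (r ?c)"]) auto
  qed
  then show "\<exists>F. ?gen F" by blast
next
  let ?E = "equiv_gen (colim_rel G U)"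
  assume "\<exists>F. ?gen F"
  then obtain F where F: "?gen F" by blast
  have "colim G U \<subseteq> (\<lambda>p. ?E `` {p}) ` F"
  proof
    fix c assume "c \<in> colim G U"
    then obtain b y where c: "c = ?E `` {(b, y)}" and "b \<in> Obj G" "y \<in> FObj U b"
      by (auto simp: colim_def quotient_def)
    then obtain a x g where ax: "(a, x) \<in> F" and g: "g \<in> hom G a b" "act U g x = y"
      using F by blast
    then have "((a, x), (b, y)) \<in> colim_rel G U"
      using F by (force simp: colim_rel_def hom_iff)
    then have "c = ?E `` {(a, x)}"
      unfolding c equiv_gen_class_eq by (rule equiv_gen_base(2))
    then show "c \<in> (\<lambda>p. ?E `` {p}) ` F"
      using ax by blast
  qed
  then show "fin_gen_gset G U"
    using F finite_surj unfolding fin_gen_gset_def by blast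
qed

lemma free_fin_gen_cong:
  assumes "\<And>a. a \<in> Obj G \<Longrightarrow> S a = S' a"
    and "\<And>g a b x. g \<in> hom G a b \<Longrightarrow> a \<in> Obj G \<Longrightarrow> x \<in> S a \<Longrightarrow> m g x = m' g x"
  shows "free_fin_gen G S m \<longleftrightarrow> free_fin_gen G S' m'"
proof -
  have S: "Sigma (Obj G) S = Sigma (Obj G) S'" using assms(1) by auto
  have "(\<exists>a x. (a, x) \<in> F \<and> (\<exists>g \<in> hom G a b. m g x = y)) \<longleftrightarrow>
      (\<exists>a x. (a, x) \<in> F \<and> (\<exists>g \<in> hom G a b. m' g x = y))" if "F \<subseteq> Sigma (Obj G) S'" for F b y
    using that assms by (intro ex_cong1 conj_cong refl bex_cong) auto
  moreover have "inj_on (\<lambda>g. m g x) (hom G a b) \<longleftrightarrow> inj_on (\<lambda>g. m' g x) (hom G a b)"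
    if "a \<in> Obj G" "x \<in> S' a" for a b x
    using that assms by (intro inj_on_cong) auto
  ultimately show ?thesis
    unfolding free_fin_gen_def S using assms(1) by (auto cong: ball_cong conj_cong)
qed

text \<open>Admissibility in terms of the values and action of \<open>X\<close> itself, so that
  later proofs need not pass through \<open>upper\<close>.\<close>

lemma admissible_iff:
  assumes H: "category H" and G: "groupoid G"
  shows "admissible H G X \<longleftrightarrow> is_functor (prod_cat (op_cat H) G) set_cat X \<and>
    (\<forall>\<eta> \<in> Obj H. free_fin_gen G (\<lambda>\<gamma>. FObj X (\<eta>, \<gamma>)) (\<lambda>g. act X (Id H \<eta>, g)))"
proof -
  interpret G: groupoid G by fact
  have "free_gset G (upper H G X \<eta>) \<and> fin_gen_gset G (upper H G X \<eta>) \<longleftrightarrow>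
      free_fin_gen G (\<lambda>\<gamma>. FObj X (\<eta>, \<gamma>)) (\<lambda>g. act X (Id H \<eta>, g))"
    if X: "is_biset H G X" and \<eta>: "\<eta> \<in> Obj H" for \<eta>
  proof -
    have "free_gset G (upper H G X \<eta>) \<and> fin_gen_gset G (upper H G X \<eta>) \<longleftrightarrow>
        free_fin_gen G (FObj (upper H G X \<eta>)) (act (upper H G X \<eta>))"
      unfolding free_fin_gen_def fin_gen_gset_iff[OF G upper_functor[OF X H G.category_axioms \<eta>]]
        free_gset_def by blast
    also have "\<dots> \<longleftrightarrow> free_fin_gen G (\<lambda>\<gamma>. FObj X (\<eta>, \<gamma>)) (\<lambda>g. act X (Id H \<eta>, g))"
      by (rule free_fin_gen_cong) (auto simp: hom_iff)
    finally show ?thesis .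
  qed
  then show ?thesis by (auto simp: admissible_def is_biset_def)
qed

text \<open>The generators are moved along \<open>t\<close>, and freeness survives because
  \<open>t\<close> is injective; source and target may lie over different types.\<close>

lemma free_fin_gen_iso:
  assumes G: "category G" and S: "free_fin_gen G S m"
    and m: "\<And>a b g x. g \<in> hom G a b \<Longrightarrow> x \<in> S a \<Longrightarrow> m g x \<in> S b"
    and bij: "\<And>a. a \<in> Obj G \<Longrightarrow> bij_betw (t a) (S a) (S' a)"
    and nat: "\<And>a b g x. g \<in> hom G a b \<Longrightarrow> x \<in> S a \<Longrightarrow> t b (m g x) = m' g (t a x)"
  shows "free_fin_gen G S' m'"
proof -
  interpret category G by fact
  obtain F where F: "finite F" "F \<subseteq> Sigma (Obj G) S"
    "\<forall>b \<in> Obj G. \<forall>y \<in> S b. \<exists>a x. (a, x) \<in> F \<and> (\<exists>g \<in> hom G a b. m g x = y)"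
    by (rule free_fin_genE[OF S])
  note inj = free_fin_gen_inj[OF S]
  have pre: "\<exists>x \<in> S a. y = t a x" if "a \<in> Obj G" "y \<in> S' a" for a y
    using bij that unfolding bij_betw_def by blast
  have "inj_on (\<lambda>g. m' g y) (hom G a b)" if ab: "a \<in> Obj G" "b \<in> Obj G" and y: "y \<in> S' a" for a b y
  proof -
    obtain x where x: "x \<in> S a" "y = t a x" using pre ab y by blast
    have "inj_on (\<lambda>g. t b (m g x)) (hom G a b)"
    proof (rule inj_onI)
      fix g g' assume g: "g \<in> hom G a b" "g' \<in> hom G a b" and "t b (m g x) = t b (m g' x)"
      then have "m g x = m g' x"
        using bij[OF ab(2)] m[OF _ x(1)] unfolding bij_betw_def by (auto dest: inj_onD)
      then show "g = g'" using inj[OF ab x(1)] g by (auto dest: inj_onD)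
    qed
    moreover have "inj_on (\<lambda>g. t b (m g x)) (hom G a b) \<longleftrightarrow> inj_on (\<lambda>g. m' g y) (hom G a b)"
      by (rule inj_on_cong) (simp add: nat x)
    ultimately show ?thesis by simp
  qed
  moreover have "\<exists>a x. (a, x) \<in> (\<lambda>(a, x). (a, t a x)) ` F \<and> (\<exists>g \<in> hom G a b. m' g x = y)"
    if b: "b \<in> Obj G" and y: "y \<in> S' b" for b y
  proof -
    obtain z where z: "z \<in> S b" "y = t b z" using pre b y by blast
    obtain a x g where "(a, x) \<in> F" "g \<in> hom G a b" "m g x = z"
      using F(3) b z(1) by blast
    moreover from this have "m' g (t a x) = y" using nat[of g a b x] F(2) z by auto
    ultimately show ?thesis by force
  qed
  moreover have "(\<lambda>(a, x). (a, t a x)) ` F \<subseteq> Sigma (Obj G) S'"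
    using F(2) bij by (auto intro: bij_betw_apply)
  ultimately show ?thesis
    unfolding free_fin_gen_def using F(1) by (intro conjI exI[of _ "(\<lambda>(a, x). (a, t a x)) ` F"]) auto
qed

text \<open>Through this invariance the tensor products with the representing bi-sets inherit
  admissibility from restrictions, also across universes.\<close>

lemma admissible_iso:
  assumes H: "category H" and G: "groupoid G" and X: "admissible H G X"
    and Y: "is_functor (prod_cat (op_cat H) G) set_cat Y"
    and t: "set_iso (prod_cat (op_cat H) G) X Y t"
  shows "admissible H G Y"
proof -
  interpret G: groupoid G by fact
  have X': "is_biset H G X" using X by (simp add: admissible_def)
  have "free_fin_gen G (\<lambda>\<gamma>. FObj Y (\<eta>, \<gamma>)) (\<lambda>g. act Y (Id H \<eta>, g))" if \<eta>: "\<eta> \<in> Obj H" for \<eta>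
  proof (rule free_fin_gen_iso[where t = "\<lambda>\<gamma>. t (\<eta>, \<gamma>)" and m = "\<lambda>g. act X (Id H \<eta>, g)"])
    show "free_fin_gen G (\<lambda>\<gamma>. FObj X (\<eta>, \<gamma>)) (\<lambda>g. act X (Id H \<eta>, g))"
      using X \<eta> by (simp add: admissible_iff[OF H G])
    show "act X (Id H \<eta>, g) x \<in> FObj X (\<eta>, b)" if "g \<in> hom G a b" "x \<in> FObj X (\<eta>, a)" for a b g x
      using bisetD(1)[OF X' H G.category_axioms category.Id_in[OF H \<eta>]] that .
    show "bij_betw (t (\<eta>, a)) (FObj X (\<eta>, a)) (FObj Y (\<eta>, a))" if "a \<in> Obj G" for a
      using set_isoD(1)[OF t, of "(\<eta>, a)"] that \<eta> by simp
    show "t (\<eta>, b) (act X (Id H \<eta>, g) x) = act Y (Id H \<eta>, g) (t (\<eta>, a) x)"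
      if "g \<in> hom G a b" "x \<in> FObj X (\<eta>, a)" for a b g x
      using set_isoD(3)[OF t, of "(Id H \<eta>, g)" "(\<eta>, a)" "(\<eta>, b)"] that category.Id_in[OF H \<eta>]
      by (simp add: prod_hom)
  qed (rule G.category_axioms)
  then show ?thesis using Y by (simp add: admissible_iff[OF H G])
qed

text \<open>An element is determined by a generator and an arrow carrying that generator to it.
  Hence \<open>S b\<close> injects into the product of a finite set with \<open>'u\<close>, which
  the infinite type \<open>'u\<close> absorbs.\<close>

lemma free_fin_gen_small:
  assumes S: "free_fin_gen G S m" and b: "b \<in> Obj G"
    and inf: "infinite (UNIV :: 'u set)" and small: "\<And>a b. hom G a b \<lesssim> (UNIV :: 'u set)"
  shows "S b \<lesssim> (UNIV :: 'u set)"
proof -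
  obtain F where F: "finite F"
    "\<And>y. y \<in> S b \<Longrightarrow> \<exists>a x. (a, x) \<in> F \<and> (\<exists>g \<in> hom G a b. m g x = y)"
    using free_fin_genE[OF S] b by metis
  have "\<forall>a. \<exists>e :: _ \<Rightarrow> 'u. inj_on e (hom G a b)"
    using small by (auto simp: lepoll_def)
  then obtain e :: "_ \<Rightarrow> _ \<Rightarrow> 'u" where e: "\<And>a. inj_on (e a) (hom G a b)"
    by metis
  \<comment> \<open>For each \<open>y\<close>, choose a generator \<open>(a y, x y)\<close> and an
    arrow \<open>g y\<close> that takes it to \<open>y\<close>.\<close>
  obtain a x g where w: "\<And>y. y \<in> S b \<Longrightarrow> (a y, x y) \<in> F \<and> g y \<in> hom G (a y) b \<and> m (g y) (x y) = y"
    using F(2) by metis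
  have "inj_on (\<lambda>y. ((a y, x y), e (a y) (g y))) (S b)"
  proof (rule inj_onI)
    fix y z assume yz: "y \<in> S b" "z \<in> S b"
      and eq: "((a y, x y), e (a y) (g y)) = ((a z, x z), e (a z) (g z))"
    then have "g y = g z" using w[OF yz(1)] w[OF yz(2)] e[of "a y"] by (auto dest: inj_onD)
    then show "y = z" using w[OF yz(1)] w[OF yz(2)] eq by (metis prod.inject)
  qed
  then have "S b \<lesssim> F \<times> (UNIV :: 'u set)"
    using w unfolding lepoll_def by (intro exI conjI) auto
  also have "F \<times> (UNIV :: 'u set) \<lesssim> (UNIV :: 'u set) \<times> (UNIV :: 'u set)"
    using finite_lepoll_infinite[OF inf F(1)] by (rule times_lepoll_mono) simp
  also have "\<dots> \<lesssim> (UNIV :: 'u set)"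
    using card_of_Times_same_infinite[OF inf] by (simp add: eqpoll_imp_lepoll eqpoll_iff_card_of_ordIso)
  finally show ?thesis .
qed

section \<open>Freeness and finite generation on the parts of a groupoid\<close>

context component
begin

text \<open>An arrow ending in the component also starts there, so the generators that lie over the
  component already generate the restriction.\<close>

lemma free_fin_gen_res:
  assumes "free_fin_gen C S m"
  shows "free_fin_gen C1 (\<lambda>a. S (FObj J a)) (\<lambda>g. m (FArr J g))"
proof -
  obtain F where F: "finite F" "F \<subseteq> Sigma (Obj C) S"
    "\<forall>b \<in> Obj C. \<forall>y \<in> S b. \<exists>a x. (a, x) \<in> F \<and> (\<exists>g \<in> hom C a b. m g x = y)"
    by (rule free_fin_genE[OF assms])
  let ?F = "(\<lambda>(a, x). (FObj J a, x)) -` F"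
  have "inj_on (\<lambda>g. m (FArr J g) x) (hom C1 a b)"
    if "a \<in> Obj C1" "b \<in> Obj C1" "x \<in> S (FObj J a)" for a b x
  proof -
    have "inj_on (\<lambda>g. m g x) (hom C (FObj J a) (FObj J b))"
      using free_fin_gen_inj[OF assms] that by simp
    then show ?thesis unfolding inj_on_def using hom_J J_eq(2) by metis
  qed
  moreover have "finite ?F"
    using F(1) by (rule finite_vimageI) (auto simp: inj_on_def)
  moreover have "\<exists>a x. (a, x) \<in> ?F \<and> (\<exists>g \<in> hom C1 a b. m (FArr J g) x = y)"
    if b: "b \<in> Obj C1" and y: "y \<in> S (FObj J b)" for b y
  proof -
    obtain a x g where "(a, x) \<in> F" "g \<in> hom C a (FObj J b)" "m g x = y"
      using F(3)[rule_format, of "FObj J b" y] b y by auto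
    then show ?thesis using hom_to by force
  qed
  moreover have "?F \<subseteq> (SIGMA a : Obj C1. S (FObj J a))" using F(2) by auto
  ultimately show ?thesis
    unfolding free_fin_gen_def by (intro conjI exI[of _ ?F]) auto
qed

end

text \<open>The union of the two generating sets is finite and generates. Freeness concerns one
  hom-set at a time, and a nonempty hom-set lies in a single part.\<close>

lemma (in decomposition) free_fin_gen_glue:
  assumes S1: "free_fin_gen C1 (\<lambda>a. S (FObj J1 a)) (\<lambda>g. m (FArr J1 g))"
    and S2: "free_fin_gen C2 (\<lambda>a. S (FObj J2 a)) (\<lambda>g. m (FArr J2 g))"
  shows "free_fin_gen C S m"
proof -
  obtain F1 where F1: "finite F1" "F1 \<subseteq> (SIGMA a : Obj C1. S (FObj J1 a))"
    "\<forall>b \<in> Obj C1. \<forall>y \<in> S (FObj J1 b).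
      \<exists>a x. (a, x) \<in> F1 \<and> (\<exists>g \<in> hom C1 a b. m (FArr J1 g) x = y)"
    by (rule free_fin_genE[OF S1])
  obtain F2 where F2: "finite F2" "F2 \<subseteq> (SIGMA a : Obj C2. S (FObj J2 a))"
    "\<forall>b \<in> Obj C2. \<forall>y \<in> S (FObj J2 b).
      \<exists>a x. (a, x) \<in> F2 \<and> (\<exists>g \<in> hom C2 a b. m (FArr J2 g) x = y)"
    by (rule free_fin_genE[OF S2])
  let ?F = "(\<lambda>(a, x). (FObj J1 a, x)) ` F1 \<union> (\<lambda>(a, x). (FObj J2 a, x)) ` F2"
  have "inj_on (\<lambda>g. m g x) (hom C a b)"
    if a: "a \<in> Obj C" and b: "b \<in> Obj C" and x: "x \<in> S a" for a b x
  proof (rule inj_onI)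
    fix g g' assume g: "g \<in> hom C a b" and g': "g' \<in> hom C a b" and eq: "m g x = m g' x"
    show "g = g'"
      using g
    proof (cases rule: hom_cases)
      case (1 f a' b')
      then obtain f' where "g' = FArr J1 f'" "f' \<in> hom C1 a' b'" using J1.hom_from g' by fastforce
      moreover have "inj_on (\<lambda>g. m (FArr J1 g) x) (hom C1 a' b')"
        using free_fin_gen_inj[OF S1] x 1 J1.C1.hom_obj[OF 1(4)] by simp
      ultimately show ?thesis using 1 eq by (auto dest: inj_onD)
    next
      case (2 f a' b')
      then obtain f' where "g' = FArr J2 f'" "f' \<in> hom C2 a' b'" using J2.hom_from g' by fastforce
      moreover have "inj_on (\<lambda>g. m (FArr J2 g) x) (hom C2 a' b')"
        using free_fin_gen_inj[OF S2] x 2 J2.C1.hom_obj[OF 2(4)] by simp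
      ultimately show ?thesis using 2 eq by (auto dest: inj_onD)
    qed
  qed
  moreover have "\<exists>a x. (a, x) \<in> ?F \<and> (\<exists>g \<in> hom C a b. m g x = y)"
    if b: "b \<in> Obj C" and y: "y \<in> S b" for b y
    using b
  proof (cases rule: Obj_cases)
    case (1 b')
    then obtain a x g where "(a, x) \<in> F1" "g \<in> hom C1 a b'" "m (FArr J1 g) x = y"
      using F1(3) y by blast
    then show ?thesis
      using 1 by (intro exI[of _ "FObj J1 a"] exI[of _ x] conjI bexI[of _ "FArr J1 g"]) force+
  next
    case (2 b')
    then obtain a x g where "(a, x) \<in> F2" "g \<in> hom C2 a b'" "m (FArr J2 g) x = y"
      using F2(3) y by blast
    then show ?thesis
      using 2 by (intro exI[of _ "FObj J2 a"] exI[of _ x] conjI bexI[of _ "FArr J2 g"]) force+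
  qed
  moreover have "finite ?F" "?F \<subseteq> Sigma (Obj C) S" using F1 F2 by auto
  ultimately show ?thesis
    unfolding free_fin_gen_def by (intro conjI exI[of _ ?F]) auto
qed

section \<open>Decompositions of opposites and of products\<close>

definition func_on_fst :: "('p, 'b, 'o, 'a) func \<Rightarrow> ('p \<times> 'k, 'b \<times> 'l, 'o \<times> 'k, 'a \<times> 'l) func" where
  "func_on_fst J = \<lparr>FObj = map_prod (FObj J) id, FArr = map_prod (FArr J) id\<rparr>"

definition func_on_snd :: "('p, 'b, 'o, 'a) func \<Rightarrow> ('k \<times> 'p, 'l \<times> 'b, 'k \<times> 'o, 'l \<times> 'a) func" where
  "func_on_snd J = \<lparr>FObj = map_prod id (FObj J), FArr = map_prod id (FArr J)\<rparr>"

lemma func_on_simps [simp]: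
  "FObj (func_on_fst J) (a, k) = (FObj J a, k)" "FArr (func_on_fst J) (f, l) = (FArr J f, l)"
  "FObj (func_on_snd J) (k, a) = (k, FObj J a)" "FArr (func_on_snd J) (l, f) = (l, FArr J f)"
  by (simp_all add: func_on_fst_def func_on_snd_def)

context component
begin

text \<open>Passing to the opposite exchanges \<open>Dom_closed\<close> and
  \<open>Cod_closed\<close>.\<close>

lemma component_op: "component (op_cat C1) (op_cat C) J"
proof (intro component.intro component_axioms.intro)
  show "h \<in> range (FArr J)" if "h \<in> Arr (op_cat C)" "Dom (op_cat C) h = FObj J a" for h a
    using Cod_closed that by simp
  show "h \<in> range (FArr J)" if "h \<in> Arr (op_cat C)" "Cod (op_cat C) h = FObj J a" for h a
    using Dom_closed that by simp
qed (use C1.category_axioms C.category_axioms category_op Id_J Comp_J inj_obj inj_arr in auto)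

lemma component_fst:
  assumes K: "category K" shows "component (prod_cat C1 K) (prod_cat C K) (func_on_fst J)"
proof (intro component.intro component_axioms.intro)
  show "h \<in> range (FArr (func_on_fst J))"
    if "h \<in> Arr (prod_cat C K)" "Dom (prod_cat C K) h = FObj (func_on_fst J) a" for h a
    using Dom_closed[of "fst h" "fst a"] that
    by (cases h; cases a) (auto simp: image_iff func_on_fst_def)
  show "h \<in> range (FArr (func_on_fst J))"
    if "h \<in> Arr (prod_cat C K)" "Cod (prod_cat C K) h = FObj (func_on_fst J) a" for h a
    using Cod_closed[of "fst h" "fst a"] that
    by (cases h; cases a) (auto simp: image_iff func_on_fst_def)
qed (use K C1.category_axioms C.category_axioms category_prod Id_J Comp_J in
  \<open>auto simp: func_on_fst_def inj_def\<close>)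

lemma component_snd:
  assumes K: "category K" shows "component (prod_cat K C1) (prod_cat K C) (func_on_snd J)"
proof (intro component.intro component_axioms.intro)
  show "h \<in> range (FArr (func_on_snd J))"
    if "h \<in> Arr (prod_cat K C)" "Dom (prod_cat K C) h = FObj (func_on_snd J) a" for h a
    using Dom_closed[of "snd h" "snd a"] that
    by (cases h; cases a) (auto simp: image_iff func_on_snd_def)
  show "h \<in> range (FArr (func_on_snd J))"
    if "h \<in> Arr (prod_cat K C)" "Cod (prod_cat K C) h = FObj (func_on_snd J) a" for h a
    using Cod_closed[of "snd h" "snd a"] that
    by (cases h; cases a) (auto simp: image_iff func_on_snd_def)
qed (use K C1.category_axioms C.category_axioms category_prod Id_J Comp_J in
  \<open>auto simp: func_on_snd_def inj_def\<close>)

end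

context decomposition
begin

lemma decomposition_op: "decomposition (op_cat C1) (op_cat C2) (op_cat C) J1 J2"
proof (intro decomposition.intro decomposition_axioms.intro J1.component_op J2.component_op)
  show "c \<in> range (FObj J1) \<union> range (FObj J2)" if "c \<in> Obj (op_cat C)" for c
    using cover that by simp
qed simp

lemma decomposition_fst:
  assumes "category K"
  shows "decomposition (prod_cat C1 K) (prod_cat C2 K) (prod_cat C K) (func_on_fst J1) (func_on_fst J2)"
proof (intro decomposition.intro decomposition_axioms.intro J1.component_fst J2.component_fst assms)
  show "c \<in> range (FObj (func_on_fst J1)) \<union> range (FObj (func_on_fst J2))"
    if "c \<in> Obj (prod_cat C K)" for c
    using cover[of "fst c"] that by (cases c) (auto simp: image_iff func_on_fst_def)
qed (simp add: func_on_fst_def map_prod_def split: prod.splits)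

lemma decomposition_snd:
  assumes "category K"
  shows "decomposition (prod_cat K C1) (prod_cat K C2) (prod_cat K C) (func_on_snd J1) (func_on_snd J2)"
proof (intro decomposition.intro decomposition_axioms.intro J1.component_snd J2.component_snd assms)
  show "c \<in> range (FObj (func_on_snd J1)) \<union> range (FObj (func_on_snd J2))"
    if "c \<in> Obj (prod_cat K C)" for c
    using cover[of "snd c"] that by (cases c) (auto simp: image_iff func_on_snd_def)
qed (simp add: func_on_snd_def map_prod_def split: prod.splits)

end

definition inl_func :: "('o, 'a, 'o + 'p, 'a + 'b) func" where
  "inl_func = \<lparr>FObj = Inl, FArr = Inl\<rparr>"

definition inr_func :: "('p, 'b, 'o + 'p, 'a + 'b) func" where
  "inr_func = \<lparr>FObj = Inr, FArr = Inr\<rparr>"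

lemma decomposition_coprod:
  fixes G :: "('o, 'a) cat" and H :: "('p, 'b) cat"
  assumes G: "groupoid G" and H: "groupoid H"
  shows "decomposition G H (G \<amalg> H) inl_func inr_func"
proof -
  have cat: "category G" "category H" "category (G \<amalg> H)"
    using G H groupoid_coprod[OF G H] by (simp_all add: groupoid_def)
  have inl: "component G (G \<amalg> H) inl_func"
  proof (intro component.intro component_axioms.intro)
    show "h \<in> range (FArr inl_func)" if "h \<in> Arr (G \<amalg> H)" "Dom (G \<amalg> H) h = FObj inl_func a" for h a
      using that by (cases h) (auto simp: inl_func_def)
    show "h \<in> range (FArr inl_func)" if "h \<in> Arr (G \<amalg> H)" "Cod (G \<amalg> H) h = FObj inl_func a" for h a
      using that by (cases h) (auto simp: inl_func_def)
  qed (use cat in \<open>auto simp: inl_func_def\<close>)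
  have inr: "component H (G \<amalg> H) inr_func"
  proof (intro component.intro component_axioms.intro)
    show "h \<in> range (FArr inr_func)" if "h \<in> Arr (G \<amalg> H)" "Dom (G \<amalg> H) h = FObj inr_func a" for h a
      using that by (cases h) (auto simp: inr_func_def)
    show "h \<in> range (FArr inr_func)" if "h \<in> Arr (G \<amalg> H)" "Cod (G \<amalg> H) h = FObj inr_func a" for h a
      using that by (cases h) (auto simp: inr_func_def)
  qed (use cat in \<open>auto simp: inr_func_def\<close>)
  show ?thesis
  proof (intro decomposition.intro decomposition_axioms.intro inl inr)
    show "c \<in> range (FObj inl_func) \<union> range (FObj inr_func)" for c :: "'o + 'p"
      by (cases c) (auto simp: inl_func_def inr_func_def)
  qed (simp add: inl_func_def inr_func_def)
qed

section \<open>The representing bi-sets\<close>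

text \<open>
  For a component \<open>J : G \<rightarrow> D\<close>, these are \<open>D(J -, -)\<close> and \<open>D(-, J -)\<close>, with their elements
  taken in \<open>G\<close>; off the component, they are empty.
\<close>

definition corep :: "('go, 'ga) cat \<Rightarrow> ('do, 'da) cat \<Rightarrow> ('go, 'ga, 'do, 'da) func \<Rightarrow>
    ('go, 'ga, 'do, 'da, 'ga) biset" where
  "corep G D J =
     \<lparr>FObj = (\<lambda>(a, c) \<in> Obj G \<times> Obj D. {x \<in> Arr G. Dom G x = a \<and> FObj J (Cod G x) = c}),
      FArr = (\<lambda>(h, d) \<in> Arr G \<times> Arr D.
        ({x \<in> Arr G. Dom G x = Cod G h \<and> FObj J (Cod G x) = Dom D d},
         (\<lambda>x \<in> {x \<in> Arr G. Dom G x = Cod G h \<and> FObj J (Cod G x) = Dom D d}.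
           Comp G (inv (FArr J) d) (Comp G x h)),
         {x \<in> Arr G. Dom G x = Dom G h \<and> FObj J (Cod G x) = Cod D d}))\<rparr>"

definition rep :: "('go, 'ga) cat \<Rightarrow> ('do, 'da) cat \<Rightarrow> ('go, 'ga, 'do, 'da) func \<Rightarrow>
    ('do, 'da, 'go, 'ga, 'ga) biset" where
  "rep G D J =
     \<lparr>FObj = (\<lambda>(c, a) \<in> Obj D \<times> Obj G. {x \<in> Arr G. FObj J (Dom G x) = c \<and> Cod G x = a}),
      FArr = (\<lambda>(d, g) \<in> Arr D \<times> Arr G.
        ({x \<in> Arr G. FObj J (Dom G x) = Cod D d \<and> Cod G x = Dom G g},
         (\<lambda>x \<in> {x \<in> Arr G. FObj J (Dom G x) = Cod D d \<and> Cod G x = Dom G g}.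
           Comp G g (Comp G x (inv (FArr J) d))),
         {x \<in> Arr G. FObj J (Dom G x) = Dom D d \<and> Cod G x = Cod G g}))\<rparr>"

text \<open>Over the other summand the condition \<open>Inl _ = Inr _\<close> fails, so the value of
  \<open>corep\<close> is empty and its action is the identity of the empty set, as prescribed in
  \<open>X1\<close>. The next three lemmas hold for the same reason.\<close>

lemma X1_eq: "X1 G H = corep G (G \<amalg> H) inl_func"
  by (auto simp: X1_def corep_def inl_func_def hom_map_def hom_def fun_eq_iff restrict_def
      inv_f_f split: sum.splits)

lemma X2_eq: "X2 G H = corep H (G \<amalg> H) inr_func"
  by (auto simp: X2_def corep_def inr_func_def hom_map_def hom_def fun_eq_iff restrict_def
      inv_f_f split: sum.splits)

lemma Y1_eq: "Y1 G H = rep G (G \<amalg> H) inl_func"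
  by (auto simp: Y1_def rep_def inl_func_def hom_map_def hom_def fun_eq_iff restrict_def
      inv_f_f split: sum.splits)

lemma Y2_eq: "Y2 G H = rep H (G \<amalg> H) inr_func"
  by (auto simp: Y2_def rep_def inr_func_def hom_map_def hom_def fun_eq_iff restrict_def
      inv_f_f split: sum.splits)

locale groupoid_component = G: groupoid G + D: groupoid D + component G D J
  for G :: "('go, 'ga) cat" and D :: "('do, 'da) cat" and J
begin

lemma inv_J [simp]: "inv (FArr J) (FArr J d) = d"
  using inv_f_f[OF inj_arr] .

lemma corep_obj:
  "a \<in> Obj G \<Longrightarrow> c \<in> Obj D \<Longrightarrow> x \<in> FObj (corep G D J) (a, c) \<longleftrightarrow> (\<exists>b. c = FObj J b \<and> x \<in> hom G a b)"
  by (auto simp: corep_def hom_def)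

lemma corep_act:
  assumes "h \<in> hom G a' a" "x \<in> hom G a b" "d \<in> hom G b b'"
  shows "act (corep G D J) (h, FArr J d) x = Comp G d (Comp G x h)"
  using assms by (simp add: corep_def hom_iff)

lemma rep_obj:
  "c \<in> Obj D \<Longrightarrow> a \<in> Obj G \<Longrightarrow> x \<in> FObj (rep G D J) (c, a) \<longleftrightarrow> (\<exists>b. c = FObj J b \<and> x \<in> hom G b a)"
  by (auto simp: rep_def hom_def)

lemma rep_act:
  assumes "d \<in> hom G b' b" "x \<in> hom G b a" "g \<in> hom G a a'"
  shows "act (rep G D J) (FArr J d, g) x = Comp G g (Comp G x d)"
  using assms by (simp add: rep_def hom_iff)

text \<open>A value is nonempty only over the component, and an arrow of \<open>D\<close> leaving
  the component stays in it (\<open>hom_from\<close>); all laws are thereby those of the hom functor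
  of \<open>G\<close>.\<close>

lemma corep_functor: "is_functor (prod_cat (op_cat G) D) set_cat (corep G D J)"
proof (rule set_functorI)
  let ?C = "prod_cat (op_cat G) D" and ?X = "corep G D J"
  show "category ?C" by (intro category_prod category_op G.category_axioms D.category_axioms)
  show "FArr ?X f = (FObj ?X p, restrict (act ?X f) (FObj ?X p), FObj ?X q)"
    if "f \<in> hom ?C p q" for f p q
    using that G.hom_obj D.hom_obj by (cases f; cases p; cases q) (auto simp: corep_def prod_hom hom_iff)
  show "act ?X f x \<in> FObj ?X q" if f: "f \<in> hom ?C p q" and x: "x \<in> FObj ?X p" for f p q x
  proof -
    obtain h d a c a' c' where [simp]: "f = (h, d)" "p = (a, c)" "q = (a', c')"
      by (cases f; cases p; cases q) blast
    have h: "h \<in> hom G a' a" and d: "d \<in> hom D c c'" using f by (auto simp: prod_hom)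
    obtain b where b: "c = FObj J b" "x \<in> hom G a b"
      using x G.hom_obj[OF h] D.hom_obj[OF d] corep_obj by auto
    obtain d' b' where d': "d = FArr J d'" "c' = FObj J b'" "d' \<in> hom G b b'"
      using hom_from d b by blast
    show ?thesis
      using corep_act[OF h b(2) d'(3)] d' G.Comp_in[OF G.Comp_in[OF h b(2)] d'(3)]
        corep_obj G.hom_obj[OF h] D.hom_obj[OF d] by auto
  qed
  show "act ?X (Id ?C p) x = x" if p: "p \<in> Obj ?C" and x: "x \<in> FObj ?X p" for p x
  proof -
    obtain a c where [simp]: "p = (a, c)" by (cases p)
    obtain b where b: "c = FObj J b" "x \<in> hom G a b"
      using x p corep_obj by auto
    have ab: "a \<in> Obj G" "b \<in> Obj G" using G.hom_obj[OF b(2)] by auto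
    show ?thesis
      using corep_act[OF G.Id_in[OF ab(1)] b(2) G.Id_in[OF ab(2)]] G.Comp_Id[OF b(2)]
        G.Id_Comp[OF b(2)] b by (simp add: Id_J)
  qed
  show "act ?X (Comp ?C g f) x = act ?X g (act ?X f x)"
    if f: "f \<in> hom ?C p q" and g: "g \<in> hom ?C q r" and x: "x \<in> FObj ?X p" for f g p q r x
  proof -
    obtain h d a c a' c' where [simp]: "f = (h, d)" "p = (a, c)" "q = (a', c')"
      by (cases f; cases p; cases q) blast
    obtain h' e a'' c'' where [simp]: "g = (h', e)" "r = (a'', c'')"
      by (cases g; cases r) blast
    have h: "h \<in> hom G a' a" and d: "d \<in> hom D c c'" using f by (auto simp: prod_hom)
    have h': "h' \<in> hom G a'' a'" and e: "e \<in> hom D c' c''" using g by (auto simp: prod_hom)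
    obtain b where b: "c = FObj J b" "x \<in> hom G a b"
      using x G.hom_obj[OF h] D.hom_obj[OF d] corep_obj by auto
    obtain d' b' where d': "d = FArr J d'" "c' = FObj J b'" "d' \<in> hom G b b'"
      using hom_from d b by blast
    obtain e' b'' where e': "e = FArr J e'" "c'' = FObj J b''" "e' \<in> hom G b' b''"
      using hom_from e d' by blast
    have xh: "Comp G x h \<in> hom G a' b" using G.Comp_in h b by blast
    have "Comp G (Comp G e' d') (Comp G x (Comp G h h')) =
        Comp G e' (Comp G (Comp G d' (Comp G x h)) h')"
      using G.Comp_assoc[OF h' h b(2)] G.Comp_assoc[OF G.Comp_in[OF h' xh] d'(3) e'(3)]
        G.Comp_assoc[OF h' xh d'(3)] by simp
    then show ?thesis
      using corep_act[OF h b(2) d'(3)] corep_act[OF h' G.Comp_in[OF xh d'(3)] e'(3)]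
        corep_act[OF G.Comp_in[OF h' h] b(2) G.Comp_in[OF d'(3) e'(3)]] d' e'
      by (simp add: Comp_J)
  qed
qed (auto simp: corep_def)

text \<open>The argument for \<open>corep\<close> with \<open>D\<close> in the contravariant place,
  so that arrows entering the component are the ones that matter (\<open>hom_to\<close>).\<close>

lemma rep_functor: "is_functor (prod_cat (op_cat D) G) set_cat (rep G D J)"
proof (rule set_functorI)
  let ?C = "prod_cat (op_cat D) G" and ?X = "rep G D J"
  show "category ?C" by (intro category_prod category_op G.category_axioms D.category_axioms)
  show "FArr ?X f = (FObj ?X p, restrict (act ?X f) (FObj ?X p), FObj ?X q)"
    if "f \<in> hom ?C p q" for f p q
    using that G.hom_obj D.hom_obj by (cases f; cases p; cases q) (auto simp: rep_def prod_hom hom_iff)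
  show "act ?X f x \<in> FObj ?X q" if f: "f \<in> hom ?C p q" and x: "x \<in> FObj ?X p" for f p q x
  proof -
    obtain g d a c a' c' where [simp]: "f = (d, g)" "p = (c, a)" "q = (c', a')"
      by (cases f; cases p; cases q) blast
    have g: "g \<in> hom G a a'" and d: "d \<in> hom D c' c" using f by (auto simp: prod_hom)
    obtain b where b: "c = FObj J b" "x \<in> hom G b a"
      using x G.hom_obj[OF g] D.hom_obj[OF d] rep_obj by auto
    obtain d' b' where d': "d = FArr J d'" "c' = FObj J b'" "d' \<in> hom G b' b"
      using hom_to d b by blast
    show ?thesis
      using rep_act[OF d'(3) b(2) g] d' G.Comp_in[OF G.Comp_in[OF d'(3) b(2)] g]
        rep_obj G.hom_obj[OF g] D.hom_obj[OF d] by auto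
  qed
  show "act ?X (Id ?C p) x = x" if p: "p \<in> Obj ?C" and x: "x \<in> FObj ?X p" for p x
  proof -
    obtain a c where [simp]: "p = (c, a)" by (cases p)
    obtain b where b: "c = FObj J b" "x \<in> hom G b a"
      using x p rep_obj by auto
    have ab: "b \<in> Obj G" "a \<in> Obj G" using G.hom_obj[OF b(2)] by auto
    show ?thesis
      using rep_act[OF G.Id_in[OF ab(1)] b(2) G.Id_in[OF ab(2)]] G.Comp_Id[OF b(2)]
        G.Id_Comp[OF b(2)] b by (simp add: Id_J)
  qed
  show "act ?X (Comp ?C g f) x = act ?X g (act ?X f x)"
    if f: "f \<in> hom ?C p q" and g: "g \<in> hom ?C q r" and x: "x \<in> FObj ?X p" for f g p q r x
  proof -
    obtain h d a c a' c' where [simp]: "f = (d, h)" "p = (c, a)" "q = (c', a')"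
      by (cases f; cases p; cases q) blast
    obtain h' e a'' c'' where [simp]: "g = (e, h')" "r = (c'', a'')"
      by (cases g; cases r) blast
    have h: "h \<in> hom G a a'" and d: "d \<in> hom D c' c" using f by (auto simp: prod_hom)
    have h': "h' \<in> hom G a' a''" and e: "e \<in> hom D c'' c'" using g by (auto simp: prod_hom)
    obtain b where b: "c = FObj J b" "x \<in> hom G b a"
      using x G.hom_obj[OF h] D.hom_obj[OF d] rep_obj by auto
    obtain d' b' where d': "d = FArr J d'" "c' = FObj J b'" "d' \<in> hom G b' b"
      using hom_to d b by blast
    obtain e' b'' where e': "e = FArr J e'" "c'' = FObj J b''" "e' \<in> hom G b'' b'"
      using hom_to e d' by blast
    have xd: "Comp G x d' \<in> hom G b' a" using G.Comp_in d' b by blast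
    have "Comp G (Comp G h' h) (Comp G x (Comp G d' e')) =
        Comp G h' (Comp G (Comp G h (Comp G x d')) e')"
      using G.Comp_assoc[OF e'(3) d'(3) b(2)] G.Comp_assoc[OF G.Comp_in[OF e'(3) xd] h h']
        G.Comp_assoc[OF e'(3) xd h] by simp
    then show ?thesis
      using rep_act[OF d'(3) b(2) h] rep_act[OF e'(3) G.Comp_in[OF xd h] h']
        rep_act[OF G.Comp_in[OF e'(3) d'(3)] b(2) G.Comp_in[OF h h']] d' e'
      by (simp add: Comp_J)
  qed
qed (auto simp: rep_def)

text \<open>Arrows of a groupoid are epimorphisms; this is the freeness of the representing
  bi-sets.\<close>

lemma right_cancel:
  assumes x: "x \<in> hom G a b" and g: "g \<in> hom G b c" "g' \<in> hom G b c"
    and eq: "Comp G g x = Comp G g' x"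
  shows "g = g'"
  using G.Comp_assoc[OF G.inverse_arr(1)[OF x] x g(1)] G.Comp_assoc[OF G.inverse_arr(1)[OF x] x g(2)]
    G.inverse_arr(3)[OF x] G.Comp_Id[OF g(1)] G.Comp_Id[OF g(2)] eq by simp

text \<open>By Yoneda the covariant functor represented by \<open>FObj J a\<close> is generated by
  the identity of \<open>a\<close>, and it is free by cancellation.\<close>

lemma admissible_corep: "admissible G D (corep G D J)"
proof -
  let ?X = "corep G D J"
  have "free_fin_gen D (\<lambda>c. FObj ?X (a, c)) (\<lambda>d. act ?X (Id G a, d))" if a: "a \<in> Obj G" for a
    unfolding free_fin_gen_def
  proof (intro conjI ballI exI[of _ "{(FObj J a, Id G a)}"])
    note I = G.Id_in[OF a]
    have act: "act ?X (Id G a, FArr J d) x = Comp G d x" if "x \<in> hom G a b" "d \<in> hom G b b'" for x d b b'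
      using corep_act[OF I that] G.Comp_Id[OF that(1)] by simp
    show "inj_on (\<lambda>d. act ?X (Id G a, d) x) (hom D c c')"
      if c: "c \<in> Obj D" and x: "x \<in> FObj ?X (a, c)" for c c' x
    proof (rule inj_onI)
      fix d d' assume d: "d \<in> hom D c c'" "d' \<in> hom D c c'"
        and eq: "act ?X (Id G a, d) x = act ?X (Id G a, d') x"
      obtain b where b: "c = FObj J b" "x \<in> hom G a b" using x corep_obj[OF a c] by blast
      obtain e b' where e: "d = FArr J e" "c' = FObj J b'" "e \<in> hom G b b'"
        using hom_from d(1) b by blast
      obtain e' where e': "d' = FArr J e'" "e' \<in> hom G b b'"
        using hom_from d(2) b e(2) by fastforce
      show "d = d'" using right_cancel[OF b(2) e(3) e'(2)] act[OF b(2)] e e' eq by simp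
    qed
    show "{(FObj J a, Id G a)} \<subseteq> (SIGMA c : Obj D. FObj ?X (a, c))"
      using a I corep_obj by auto
    show "\<exists>c x. (c, x) \<in> {(FObj J a, Id G a)} \<and> (\<exists>d \<in> hom D c c'. act ?X (Id G a, d) x = y)"
      if c': "c' \<in> Obj D" and y: "y \<in> FObj ?X (a, c')" for c' y
    proof -
      obtain b where b: "c' = FObj J b" "y \<in> hom G a b" using y corep_obj[OF a c'] by blast
      then show ?thesis using act[OF I b(2)] G.Comp_Id[OF b(2)]
        by (intro exI[of _ "FObj J a"] exI[of _ "Id G a"]) (auto intro!: bexI[of _ "FArr J y"])
    qed
  qed simp
  then show ?thesis
    using corep_functor by (simp add: admissible_iff[OF G.category_axioms D.groupoid_axioms])
qed

text \<open>Over an object of the component this is a representable \<open>G\<close>-set, generated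
  by an identity. Elsewhere it is empty, and the empty set of generators suffices.\<close>

lemma admissible_rep: "admissible D G (rep G D J)"
proof -
  let ?X = "rep G D J"
  have "free_fin_gen G (\<lambda>a. FObj ?X (c, a)) (\<lambda>g. act ?X (Id D c, g))" if c: "c \<in> Obj D" for c
  proof (cases "c \<in> range (FObj J)")
    case True
    then obtain b where b: "c = FObj J b" "b \<in> Obj G" using c by auto
    note I = G.Id_in[OF b(2)]
    have act: "act ?X (Id D c, g) x = Comp G g x" if "x \<in> hom G b a" "g \<in> hom G a a'" for x g a a'
      using rep_act[OF I that] G.Comp_Id[OF that(1)] b by (simp add: Id_J)
    have obj: "x \<in> FObj ?X (c, a) \<longleftrightarrow> x \<in> hom G b a" if "a \<in> Obj G" for a x
      using rep_obj[OF c that] b by auto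
    show ?thesis
      unfolding free_fin_gen_def
    proof (intro conjI ballI exI[of _ "{(b, Id G b)}"])
      show "inj_on (\<lambda>g. act ?X (Id D c, g) x) (hom G a a')"
        if "a \<in> Obj G" "x \<in> FObj ?X (c, a)" for a a' x
        using that right_cancel[of x b a] act obj by (auto simp: inj_on_def)
      show "{(b, Id G b)} \<subseteq> (SIGMA a : Obj G. FObj ?X (c, a))"
        using b I obj by auto
      show "\<exists>a x. (a, x) \<in> {(b, Id G b)} \<and> (\<exists>g \<in> hom G a a'. act ?X (Id D c, g) x = y)"
        if "a' \<in> Obj G" "y \<in> FObj ?X (c, a')" for a' y
        using that act[OF I] obj G.Comp_Id by auto
    qed simp
  next
    case False
    then have "FObj ?X (c, a) = {}" if "a \<in> Obj G" for a
      using rep_obj[OF c that] by auto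
    then show ?thesis
      unfolding free_fin_gen_def by (intro conjI exI[of _ "{}"]) auto
  qed
  then show ?thesis
    using rep_functor by (simp add: admissible_iff[OF D.category_axioms G.groupoid_axioms])
qed

end

section \<open>Tensor products with the representing bi-sets\<close>

text \<open>The two one-sided actions commute and together give the joint action. Tensor products
  are formed from one-sided actions, whereas functors on the product category use the joint
  one.\<close>

lemma biset_act_split:
  assumes X: "is_biset H G X" "category H" "category G"
    and h: "h \<in> hom H a b" and g: "g \<in> hom G c d" and x: "x \<in> FObj X (b, c)"
  shows "act X (h, Id G d) (act X (Id H b, g) x) = act X (h, g) x"
    and "act X (Id H a, g) (act X (h, Id G c) x) = act X (h, g) x"
proof -
  interpret H: category H by fact
  interpret G: category G by fact
  have obj: "a \<in> Obj H" "b \<in> Obj H" "c \<in> Obj G" "d \<in> Obj G" using H.hom_obj[OF h] G.hom_obj[OF g] by auto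
  show "act X (h, Id G d) (act X (Id H b, g) x) = act X (h, g) x"
    using bisetD(3)[OF X h H.Id_in[OF obj(2)] g G.Id_in[OF obj(4)] x] H.Id_Comp[OF h] G.Id_Comp[OF g]
    by simp
  show "act X (Id H a, g) (act X (h, Id G c) x) = act X (h, g) x"
    using bisetD(3)[OF X H.Id_in[OF obj(1)] h G.Id_in[OF obj(3)] g x] H.Comp_Id[OF h] G.Comp_Id[OF g]
    by simp
qed

text \<open>\<open>s\<close> followed by taking classes is injective because \<open>\<tau>\<close>
  is an invariant of classes that recovers \<open>z\<close>, and surjective because \<open>s\<close>
  applied to \<open>\<tau>\<close> is a normal form of every triple.\<close>

lemma tensor_bij:
  assumes s: "\<And>z. z \<in> S \<Longrightarrow> s z \<in> (SIGMA \<eta> : Obj H. FObj X \<eta> \<times> FObj Y \<eta>)"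
    and \<tau>s: "\<And>z. z \<in> S \<Longrightarrow> \<tau> (s z) = z"
    and \<tau>_eq: "\<And>p q. (p, q) \<in> tensor_rel H X Y \<Longrightarrow> \<tau> p = \<tau> q"
    and \<tau>: "\<And>\<eta> x y. \<eta> \<in> Obj H \<Longrightarrow> x \<in> FObj X \<eta> \<Longrightarrow> y \<in> FObj Y \<eta> \<Longrightarrow> \<tau> (\<eta>, x, y) \<in> S \<and>
      (s (\<tau> (\<eta>, x, y)), (\<eta>, x, y)) \<in> equiv_gen (tensor_rel H X Y)"
  shows "bij_betw (\<lambda>z. equiv_gen (tensor_rel H X Y) `` {s z}) S (tensor H X Y)"
  unfolding bij_betw_def
proof
  let ?E = "equiv_gen (tensor_rel H X Y)"
  show "inj_on (\<lambda>z. ?E `` {s z}) S"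
  proof (rule inj_onI)
    fix z z' assume z: "z \<in> S" "z' \<in> S" and "?E `` {s z} = ?E `` {s z'}"
    then have "\<tau> (s z) = \<tau> (s z')"
      unfolding equiv_gen_class_eq by (elim equiv_gen_const) (rule \<tau>_eq)
    then show "z = z'" using \<tau>s z by simp
  qed
  show "(\<lambda>z. ?E `` {s z}) ` S = tensor H X Y"
  proof
    show "(\<lambda>z. ?E `` {s z}) ` S \<subseteq> tensor H X Y"
      using s by (auto simp: tensor_def quotient_def)
    show "tensor H X Y \<subseteq> (\<lambda>z. ?E `` {s z}) ` S"
    proof
      fix c assume "c \<in> tensor H X Y"
      then obtain \<eta> x y where c: "c = ?E `` {(\<eta>, x, y)}" and p: "\<eta> \<in> Obj H" "x \<in> FObj X \<eta>" "y \<in> FObj Y \<eta>"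
        by (auto simp: tensor_def quotient_def)
      have "c = ?E `` {s (\<tau> (\<eta>, x, y))}"
        unfolding c equiv_gen_class_eq using \<tau>[OF p] equiv_equiv_gen by (meson equivE symD)
      then show "c \<in> (\<lambda>z. ?E `` {s z}) ` S" using \<tau>[OF p] by blast
    qed
  qed
qed

text \<open>The images of (x h, y) and (x, h y) are again related, by naturality of \<phi> and
  \<psi>, so all points of a class are sent into one class and saturation adds no second
  one.\<close>

lemma tensor_map_class:
  assumes \<phi>: "\<And>h x. h \<in> Arr H \<Longrightarrow> x \<in> FObj X (Cod H h) \<Longrightarrow> app (\<phi> (Cod H h)) x \<in> FObj X' (Cod H h) \<and>
      app (\<phi> (Dom H h)) (act X h x) = act X' h (app (\<phi> (Cod H h)) x)"
    and \<psi>: "\<And>h y. h \<in> Arr H \<Longrightarrow> y \<in> FObj Y (Dom H h) \<Longrightarrow> app (\<psi> (Dom H h)) y \<in> FObj Y' (Dom H h) \<and>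
      app (\<psi> (Cod H h)) (act Y h y) = act Y' h (app (\<psi> (Dom H h)) y)"
    and p: "\<eta> \<in> Obj H" "x \<in> FObj X \<eta>" "y \<in> FObj Y \<eta>"
  shows "app (tensor_map H X Y X' Y' \<phi> \<psi>) (equiv_gen (tensor_rel H X Y) `` {(\<eta>, x, y)}) =
    equiv_gen (tensor_rel H X' Y') `` {(\<eta>, app (\<phi> \<eta>) x, app (\<psi> \<eta>) y)}"
proof -
  let ?E = "equiv_gen (tensor_rel H X Y)" and ?E' = "equiv_gen (tensor_rel H X' Y')"
  let ?f = "\<lambda>(\<eta>, x, y). (\<eta>, app (\<phi> \<eta>) x, app (\<psi> \<eta>) y)"
  have rel: "(?f u, ?f v) \<in> ?E'" if uv: "(u, v) \<in> tensor_rel H X Y" for u v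
  proof -
    obtain h x y where h: "h \<in> Arr H" and x: "x \<in> FObj X (Cod H h)" and y: "y \<in> FObj Y (Dom H h)"
      and u: "u = (Dom H h, act X h x, y)" and v: "v = (Cod H h, x, act Y h y)"
      using uv by (auto simp: tensor_rel_def)
    show ?thesis
      using \<phi>[OF h x] \<psi>[OF h y] h unfolding u v
      by (intro equiv_gen_base(1)) (auto simp: tensor_rel_def)
  qed
  have "?E' `` (?f ` (?E `` {(\<eta>, x, y)})) = ?E' `` {?f (\<eta>, x, y)}"
  proof
    show "?E' `` {?f (\<eta>, x, y)} \<subseteq> ?E' `` (?f ` (?E `` {(\<eta>, x, y)}))"
      by (intro Image_mono) (force simp: equiv_gen_def)+
    show "?E' `` (?f ` (?E `` {(\<eta>, x, y)})) \<subseteq> ?E' `` {?f (\<eta>, x, y)}"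
    proof
      fix v assume "v \<in> ?E' `` (?f ` (?E `` {(\<eta>, x, y)}))"
      then obtain q where q: "((\<eta>, x, y), q) \<in> ?E" and v: "(?f q, v) \<in> ?E'"
        by blast
      have "(?f (\<eta>, x, y), ?f q) \<in> ?E'" by (rule equiv_gen_map[OF q rel])
      then show "v \<in> ?E' `` {?f (\<eta>, x, y)}"
        using v equiv_equiv_gen[of "tensor_rel H X' Y'"] by (auto elim!: equivE dest: transD)
    qed
  qed
  moreover have "?E `` {(\<eta>, x, y)} \<in> tensor H X Y"
    using p by (auto simp: tensor_def quotient_def)
  ultimately show ?thesis by (simp add: tensor_map_def)
qed

text \<open>The pure tensor of two elements. The outer objects \<open>a\<close> and \<open>c\<close>
  are arguments because the relation is formed from the slices of the bi-sets at these
  objects.\<close>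

definition tensor_class :: "('bo, 'ba) cat \<Rightarrow> ('ao, 'aa) cat \<Rightarrow> ('co, 'ca) cat \<Rightarrow>
    ('bo, 'ba, 'co, 'ca, 'u) biset \<Rightarrow> ('ao, 'aa, 'bo, 'ba, 'v) biset \<Rightarrow> 'ao \<Rightarrow> 'co \<Rightarrow>
    'bo \<times> 'u \<times> 'v \<Rightarrow> ('bo \<times> 'u \<times> 'v) set" where
  "tensor_class B A C X Y a c p = equiv_gen (tensor_rel B (lower B C X c) (upper A B Y a)) `` {p}"

locale three_categories = A: category A + B: category B + C: category C
  for A :: "('ao, 'aa) cat" and B :: "('bo, 'ba) cat" and C :: "('co, 'ca) cat"
begin

abbreviation (input) AC where "AC \<equiv> prod_cat (op_cat A) C"

lemma tensor_rel_iff: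
  "(p, q) \<in> tensor_rel B (lower B C X c) (upper A B Y a) \<longleftrightarrow>
    (\<exists>h b b' x y. h \<in> hom B b b' \<and> x \<in> FObj X (b', c) \<and> y \<in> FObj Y (a, b) \<and>
      p = (b, act X (h, Id C c) x, y) \<and> q = (b', x, act Y (Id A a, h) y))"
  by (fastforce simp: tensor_rel_def hom_def B.Dom_in B.Cod_in)

lemma tensor_class_eqI:
  assumes "h \<in> hom B b b'" "x \<in> FObj X (b', c)" "y \<in> FObj Y (a, b)"
  shows "tensor_class B A C X Y a c (b, act X (h, Id C c) x, y) =
    tensor_class B A C X Y a c (b', x, act Y (Id A a, h) y)"
  unfolding tensor_class_def equiv_gen_class_eq
  by (rule equiv_gen_base(1)) (use assms in \<open>auto simp: tensor_rel_iff\<close>)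

lemma tensor_class_bij:
  assumes s: "\<And>z. z \<in> S \<Longrightarrow> s z \<in> (SIGMA b : Obj B. FObj X (b, c) \<times> FObj Y (a, b))"
    and \<tau>s: "\<And>z. z \<in> S \<Longrightarrow> \<tau> (s z) = z"
    and \<tau>_eq: "\<And>h b b' x y. h \<in> hom B b b' \<Longrightarrow> x \<in> FObj X (b', c) \<Longrightarrow> y \<in> FObj Y (a, b) \<Longrightarrow>
      \<tau> (b, act X (h, Id C c) x, y) = \<tau> (b', x, act Y (Id A a, h) y)"
    and \<tau>: "\<And>b x y. b \<in> Obj B \<Longrightarrow> x \<in> FObj X (b, c) \<Longrightarrow> y \<in> FObj Y (a, b) \<Longrightarrow> \<tau> (b, x, y) \<in> S \<and>
      tensor_class B A C X Y a c (s (\<tau> (b, x, y))) = tensor_class B A C X Y a c (b, x, y)"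
  shows "bij_betw (\<lambda>z. tensor_class B A C X Y a c (s z)) S (tensor B (lower B C X c) (upper A B Y a))"
  unfolding tensor_class_def
proof (rule tensor_bij[where \<tau> = \<tau>])
  show "s z \<in> (SIGMA b : Obj B. FObj (lower B C X c) b \<times> FObj (upper A B Y a) b)" if "z \<in> S" for z
    using s[OF that] by auto
  show "\<tau> p = \<tau> q" if "(p, q) \<in> tensor_rel B (lower B C X c) (upper A B Y a)" for p q
    using that \<tau>_eq by (auto simp: tensor_rel_iff)
  show "\<tau> (b, x, y) \<in> S \<and> (s (\<tau> (b, x, y)), (b, x, y)) \<in>
      equiv_gen (tensor_rel B (lower B C X c) (upper A B Y a))"
    if "b \<in> Obj B" "x \<in> FObj (lower B C X c) b" "y \<in> FObj (upper A B Y a) b" for b x y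
    using \<tau>[of b x y] that unfolding tensor_class_def equiv_gen_class_eq by simp
qed (rule \<tau>s)

lemma biset_tensor_obj:
  "a \<in> Obj A \<Longrightarrow> c \<in> Obj C \<Longrightarrow>
    FObj (biset_tensor A B C X Y) (a, c) = tensor B (lower B C X c) (upper A B Y a)"
  by (simp add: biset_tensor_def)

lemma tensor_classE:
  assumes "w \<in> tensor B (lower B C X c) (upper A B Y a)"
  obtains b x y where "b \<in> Obj B" "x \<in> FObj X (b, c)" "y \<in> FObj Y (a, b)"
    "w = tensor_class B A C X Y a c (b, x, y)"
  using assms by (auto simp: tensor_def quotient_def tensor_class_def)

context
  fixes X :: "('bo, 'ba, 'co, 'ca, 'u) biset" and Y :: "('ao, 'aa, 'bo, 'ba, 'v) biset"
  assumes X: "is_biset B C X" and Y: "is_biset A B Y"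
begin

text \<open>The rule g (x \<otimes> y) f = g x \<otimes> y f. It is well defined because the outer
  actions commute with that of the middle groupoid, which is \<open>biset_act_split\<close> for each
  factor.\<close>

lemma biset_tensor_act:
  assumes f: "f \<in> hom A a' a" and g: "g \<in> hom C c c'"
    and b: "b \<in> Obj B" and x: "x \<in> FObj X (b, c)" and y: "y \<in> FObj Y (a, b)"
  shows "act (biset_tensor A B C X Y) (f, g) (tensor_class B A C X Y a c (b, x, y)) =
    tensor_class B A C X Y a' c' (b, act X (Id B b, g) x, act Y (f, Id B b) y)"
proof -
  note X' = X B.category_axioms C.category_axioms and Y' = Y A.category_axioms B.category_axioms
  have "act (biset_tensor A B C X Y) (f, g) = app (tensor_map B
      (lower B C X c) (upper A B Y a) (lower B C X c') (upper A B Y a')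
      (\<lambda>b. FArr X (Id B b, g)) (\<lambda>b. FArr Y (f, Id B b)))"
    using f g by (simp add: biset_tensor_def hom_iff)
  moreover have "app (tensor_map B
      (lower B C X c) (upper A B Y a) (lower B C X c') (upper A B Y a')
      (\<lambda>b. FArr X (Id B b, g)) (\<lambda>b. FArr Y (f, Id B b)))
      (equiv_gen (tensor_rel B (lower B C X c) (upper A B Y a)) `` {(b, x, y)}) =
    equiv_gen (tensor_rel B (lower B C X c') (upper A B Y a')) ``
      {(b, app (FArr X (Id B b, g)) x, app (FArr Y (f, Id B b)) y)}"
  proof (rule tensor_map_class)
    fix h assume h: "h \<in> Arr B"
    note h' = B.Arr_hom[OF h] and D = B.Dom_in[OF h] and E = B.Cod_in[OF h]
    show "act X (Id B (Cod B h), g) x \<in> FObj (lower B C X c') (Cod B h) \<and>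
      act X (Id B (Dom B h), g) (act (lower B C X c) h x) =
        act (lower B C X c') h (act X (Id B (Cod B h), g) x)"
      if "x \<in> FObj (lower B C X c) (Cod B h)" for x
      using that D E h bisetD(1)[OF X' B.Id_in[OF E] g, of x] biset_act_split[OF X' h' g, of x] by simp
    show "act Y (f, Id B (Dom B h)) y \<in> FObj (upper A B Y a') (Dom B h) \<and>
      act Y (f, Id B (Cod B h)) (act (upper A B Y a) h y) =
        act (upper A B Y a') h (act Y (f, Id B (Dom B h)) y)"
      if "y \<in> FObj (upper A B Y a) (Dom B h)" for y
      using that D E h bisetD(1)[OF Y' f B.Id_in[OF D], of y] biset_act_split[OF Y' f h', of y] by simp
  qed (use b x y in auto)
  ultimately show ?thesis by (simp add: tensor_class_def)
qed

text \<open>The functor laws of the tensor product are transported from the known functor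
  \<open>R\<close> along the same bijections that will form the isomorphism.\<close>

lemma biset_tensor_iso:
  assumes R: "is_functor AC set_cat R"
    and bij: "\<And>a c. a \<in> Obj A \<Longrightarrow> c \<in> Obj C \<Longrightarrow>
      bij_betw (t (a, c)) (FObj R (a, c)) (tensor B (lower B C X c) (upper A B Y a))"
    and nat: "\<And>f a a' g c c' z. f \<in> hom A a' a \<Longrightarrow> g \<in> hom C c c' \<Longrightarrow> z \<in> FObj R (a, c) \<Longrightarrow>
      act (biset_tensor A B C X Y) (f, g) (t (a, c) z) = t (a', c') (act R (f, g) z)"
  shows "is_functor AC set_cat (biset_tensor A B C X Y)" "set_iso AC R (biset_tensor A B C X Y) t"
proof -
  let ?T = "biset_tensor A B C X Y"
  have ext: "FObj ?T \<in> extensional (Obj AC)" "FArr ?T \<in> extensional (Arr AC)"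
    by (auto simp: biset_tensor_def)
  have bij': "bij_betw (t p) (FObj R p) (FObj ?T p)" if "p \<in> Obj AC" for p
    using bij that by (cases p) (auto simp: biset_tensor_obj)
  have arr: "FArr ?T m = (FObj ?T p, restrict (act ?T m) (FObj ?T p), FObj ?T q)"
    if "m \<in> hom AC p q" for m p q
    using that A.hom_obj C.hom_obj
    by (cases m; cases p; cases q) (auto simp: biset_tensor_def tensor_map_def prod_hom hom_iff)
  have nat': "act ?T m (t p z) = t q (act R m z)" if "m \<in> hom AC p q" "z \<in> FObj R p" for m p q z
    using that nat by (cases m; cases p; cases q) (auto simp: prod_hom)
  show "is_functor AC set_cat ?T" "set_iso AC R ?T t"
    by (rule set_functor_bij[OF R ext bij' arr nat']; assumption)+
qed

end

text \<open>Every element is a pure tensor, so the induced 2-cell is known from its values there.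
  Leaving \<open>m\<close> arbitrary allows any formula with these values, such as the conjugate in
  \<open>T_arr\<close>.\<close>

lemma biset_tensor_map_eq:
  assumes X: "is_biset B C X" and Y: "is_biset A B Y"
    and t: "set_iso (prod_cat (op_cat B) C) X X' t" and s: "set_iso (prod_cat (op_cat A) B) Y Y' s"
    and m: "\<And>a c b x y. a \<in> Obj A \<Longrightarrow> c \<in> Obj C \<Longrightarrow> b \<in> Obj B \<Longrightarrow> x \<in> FObj X (b, c) \<Longrightarrow>
      y \<in> FObj Y (a, b) \<Longrightarrow> m (a, c) (tensor_class B A C X Y a c (b, x, y)) =
        tensor_class B A C X' Y' a c (b, t (b, c) x, s (a, b) y)"
  shows "biset_tensor_map A B C (X, iso_family (prod_cat (op_cat B) C) X X' t, X')
      (Y, iso_family (prod_cat (op_cat A) B) Y Y' s, Y') =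
    (biset_tensor A B C X Y, iso_family AC (biset_tensor A B C X Y) (biset_tensor A B C X' Y') m,
      biset_tensor A B C X' Y')"
proof -
  let ?\<phi> = "\<lambda>c b. iso_family (prod_cat (op_cat B) C) X X' t (b, c)"
  let ?\<psi> = "\<lambda>a b. iso_family (prod_cat (op_cat A) B) Y Y' s (a, b)"
  let ?M = "\<lambda>a c. tensor_map B (lower B C X c) (upper A B Y a) (lower B C X' c) (upper A B Y' a)
    (?\<phi> c) (?\<psi> a)"
  have M: "app (?M a c) (tensor_class B A C X Y a c (b, x, y)) =
      tensor_class B A C X' Y' a c (b, t (b, c) x, s (a, b) y)"
    if a: "a \<in> Obj A" and c: "c \<in> Obj C" and b: "b \<in> Obj B" and x: "x \<in> FObj X (b, c)"
      and y: "y \<in> FObj Y (a, b)" for a c b x y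
  proof -
    have "app (?M a c) (equiv_gen (tensor_rel B (lower B C X c) (upper A B Y a)) `` {(b, x, y)}) =
      equiv_gen (tensor_rel B (lower B C X' c) (upper A B Y' a)) ``
        {(b, app (?\<phi> c b) x, app (?\<psi> a b) y)}"
    proof (rule tensor_map_class)
      fix h assume h: "h \<in> Arr B"
      note h' = B.Arr_hom[OF h] and D = B.Dom_in[OF h] and E = B.Cod_in[OF h]
      have hX: "(h, Id C c) \<in> hom (prod_cat (op_cat B) C) (Cod B h, c) (Dom B h, c)"
        and hY: "(Id A a, h) \<in> hom (prod_cat (op_cat A) B) (a, Dom B h) (a, Cod B h)"
        using h' C.Id_in[OF c] A.Id_in[OF a] by (simp_all add: prod_hom)
      show "app (?\<phi> c (Cod B h)) x \<in> FObj (lower B C X' c) (Cod B h) \<and>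
        app (?\<phi> c (Dom B h)) (act (lower B C X c) h x) =
          act (lower B C X' c) h (app (?\<phi> c (Cod B h)) x)"
        if "x \<in> FObj (lower B C X c) (Cod B h)" for x
        using that D E h c set_isoD(2)[OF t, of "(Cod B h, c)" x] set_isoD(3)[OF t hX, of x]
          bisetD(1)[OF X B.category_axioms C.category_axioms h' C.Id_in[OF c], of x] by simp
      show "app (?\<psi> a (Dom B h)) y \<in> FObj (upper A B Y' a) (Dom B h) \<and>
        app (?\<psi> a (Cod B h)) (act (upper A B Y a) h y) =
          act (upper A B Y' a) h (app (?\<psi> a (Dom B h)) y)"
        if "y \<in> FObj (upper A B Y a) (Dom B h)" for y
        using that D E h a set_isoD(2)[OF s, of "(a, Dom B h)" y] set_isoD(3)[OF s hY, of y]
          bisetD(1)[OF Y A.category_axioms B.category_axioms A.Id_in[OF a] h', of y] by simp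
    qed (use b x y in auto)
    then show ?thesis using a b c x y by (simp add: tensor_class_def)
  qed
  have "?M a c = (tensor B (lower B C X c) (upper A B Y a),
      restrict (m (a, c)) (tensor B (lower B C X c) (upper A B Y a)),
      tensor B (lower B C X' c) (upper A B Y' a))" if a: "a \<in> Obj A" and c: "c \<in> Obj C" for a c
  proof -
    let ?S = "tensor B (lower B C X c) (upper A B Y a)"
    have "?M a c = (?S, restrict (app (?M a c)) ?S, tensor B (lower B C X' c) (upper A B Y' a))"
      by (simp add: tensor_map_def)
    moreover have "app (?M a c) w = m (a, c) w" if "w \<in> ?S" for w
      using that by (rule tensor_classE) (use M m a c in simp)
    ultimately show ?thesis by (auto cong: restrict_cong)
  qed
  then show ?thesis
    by (auto simp: biset_tensor_map_def iso_family_def fun_eq_iff biset_tensor_obj)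
qed

end

lemma set_functors_admissible: "set_functors (prod_cat (op_cat H) G) (admissible H G)"
  by unfold_locales (simp add: admissible_def is_biset_def)

lemma admissible_iso':
  assumes H: "category H" and G: "groupoid G" and Y: "admissible H G Y"
    and X: "is_functor (prod_cat (op_cat H) G) set_cat X"
    and t: "set_iso (prod_cat (op_cat H) G) X Y t"
  shows "admissible H G X"
  using admissible_iso[OF H G Y X set_iso_inverse[OF X t]] .

lemma admissible_small:
  assumes H: "category H" and G: "groupoid G" and X: "admissible H G X"
    and a: "a \<in> Obj (prod_cat (op_cat H) G)"
    and inf: "infinite (UNIV :: 'u set)" and small: "\<And>a b. hom G a b \<lesssim> (UNIV :: 'u set)"
  shows "FObj X a \<lesssim> (UNIV :: 'u set)"
proof -
  obtain \<eta> \<gamma> where [simp]: "a = (\<eta>, \<gamma>)" by (cases a)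
  have "free_fin_gen G (\<lambda>\<gamma>. FObj X (\<eta>, \<gamma>)) (\<lambda>g. act X (Id H \<eta>, g))"
    using X a by (simp add: admissible_iff[OF H G])
  from free_fin_gen_small[OF this _ inf small] show ?thesis using a by simp
qed

section \<open>Co-Yoneda isomorphisms and tensoring as restriction\<close>

context groupoid_component
begin

text \<open>Restricting the contravariant variable keeps each \<open>K\<close>-set unchanged and
  merely selects some of them.\<close>

lemma free_fin_gen_res_fst:
  assumes \<eta>: "\<eta> \<in> Obj G"
  shows "free_fin_gen K (\<lambda>\<kappa>. FObj (comp_func (prod_cat (op_cat G) K) Z (func_on_fst J)) (\<eta>, \<kappa>))
      (\<lambda>g. act (comp_func (prod_cat (op_cat G) K) Z (func_on_fst J)) (Id G \<eta>, g)) \<longleftrightarrow>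
    free_fin_gen K (\<lambda>\<kappa>. FObj Z (FObj J \<eta>, \<kappa>)) (\<lambda>g. act Z (Id D (FObj J \<eta>), g))"
  using \<eta> G.Id_in[OF \<eta>]
  by (intro free_fin_gen_cong) (auto simp: comp_func_def Id_J hom_iff)

text \<open>Here the acting groupoid itself shrinks from \<open>D\<close> to the component, so this
  only rewrites the condition; relating it to \<open>D\<close> takes \<open>free_fin_gen_res\<close>
  or \<open>free_fin_gen_glue\<close>.\<close>

lemma free_fin_gen_res_snd:
  assumes K: "category K" and \<kappa>: "\<kappa> \<in> Obj K"
  shows "free_fin_gen G (\<lambda>\<eta>. FObj (comp_func (prod_cat (op_cat K) G) Z (func_on_snd J)) (\<kappa>, \<eta>))
      (\<lambda>g. act (comp_func (prod_cat (op_cat K) G) Z (func_on_snd J)) (Id K \<kappa>, g)) \<longleftrightarrow>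
    free_fin_gen G (\<lambda>\<eta>. FObj Z (\<kappa>, FObj J \<eta>)) (\<lambda>g. act Z (Id K \<kappa>, FArr J g))"
  using \<kappa> category.Id_in[OF K \<kappa>]
  by (intro free_fin_gen_cong) (auto simp: comp_func_def hom_iff)

text \<open>The co-Yoneda map z \<mapsto> z \<otimes> 1; its mirror image \<open>left_unit\<close>
  is z \<mapsto> 1 \<otimes> z.\<close>

definition right_unit :: "('ko, 'ka) cat \<Rightarrow> ('do, 'da, 'ko, 'ka, 'u) biset \<Rightarrow> 'go \<times> 'ko \<Rightarrow> 'u \<Rightarrow>
    ('do \<times> 'u \<times> 'ga) set" where
  "right_unit K Z = (\<lambda>(a, c) z. tensor_class D G K Z (corep G D J) a c (FObj J a, z, Id G a))"

definition left_unit :: "('ko, 'ka) cat \<Rightarrow> ('ko, 'ka, 'do, 'da, 'u) biset \<Rightarrow> 'ko \<times> 'go \<Rightarrow> 'u \<Rightarrow>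
    ('do \<times> 'ga \<times> 'u) set" where
  "left_unit K Z = (\<lambda>(a, c) z. tensor_class D K G (rep G D J) Z a c (FObj J c, Id G c, z))"

text \<open>The tensor relation moves \<open>x\<close> across: z x \<otimes> 1 = z \<otimes> x. Read
  backwards, it exhibits a preimage of every pure tensor.\<close>

lemma right_unit_class:
  fixes Z :: "('do, 'da, 'ko, 'ka, 'u) biset"
  assumes K: "category K"
    and x: "x \<in> hom G a b" and z: "z \<in> FObj Z (FObj J b, c)" and c: "c \<in> Obj K"
  shows "right_unit K Z (a, c) (act Z (FArr J x, Id K c) z) =
    tensor_class D G K Z (corep G D J) a c (FObj J b, z, x)"
proof -
  interpret K: category K by fact
  interpret GDK: three_categories G D K by unfold_locales
  have ab: "a \<in> Obj G" "b \<in> Obj G" using G.hom_obj[OF x] by auto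
  note I = G.Id_in[OF ab(1)]
  show ?thesis
    using GDK.tensor_class_eqI[of "FArr J x" "FObj J a" "FObj J b" z Z c "Id G a" "corep G D J" a]
      corep_act[OF I I x] G.Comp_Id[OF x] G.Comp_Id[OF I] corep_obj I ab x z
    by (simp add: right_unit_def)
qed

lemma left_unit_class:
  fixes Z :: "('ko, 'ka, 'do, 'da, 'u) biset"
  assumes K: "category K"
    and x: "x \<in> hom G b c" and z: "z \<in> FObj Z (a, FObj J b)" and a: "a \<in> Obj K"
  shows "left_unit K Z (a, c) (act Z (Id K a, FArr J x) z) =
    tensor_class D K G (rep G D J) Z a c (FObj J b, x, z)"
proof -
  interpret K: category K by fact
  interpret KDG: three_categories K D G by unfold_locales
  have bc: "b \<in> Obj G" "c \<in> Obj G" using G.hom_obj[OF x] by auto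
  note I = G.Id_in[OF bc(2)]
  show ?thesis
    using KDG.tensor_class_eqI[of "FArr J x" "FObj J b" "FObj J c" "Id G c" "rep G D J" c z Z a]
      rep_act[OF x I I] G.Id_Comp[OF x] rep_obj I bc x z
    by (simp add: left_unit_def)
qed

text \<open>Co-Yoneda for restriction: an element of \<open>corep\<close> exists only over the
  component, so in any pure tensor the middle object is some \<open>FObj J e\<close> and the arrow
  can be absorbed into \<open>Z\<close>.\<close>

lemma right_unit_iso:
  fixes Z :: "('do, 'da, 'ko, 'ka, 'u) biset"
  assumes K: "category K" and Z: "is_biset D K Z"
  defines "R \<equiv> comp_func (prod_cat (op_cat G) K) Z (func_on_fst J)"
  shows "is_functor (prod_cat (op_cat G) K) set_cat (biset_tensor G D K Z (corep G D J))"
    and "set_iso (prod_cat (op_cat G) K) R (biset_tensor G D K Z (corep G D J)) (right_unit K Z)"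
proof -
  interpret K: category K by fact
  interpret GDK: three_categories G D K by unfold_locales
  interpret J': component "prod_cat (op_cat G) K" "prod_cat (op_cat D) K" "func_on_fst J"
    by (rule component.component_fst[OF component_op K])
  let ?X = "corep G D J" and ?cl = "tensor_class D G K Z (corep G D J)"
  have X: "is_biset G D ?X" using corep_functor by (simp add: is_biset_def)
  note Z' = Z D.category_axioms K
  have R: "is_functor (prod_cat (op_cat G) K) set_cat R"
    unfolding R_def using Z by (intro J'.res_functor) (simp add: is_biset_def)
  have R_obj: "FObj R (a, c) = FObj Z (FObj J a, c)" if "a \<in> Obj G" "c \<in> Obj K" for a c
    using that by (simp add: R_def)
  note move = right_unit_class[OF K, unfolded right_unit_def prod.case]
  have bij: "bij_betw (right_unit K Z (a, c)) (FObj R (a, c)) (tensor D (lower D K Z c) (upper G D ?X a))"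
    if a: "a \<in> Obj G" and c: "c \<in> Obj K" for a c
    unfolding right_unit_def prod.case
  \<comment> \<open>The inverse sends z \<otimes> x to z x; it respects the tensor relation by
    associativity, (z h) x = z (h x).\<close>
  proof (rule GDK.tensor_class_bij[where \<tau> = "\<lambda>(b, z, x). act Z (FArr J x, Id K c) z"])
    show "(FObj J a, z, Id G a) \<in> (SIGMA b : Obj D. FObj Z (b, c) \<times> FObj ?X (a, b))"
      if "z \<in> FObj R (a, c)" for z
      using that a c R_obj corep_obj G.Id_in by auto
    show "(case (FObj J a, z, Id G a) of (b, z, x) \<Rightarrow> act Z (FArr J x, Id K c) z) = z"
      if "z \<in> FObj R (a, c)" for z
      using that a c R_obj bisetD(2)[OF Z', of "FObj J a" c z] by (simp add: Id_J)
    show "(case (b, act Z (h, Id K c) z, x) of (b, z, x) \<Rightarrow> act Z (FArr J x, Id K c) z) =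
        (case (b', z, act ?X (Id G a, h) x) of (b, z, x) \<Rightarrow> act Z (FArr J x, Id K c) z)"
      if h: "h \<in> hom D b b'" and z: "z \<in> FObj Z (b', c)" and x: "x \<in> FObj ?X (a, b)" for h b b' z x
    proof -
      obtain e where e: "b = FObj J e" "x \<in> hom G a e"
        using x corep_obj[OF a] D.hom_obj[OF h] by auto
      obtain h' e' where h': "h = FArr J h'" "b' = FObj J e'" "h' \<in> hom G e e'"
        using hom_from h e by blast
      show ?thesis
        using bisetD(3)[OF Z', of "FArr J x" "FObj J a" "FObj J e" h b' "Id K c" c c "Id K c" c z]
          corep_act[OF G.Id_in[OF a] e(2) h'(3)] G.Comp_Id[OF e(2)] K.Id_in[OF c] e h' z
          K.Comp_Id[OF K.Id_in[OF c]] by (simp add: Comp_J)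
    qed
    show "(case (b, z, x) of (b, z, x) \<Rightarrow> act Z (FArr J x, Id K c) z) \<in> FObj R (a, c) \<and>
        ?cl a c (FObj J a, (case (b, z, x) of (b, z, x) \<Rightarrow> act Z (FArr J x, Id K c) z), Id G a) =
          ?cl a c (b, z, x)"
      if b: "b \<in> Obj D" and z: "z \<in> FObj Z (b, c)" and x: "x \<in> FObj ?X (a, b)" for b z x
    proof -
      obtain e where e: "b = FObj J e" "x \<in> hom G a e"
        using x corep_obj[OF a b] by auto
      then show ?thesis
        using move[OF e(2)] bisetD(1)[OF Z', of "FArr J x" "FObj J a" b "Id K c" c c z]
          K.Id_in[OF c] z R_obj a c by simp
    qed
  qed
  \<comment> \<open>The computation is g (z \<otimes> 1) f = g z \<otimes> f = (g z) f \<otimes>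
    1.\<close>
  have nat: "act (biset_tensor G D K Z ?X) (f, g) (right_unit K Z (a, c) z) =
      right_unit K Z (a', c') (act R (f, g) z)"
    if f: "f \<in> hom G a' a" and g: "g \<in> hom K c c'" and z: "z \<in> FObj R (a, c)" for f g a a' c c' z
  proof -
    have obj: "a' \<in> Obj G" "a \<in> Obj G" "c \<in> Obj K" "c' \<in> Obj K"
      using G.hom_obj[OF f] K.hom_obj[OF g] by auto
    note I = G.Id_in[OF obj(2)]
    have z': "z \<in> FObj Z (FObj J a, c)" using z R_obj obj by simp
    have "act (biset_tensor G D K Z ?X) (f, g) (?cl a c (FObj J a, z, Id G a)) =
        ?cl a' c' (FObj J a, act Z (Id D (FObj J a), g) z, f)"
      using GDK.biset_tensor_act[OF Z X f g _ z'] corep_obj corep_act[OF f I I] G.Id_Comp[OF f]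
        G.Id_Comp[OF f] I obj by (simp add: Id_J)
    also have "\<dots> = ?cl a' c' (FObj J a', act Z (FArr J f, Id K c') (act Z (Id D (FObj J a), g) z), Id G a')"
      using move[OF f _ obj(4), symmetric] bisetD(1)[OF Z' D.Id_in g z'] obj by simp
    also have "\<dots> = ?cl a' c' (FObj J a', act R (f, g) z, Id G a')"
      using biset_act_split(1)[OF Z' _ g z', of "FArr J f" "FObj J a'"] f g
      by (simp add: R_def hom_iff)
    finally show ?thesis by (simp add: right_unit_def)
  qed
  show "is_functor (prod_cat (op_cat G) K) set_cat (biset_tensor G D K Z ?X)"
    "set_iso (prod_cat (op_cat G) K) R (biset_tensor G D K Z ?X) (right_unit K Z)"
    by (rule GDK.biset_tensor_iso[OF Z X R bij nat]; assumption)+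
qed

text \<open>The mirror image of \<open>right_unit_iso\<close>: the inverse is x \<otimes> z
  \<mapsto> x z, and naturality is g (1 \<otimes> z) f = g \<otimes> z f = 1 \<otimes> g (z
  f).\<close>

lemma left_unit_iso:
  fixes Z :: "('ko, 'ka, 'do, 'da, 'u) biset"
  assumes K: "category K" and Z: "is_biset K D Z"
  defines "R \<equiv> comp_func (prod_cat (op_cat K) G) Z (func_on_snd J)"
  shows "is_functor (prod_cat (op_cat K) G) set_cat (biset_tensor K D G (rep G D J) Z)"
    and "set_iso (prod_cat (op_cat K) G) R (biset_tensor K D G (rep G D J) Z) (left_unit K Z)"
proof -
  interpret K: category K by fact
  interpret KDG: three_categories K D G by unfold_locales
  interpret J': component "prod_cat (op_cat K) G" "prod_cat (op_cat K) D" "func_on_snd J"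
    by (rule component_snd[OF category_op[OF K]])
  let ?X = "rep G D J" and ?cl = "tensor_class D K G (rep G D J) Z"
  have X: "is_biset D G ?X" using rep_functor by (simp add: is_biset_def)
  note Z' = Z K D.category_axioms
  have R: "is_functor (prod_cat (op_cat K) G) set_cat R"
    unfolding R_def using Z by (intro J'.res_functor) (simp add: is_biset_def)
  have R_obj: "FObj R (a, c) = FObj Z (a, FObj J c)" if "a \<in> Obj K" "c \<in> Obj G" for a c
    using that by (simp add: R_def)
  note move = left_unit_class[OF K, unfolded left_unit_def prod.case]
  have bij: "bij_betw (left_unit K Z (a, c)) (FObj R (a, c)) (tensor D (lower D G ?X c) (upper K D Z a))"
    if a: "a \<in> Obj K" and c: "c \<in> Obj G" for a c
    unfolding left_unit_def prod.case
  proof (rule KDG.tensor_class_bij[where \<tau> = "\<lambda>(b, x, z). act Z (Id K a, FArr J x) z"])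
    show "(FObj J c, Id G c, z) \<in> (SIGMA b : Obj D. FObj ?X (b, c) \<times> FObj Z (a, b))"
      if "z \<in> FObj R (a, c)" for z
      using that a c R_obj rep_obj G.Id_in by auto
    show "(case (FObj J c, Id G c, z) of (b, x, z) \<Rightarrow> act Z (Id K a, FArr J x) z) = z"
      if "z \<in> FObj R (a, c)" for z
      using that a c R_obj bisetD(2)[OF Z', of a "FObj J c" z] by (simp add: Id_J)
    show "(case (b, act ?X (h, Id G c) x, z) of (b, x, z) \<Rightarrow> act Z (Id K a, FArr J x) z) =
        (case (b', x, act Z (Id K a, h) z) of (b, x, z) \<Rightarrow> act Z (Id K a, FArr J x) z)"
      if h: "h \<in> hom D b b'" and x: "x \<in> FObj ?X (b', c)" and z: "z \<in> FObj Z (a, b)" for h b b' z x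
    proof -
      obtain e' where e': "b' = FObj J e'" "x \<in> hom G e' c"
        using x rep_obj[OF _ c] D.hom_obj[OF h] by auto
      obtain h' e where h': "h = FArr J h'" "b = FObj J e" "h' \<in> hom G e e'"
        using hom_to h e' by blast
      show ?thesis
        using bisetD(3)[OF Z', of "Id K a" a a "Id K a" a h b b' "FArr J x" "FObj J c" z]
          rep_act[OF h'(3) e'(2) G.Id_in[OF c]] G.Id_Comp[OF G.Comp_in[OF h'(3) e'(2)]] K.Id_in[OF a]
          e' h' z K.Comp_Id[OF K.Id_in[OF a]] by (simp add: Comp_J)
    qed
    show "(case (b, x, z) of (b, x, z) \<Rightarrow> act Z (Id K a, FArr J x) z) \<in> FObj R (a, c) \<and>
        ?cl a c (FObj J c, Id G c, (case (b, x, z) of (b, x, z) \<Rightarrow> act Z (Id K a, FArr J x) z)) =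
          ?cl a c (b, x, z)"
      if b: "b \<in> Obj D" and x: "x \<in> FObj ?X (b, c)" and z: "z \<in> FObj Z (a, b)" for b z x
    proof -
      obtain e where e: "b = FObj J e" "x \<in> hom G e c"
        using x rep_obj[OF b c] by auto
      then show ?thesis
        using move[OF e(2)] bisetD(1)[OF Z', of "Id K a" a a "FArr J x" b "FObj J c" z]
          K.Id_in[OF a] z R_obj a c by simp
    qed
  qed
  have nat: "act (biset_tensor K D G ?X Z) (f, g) (left_unit K Z (a, c) z) =
      left_unit K Z (a', c') (act R (f, g) z)"
    if f: "f \<in> hom K a' a" and g: "g \<in> hom G c c'" and z: "z \<in> FObj R (a, c)" for f g a a' c c' z
  proof -
    have obj: "a' \<in> Obj K" "a \<in> Obj K" "c \<in> Obj G" "c' \<in> Obj G"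
      using K.hom_obj[OF f] G.hom_obj[OF g] by auto
    note I = G.Id_in[OF obj(3)]
    have z': "z \<in> FObj Z (a, FObj J c)" using z R_obj obj by simp
    have "act (biset_tensor K D G ?X Z) (f, g) (?cl a c (FObj J c, Id G c, z)) =
        ?cl a' c' (FObj J c, g, act Z (f, Id D (FObj J c)) z)"
      using KDG.biset_tensor_act[OF X Z f g _ _ z'] rep_obj rep_act[OF I I g] G.Comp_Id[OF g]
        G.Comp_Id[OF I] I obj by (simp add: Id_J)
    also have "\<dots> = ?cl a' c' (FObj J c', Id G c', act Z (Id K a', FArr J g) (act Z (f, Id D (FObj J c)) z))"
      using move[OF g _ obj(1), symmetric] bisetD(1)[OF Z' f D.Id_in z'] obj by simp
    also have "\<dots> = ?cl a' c' (FObj J c', Id G c', act R (f, g) z)"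
      using biset_act_split(2)[OF Z' f _ z', of "FArr J g" "FObj J c'"] f g
      by (simp add: R_def hom_iff)
    finally show ?thesis by (simp add: left_unit_def)
  qed
  show "is_functor (prod_cat (op_cat K) G) set_cat (biset_tensor K D G ?X Z)"
    "set_iso (prod_cat (op_cat K) G) R (biset_tensor K D G ?X Z) (left_unit K Z)"
    by (rule KDG.biset_tensor_iso[OF X Z R bij nat]; assumption)+
qed

text \<open>\<open>admissible G K\<close> occurs both over the type of the tensor products and over
  \<open>'u\<close>. Smallness of values comes from the hom-sets of \<open>K\<close>, the groupoid
  acting covariantly.\<close>

lemma restriction_right:
  fixes K :: "('ko, 'ka) cat"
  assumes K: "groupoid K" and inf: "infinite (UNIV :: 'u set)"
    and small: "\<And>a b. hom K a b \<lesssim> (UNIV :: 'u set)"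
  shows "restriction (prod_cat (op_cat G) K) (prod_cat (op_cat D) K) (func_on_fst J)
    (admissible D K :: ('do, 'da, 'ko, 'ka, 'u) biset \<Rightarrow> bool) (admissible G K) (admissible G K)
    (tensor_on_right G D K (corep G D J)) (right_unit K)"
proof -
  interpret K: groupoid K by fact
  let ?C1 = "prod_cat (op_cat G) K" and ?C = "prod_cat (op_cat D) K" and ?X = "corep G D J"
  interpret J': component ?C1 ?C "func_on_fst J"
    by (rule component.component_fst[OF component_op K.category_axioms])
  interpret GDK: three_categories G D K by unfold_locales
  have Z_functor: "is_functor ?C set_cat Z" "is_biset D K Z" if "admissible D K Z"
    for Z :: "('do, 'da, 'ko, 'ka, 'u) biset"
    using that by (auto simp: admissible_def is_biset_def)
  have X: "is_biset G D ?X" using corep_functor by (simp add: is_biset_def)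
  have T_obj: "FObj (tensor_on_right G D K ?X) Z = biset_tensor G D K Z ?X" if "admissible D K Z"
    for Z :: "('do, 'da, 'ko, 'ka, 'u) biset"
    using that by (simp add: tensor_on_right_def BB_def)
  note unit = right_unit_iso[OF K.category_axioms Z_functor(2)]
  interpret dom: set_functors ?C "admissible D K :: ('do, 'da, 'ko, 'ka, 'u) biset \<Rightarrow> bool"
    by (rule set_functors_admissible)
  interpret X: set_functors "prod_cat (op_cat G) D" "admissible G D :: ('go, 'ga, 'do, 'da, 'ga) biset \<Rightarrow> bool"
    by (rule set_functors_admissible)
  show ?thesis
  proof (intro restriction.intro restriction_axioms.intro set_functors_admissible J'.component_axioms)
    fix Z :: "('do, 'da, 'ko, 'ka, 'u) biset" assume Z: "admissible D K Z"
    show "admissible G K (J'.res Z)"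
      using Z J'.res_functor[OF Z_functor(1)[OF Z]]
      unfolding admissible_iff[OF G.category_axioms K] admissible_iff[OF D.category_axioms K]
      by (auto intro: iffD2[OF free_fin_gen_res_fst])
    show "is_functor ?C1 set_cat (FObj (tensor_on_right G D K ?X) Z)"
      "set_iso ?C1 (J'.res Z) (FObj (tensor_on_right G D K ?X) Z) (right_unit K Z)"
      unfolding T_obj[OF Z] using unit[OF Z] by auto
    fix Z' :: "('do, 'da, 'ko, 'ka, 'u) biset" and r
    assume Z': "admissible D K Z'" and r: "set_iso ?C Z Z' r"
    have "FArr (tensor_on_right G D K ?X) (Z, iso_family ?C Z Z' r, Z') =
        biset_tensor_map G D K (Z, iso_family ?C Z Z' r, Z')
          (?X, iso_family (prod_cat (op_cat G) D) ?X ?X (\<lambda>a x. x), ?X)"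
    proof -
      have "(Z, iso_family ?C Z Z' r, Z') \<in> hom (BB D K) Z Z'"
        unfolding BB_eq dom.iso_cat_hom using Z Z' r by blast
      then show ?thesis
        by (simp add: tensor_on_right_def hom_iff BB_eq X.iso_cat_Id)
    qed
    also have "\<dots> = (biset_tensor G D K Z ?X, iso_family ?C1 (biset_tensor G D K Z ?X)
        (biset_tensor G D K Z' ?X) (\<lambda>a y. right_unit K Z' a (r (FObj (func_on_fst J) a)
          (inv_into (FObj (J'.res Z) a) (right_unit K Z a) y))), biset_tensor G D K Z' ?X)"
    proof (rule GDK.biset_tensor_map_eq[OF Z_functor(2)[OF Z] X r X.set_iso_id[OF admissible_corep]])
      \<comment> \<open>Since z \<otimes> x = z x \<otimes> 1, its preimage under
        \<open>right_unit\<close> is z x. Naturality of \<open>r\<close> gives r(z x) = r(z) x, and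
        this is mapped to r(z) \<otimes> x.\<close>
      fix a c b z x assume a: "a \<in> Obj G" and c: "c \<in> Obj K" and b: "b \<in> Obj D"
        and z: "z \<in> FObj Z (b, c)" and x: "x \<in> FObj ?X (a, b)"
      obtain e where e: "b = FObj J e" "x \<in> hom G a e" using x corep_obj[OF a b] by auto
      let ?w = "tensor_class D G K Z ?X a c (b, z, x)" and ?z = "act Z (FArr J x, Id K c) z"
      have Jx: "(FArr J x, Id K c) \<in> hom ?C (b, c) (FObj J a, c)"
        using e K.Id_in[OF c] by (simp add: prod_hom)
      have z': "?z \<in> FObj Z (FObj J a, c)" and rz: "r (b, c) z \<in> FObj Z' (b, c)"
        and r_z: "r (FObj J a, c) ?z = act Z' (FArr J x, Id K c) (r (b, c) z)"
        using set_functorD(5)[OF Z_functor(1)[OF Z] Jx z] set_isoD(2)[OF r _ z] set_isoD(3)[OF r Jx z] b c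
        by auto
      have w: "?w = right_unit K Z (a, c) ?z"
        using right_unit_class[OF K.category_axioms e(2) _ c, of z] z e by simp
      have "inv_into (FObj (J'.res Z) (a, c)) (right_unit K Z (a, c)) ?w = ?z"
        unfolding w using set_isoD(1)[OF unit(2)[OF Z], of "(a, c)"] a c z'
        by (intro bij_betw_inv_into_left) auto
      then show "right_unit K Z' (a, c) (r (FObj (func_on_fst J) (a, c))
          (inv_into (FObj (J'.res Z) (a, c)) (right_unit K Z (a, c)) ?w)) =
        tensor_class D G K Z' ?X a c (b, r (b, c) z, x)"
        using right_unit_class[OF K.category_axioms e(2) _ c, of "r (b, c) z"] rz r_z e
        by simp
    qed
    finally show "FArr (tensor_on_right G D K ?X) (Z, iso_family ?C Z Z' r, Z') =
      (FObj (tensor_on_right G D K ?X) Z, iso_family ?C1 (FObj (tensor_on_right G D K ?X) Z)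
        (FObj (tensor_on_right G D K ?X) Z') (\<lambda>a y. right_unit K Z' a (r (FObj (func_on_fst J) a)
          (inv_into (FObj (J'.res Z) a) (right_unit K Z a) y))), FObj (tensor_on_right G D K ?X) Z')"
      unfolding T_obj[OF Z] T_obj[OF Z'] .
  qed (use admissible_iso[OF G.category_axioms K] admissible_iso'[OF G.category_axioms K]
      admissible_small[OF G.category_axioms K _ _ inf small] in blast)+
qed

text \<open>The covariantly acting groupoid is now \<open>G\<close>, so its hom-sets bound the
  values, and admissibility of the restriction requires selecting the generators over the
  component.\<close>

lemma restriction_left:
  fixes K :: "('ko, 'ka) cat"
  assumes K: "category K" and inf: "infinite (UNIV :: 'u set)"
    and small: "\<And>a b. hom G a b \<lesssim> (UNIV :: 'u set)"
  shows "restriction (prod_cat (op_cat K) G) (prod_cat (op_cat K) D) (func_on_snd J)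
    (admissible K D :: ('ko, 'ka, 'do, 'da, 'u) biset \<Rightarrow> bool) (admissible K G) (admissible K G)
    (tensor_on_left K D G (rep G D J)) (left_unit K)"
proof -
  interpret K: category K by fact
  let ?C1 = "prod_cat (op_cat K) G" and ?C = "prod_cat (op_cat K) D" and ?X = "rep G D J"
  interpret J': component ?C1 ?C "func_on_snd J"
    by (rule component_snd[OF category_op[OF K]])
  interpret KDG: three_categories K D G by unfold_locales
  have Z_functor: "is_functor ?C set_cat Z" "is_biset K D Z" if "admissible K D Z"
    for Z :: "('ko, 'ka, 'do, 'da, 'u) biset"
    using that by (auto simp: admissible_def is_biset_def)
  have X: "is_biset D G ?X" using rep_functor by (simp add: is_biset_def)
  have T_obj: "FObj (tensor_on_left K D G ?X) Z = biset_tensor K D G ?X Z" if "admissible K D Z"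
    for Z :: "('ko, 'ka, 'do, 'da, 'u) biset"
    using that by (simp add: tensor_on_left_def BB_def)
  note unit = left_unit_iso[OF K Z_functor(2)]
  interpret dom: set_functors ?C "admissible K D :: ('ko, 'ka, 'do, 'da, 'u) biset \<Rightarrow> bool"
    by (rule set_functors_admissible)
  interpret X: set_functors "prod_cat (op_cat D) G" "admissible D G :: ('do, 'da, 'go, 'ga, 'ga) biset \<Rightarrow> bool"
    by (rule set_functors_admissible)
  show ?thesis
  proof (intro restriction.intro restriction_axioms.intro set_functors_admissible J'.component_axioms)
    fix Z :: "('ko, 'ka, 'do, 'da, 'u) biset" assume Z: "admissible K D Z"
    have "free_fin_gen G (\<lambda>\<gamma>. FObj (J'.res Z) (\<kappa>, \<gamma>)) (\<lambda>g. act (J'.res Z) (Id K \<kappa>, g))"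
      if "\<kappa> \<in> Obj K" for \<kappa>
      unfolding free_fin_gen_res_snd[OF K that]
      by (rule free_fin_gen_res[of "\<lambda>\<gamma>. FObj Z (\<kappa>, \<gamma>)" "\<lambda>g. act Z (Id K \<kappa>, g)"])
        (use Z that in \<open>simp add: admissible_iff[OF K D.groupoid_axioms]\<close>)
    then show "admissible K G (J'.res Z)"
      using J'.res_functor[OF Z_functor(1)[OF Z]]
      by (simp add: admissible_iff[OF K G.groupoid_axioms])
    show "is_functor ?C1 set_cat (FObj (tensor_on_left K D G ?X) Z)"
      "set_iso ?C1 (J'.res Z) (FObj (tensor_on_left K D G ?X) Z) (left_unit K Z)"
      unfolding T_obj[OF Z] using unit[OF Z] by auto
    fix Z' :: "('ko, 'ka, 'do, 'da, 'u) biset" and r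
    assume Z': "admissible K D Z'" and r: "set_iso ?C Z Z' r"
    have "FArr (tensor_on_left K D G ?X) (Z, iso_family ?C Z Z' r, Z') =
        biset_tensor_map K D G (?X, iso_family (prod_cat (op_cat D) G) ?X ?X (\<lambda>a x. x), ?X)
          (Z, iso_family ?C Z Z' r, Z')"
    proof -
      have "(Z, iso_family ?C Z Z' r, Z') \<in> hom (BB K D) Z Z'"
        unfolding BB_eq dom.iso_cat_hom using Z Z' r by blast
      then show ?thesis
        by (simp add: tensor_on_left_def hom_iff BB_eq X.iso_cat_Id)
    qed
    also have "\<dots> = (biset_tensor K D G ?X Z, iso_family ?C1 (biset_tensor K D G ?X Z)
        (biset_tensor K D G ?X Z') (\<lambda>a y. left_unit K Z' a (r (FObj (func_on_snd J) a)
          (inv_into (FObj (J'.res Z) a) (left_unit K Z a) y))), biset_tensor K D G ?X Z')"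
    proof (rule KDG.biset_tensor_map_eq[OF X Z_functor(2)[OF Z] X.set_iso_id[OF admissible_rep] r])
      \<comment> \<open>Here x \<otimes> z = 1 \<otimes> x z has preimage x z, and r(x z) = x r(z)
        is mapped to x \<otimes> r(z).\<close>
      fix a c b x z assume a: "a \<in> Obj K" and c: "c \<in> Obj G" and b: "b \<in> Obj D"
        and x: "x \<in> FObj ?X (b, c)" and z: "z \<in> FObj Z (a, b)"
      obtain e where e: "b = FObj J e" "x \<in> hom G e c" using x rep_obj[OF b c] by auto
      let ?w = "tensor_class D K G ?X Z a c (b, x, z)" and ?z = "act Z (Id K a, FArr J x) z"
      have Jx: "(Id K a, FArr J x) \<in> hom ?C (a, b) (a, FObj J c)"
        using e K.Id_in[OF a] by (simp add: prod_hom)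
      have z': "?z \<in> FObj Z (a, FObj J c)" and rz: "r (a, b) z \<in> FObj Z' (a, b)"
        and r_z: "r (a, FObj J c) ?z = act Z' (Id K a, FArr J x) (r (a, b) z)"
        using set_functorD(5)[OF Z_functor(1)[OF Z] Jx z] set_isoD(2)[OF r _ z] set_isoD(3)[OF r Jx z] b a
        by auto
      have w: "?w = left_unit K Z (a, c) ?z"
        using left_unit_class[OF K e(2) _ a, of z] z e by simp
      have "inv_into (FObj (J'.res Z) (a, c)) (left_unit K Z (a, c)) ?w = ?z"
        unfolding w using set_isoD(1)[OF unit(2)[OF Z], of "(a, c)"] a c z'
        by (intro bij_betw_inv_into_left) auto
      then show "left_unit K Z' (a, c) (r (FObj (func_on_snd J) (a, c))
          (inv_into (FObj (J'.res Z) (a, c)) (left_unit K Z (a, c)) ?w)) =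
        tensor_class D K G ?X Z' a c (b, x, r (a, b) z)"
        using left_unit_class[OF K e(2) _ a, of "r (a, b) z"] rz r_z e
        by simp
    qed
    finally show "FArr (tensor_on_left K D G ?X) (Z, iso_family ?C Z Z' r, Z') =
      (FObj (tensor_on_left K D G ?X) Z, iso_family ?C1 (FObj (tensor_on_left K D G ?X) Z)
        (FObj (tensor_on_left K D G ?X) Z') (\<lambda>a y. left_unit K Z' a (r (FObj (func_on_snd J) a)
          (inv_into (FObj (J'.res Z) a) (left_unit K Z a) y))), FObj (tensor_on_left K D G ?X) Z')"
      unfolding T_obj[OF Z] T_obj[OF Z'] .
  qed (use admissible_iso[OF K G.groupoid_axioms] admissible_iso'[OF K G.groupoid_axioms]
      admissible_small[OF K G.groupoid_axioms _ _ inf small] in blast)+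
qed

end

section \<open>The disjoint union as coproduct and product\<close>

theorem mainTheorem6:
  fixes G :: "('go, 'ga) cat" and H :: "('ho, 'ha) cat" and K :: "('ko, 'ka) cat"
  assumes G: "groupoid G" and H: "groupoid H" and K: "groupoid K"
    and universe: "infinite (UNIV :: 'u set)"
    and G_small: "\<And>a b. hom G a b \<lesssim> (UNIV :: 'u set)"
    and H_small: "\<And>a b. hom H a b \<lesssim> (UNIV :: 'u set)"
    and K_small: "\<And>a b. hom K a b \<lesssim> (UNIV :: 'u set)"
  shows "admissible G (G \<amalg> H) (X1 G H) \<and> admissible H (G \<amalg> H) (X2 G H) \<and>
    admissible (G \<amalg> H) G (Y1 G H) \<and> admissible (G \<amalg> H) H (Y2 G H) \<and>
    is_equivalence
      (BB (G \<amalg> H) K :: ('go + 'ho, 'ga + 'ha, 'ko, 'ka, 'u) biset_cat)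
      (prod_cat (BB G K) (BB H K))
      (pair_func (BB (G \<amalg> H) K)
        (tensor_on_right G (G \<amalg> H) K (X1 G H))
        (tensor_on_right H (G \<amalg> H) K (X2 G H))) \<and>
    is_equivalence
      (BB K (G \<amalg> H) :: ('ko, 'ka, 'go + 'ho, 'ga + 'ha, 'u) biset_cat)
      (prod_cat (BB K G) (BB K H))
      (pair_func (BB K (G \<amalg> H))
        (tensor_on_left K (G \<amalg> H) G (Y1 G H))
        (tensor_on_left K (G \<amalg> H) H (Y2 G H)))"
proof -
  let ?D = "G \<amalg> H"
  have D: "groupoid ?D" using G H by (rule groupoid_coprod)
  interpret GH: decomposition G H ?D inl_func inr_func
    using G H by (rule decomposition_coprod)
  interpret L: groupoid_component G ?D inl_func
    by (intro groupoid_component.intro G D GH.J1.component_axioms)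
  interpret R: groupoid_component H ?D inr_func
    by (intro groupoid_component.intro H D GH.J2.component_axioms)
  have cat: "category G" "category H" "category ?D" and K': "category K"
    using G H D K by (simp_all add: groupoid_def)
  \<comment> \<open>The base category is the opposite of G \<amalg> H times \<open>K\<close>,
    decomposed by \<open>decomposition_op\<close> followed by \<open>decomposition_fst\<close>. Each
    admissibility predicate for a part occurs twice: first over the type of the tensor products,
    then over \<open>'u\<close>.\<close>
  interpret right: decomposed_restriction "prod_cat (op_cat G) K" "prod_cat (op_cat H) K"
    "prod_cat (op_cat ?D) K" "func_on_fst inl_func" "func_on_fst inr_func"
    "admissible ?D K :: ('go + 'ho, 'ga + 'ha, 'ko, 'ka, 'u) biset \<Rightarrow> bool"
    "admissible G K" "admissible H K" "admissible G K" "admissible H K"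
    "tensor_on_right G ?D K (corep G ?D inl_func)" "tensor_on_right H ?D K (corep H ?D inr_func)"
    "L.right_unit K" "R.right_unit K"
  proof (intro decomposed_restriction.intro decomposed_restriction_axioms.intro
      decomposition.decomposition_fst GH.decomposition_op K'
      L.restriction_right R.restriction_right K universe K_small)
    fix Z :: "('go + 'ho, 'ga + 'ha, 'ko, 'ka, 'u) biset"
    assume Z: "is_functor (prod_cat (op_cat ?D) K) set_cat Z"
      and 1: "admissible G K (comp_func (prod_cat (op_cat G) K) Z (func_on_fst inl_func))"
      and 2: "admissible H K (comp_func (prod_cat (op_cat H) K) Z (func_on_fst inr_func))"
    \<comment> \<open>The condition concerns one object of G \<amalg> H at a time, and that object
      lies in one of the summands.\<close>
    have "free_fin_gen K (\<lambda>\<kappa>. FObj Z (\<eta>, \<kappa>)) (\<lambda>g. act Z (Id ?D \<eta>, g))" if "\<eta> \<in> Obj ?D" for \<eta>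
      using that 1 2 unfolding admissible_iff[OF cat(1) K] admissible_iff[OF cat(2) K]
      by (cases rule: GH.Obj_cases)
        (auto dest: iffD1[OF L.free_fin_gen_res_fst] iffD1[OF R.free_fin_gen_res_fst])
    then show "admissible ?D K Z" using Z by (simp add: admissible_iff[OF cat(3) K])
  qed
  interpret left: decomposed_restriction "prod_cat (op_cat K) G" "prod_cat (op_cat K) H"
    "prod_cat (op_cat K) ?D" "func_on_snd inl_func" "func_on_snd inr_func"
    "admissible K ?D :: ('ko, 'ka, 'go + 'ho, 'ga + 'ha, 'u) biset \<Rightarrow> bool"
    "admissible K G" "admissible K H" "admissible K G" "admissible K H"
    "tensor_on_left K ?D G (rep G ?D inl_func)" "tensor_on_left K ?D H (rep H ?D inr_func)"
    "L.left_unit K" "R.left_unit K"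
  proof (intro decomposed_restriction.intro decomposed_restriction_axioms.intro
      GH.decomposition_snd category_op K'
      L.restriction_left R.restriction_left universe G_small H_small)
    fix Z :: "('ko, 'ka, 'go + 'ho, 'ga + 'ha, 'u) biset"
    assume Z: "is_functor (prod_cat (op_cat K) ?D) set_cat Z"
      and 1: "admissible K G (comp_func (prod_cat (op_cat K) G) Z (func_on_snd inl_func))"
      and 2: "admissible K H (comp_func (prod_cat (op_cat K) H) Z (func_on_snd inr_func))"
    \<comment> \<open>For fixed \<kappa> the set over G \<amalg> H is made up of a
      \<open>G\<close>-set and an \<open>H\<close>-set, whose finite generating sets are
      joined.\<close>
    have "free_fin_gen ?D (\<lambda>\<eta>. FObj Z (\<kappa>, \<eta>)) (\<lambda>g. act Z (Id K \<kappa>, g))" if "\<kappa> \<in> Obj K" for \<kappa>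
      using that 1 2 unfolding admissible_iff[OF K' G] admissible_iff[OF K' H]
      by (intro GH.free_fin_gen_glue)
        (auto dest: iffD1[OF L.free_fin_gen_res_snd[OF K']] iffD1[OF R.free_fin_gen_res_snd[OF K']])
    then show "admissible K ?D Z" using Z by (simp add: admissible_iff[OF K' D])
  qed
  show ?thesis
    unfolding BB_eq X1_eq X2_eq Y1_eq Y2_eq
    by (intro conjI L.admissible_corep R.admissible_corep L.admissible_rep R.admissible_rep
        right.equivalence left.equivalence)
qed

end
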